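(* Let $X$ be an upwards skip-free Lévy chain on $\mathbb{Z}_h$, and write $\overline{\mathbb{C}^{\rightarrow}}=\{z\in\mathbb{C}:\Re z\ge0\}$. (i) Let $p>0$. For every $\alpha\ge0$ and $\beta\in\overline{\mathbb{C}^{\rightarrow}}$: $$\mathsf{E}[\exp\{-\alpha\overline{G}^*_{e_p}-\beta\overline{X}_{e_p}\}]=\frac{1-e^{-\Phi(p)h}}{1-e^{-(\beta+\Phi(p+\alpha))h}}$$ and $$\mathsf{E}[\exp\{-\alpha\underline{G}_{e_p}+\beta\underline{X}_{e_p}\}]=\frac{p}{p+\alpha-\psi(\beta)}\cdot\frac{1-e^{(\beta-\Phi(p+\alpha))h}}{1-e^{-\Phi(p)h}},$$ the latter whenever $p+\alpha\ne\psi(\beta)$; for the unique real $\beta_0>0$ such that $\psi(\beta_0)=p+\alpha$, i.e. for $\beta=\beta_0=\Phi(p+\alpha)$, the right-hand side is to be replaced by $\frac{ph}{\psi'(\beta_0)(1-e^{-\Phi(p)h})}=\frac{ph\,\Phi'(p+\alpha)}{1-e^{-\Phi(p)h}}$. (ii) There exist constants $k^*,\hat k\in(0,\infty)$ such that for every $\alpha>0$ and $\beta\in\overline{\mathbb{C}^{\rightarrow}}$: $$\kappa^*(\alpha,\beta)=k^*\left(1-e^{-(\beta+\Phi(\alpha))h}\right)$$ and $$\hat\kappa(\alpha,\beta)=\hat k\,\frac{\alpha-\psi(\beta)}{1-e^{(\beta-\Phi(\alpha))h}},$$ the latter whenever $\alpha\ne\psi(\beta)$; for the unique real $\beta_0>0$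 such that $\psi(\beta_0)=\alpha$, i.e. for $\beta=\beta_0=\Phi(\alpha)$, the right-hand side is to be replaced by $\hat k\psi'(\beta_0)/h=\frac{\hat k}{h\Phi'(\alpha)}$.
   Context: Fix $h>0$; $\mathbb{Z}_h:=\{hk:k\in\mathbb{Z}\}$. $X$ is a Lévy process (càdlàg paths, $X_0=0$ a.s.) on a filtered probability space $(\Omega,\mathcal{F},\mathbb{F},\mathsf{P})$ satisfying the usual conditions, adapted to $\mathbb{F}$ and with independent increments relative to $\mathbb{F}$. It is an upwards skip-free Lévy chain: a compound Poisson process (finite Lévy measure $\lambda$, no drift, no Gaussian part) with $\lambda$ supported in $\mathbb{Z}_h$ and with $\lambda|_{(0,\infty)}$ having support exactly $\{h\}$ (so $\lambda(\{h\})>0$). $\psi(\beta)=\int_{\mathbb{R}}(e^{\beta x}-1)\lambda(dx)$ ($\Re\beta\ge0$) is the Laplace exponent, $\mathsf{E}[e^{\beta X_t}]=e^{t\psi(\beta)}$. On $[0,\infty)$, $\psi$ is strictly convex and continuous and tends to $+\infty$; $\Phi(0)$ is the largest root of $\psi|_{[0,\infty)}$, and $\Phi:[0,\infty)\to[\Phi(0),\infty)$ is the inverse of the increasing bijection $\psi:[\Phi(0),\infty)\to[0,\infty)$. $\overline{X}_t:=\sup\{X_s:s\in[0,t]\}$, $\underline{X}_t:=\inf\{X_s:s\in[0,t]\}$, $\overline{G}^*_t:=\inf\{s\in[0,t]:X_s=\overline{X}_t\}$, $\underline{G}_t:=\sup\{s\in[0,t]:X_s=\underline{X}_s\}$. For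 $p>0$, $e_p$ is an exponential random variable with rate $p$ (mean $1/p$), independent of $X$. $\kappa^*$ and $\hat\kappa$ (the functions determining the Wiener-Hopf factors of $X$) are defined, up to arbitrary fixed multiplicative constants $c^*,\hat c\in(0,\infty)$, for $\Re\alpha>0$, $\Re\beta\ge0$, by $$\kappa^*(\alpha,\beta):=c^*\exp\left(\int_0^\infty\int_{(0,\infty)}(e^{-t}-e^{-\alpha t-\beta x})\frac1t\,\mathsf{P}(X_t\in dx)\,dt\right),$$ $$\hat\kappa(\alpha,\beta):=\hat c\exp\left(\int_0^\infty\int_{(-\infty,0]}(e^{-t}-e^{-\alpha t+\beta x})\frac1t\,\mathsf{P}(X_t\in dx)\,dt\right).$$ *)

theory Defs
  imports "HOL-Probability.Probability"
begin

section \<open>Filtered probability spaces and Levy processes\<close>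

text \<open>
  The time axis is \<open>[0,\<infinity>)\<close>; families indexed by \<^typ>\<open>real\<close> are only ever used at
  nonnegative times. To reuse the filtration locale, \<open>F\<close> is frozen at \<open>F 0\<close> before time \<open>0\<close>.
\<close>

locale usual_filtered_prob_space = prob_space M + complete_measure M
  for M :: "'a measure" +
  fixes F :: "real \<Rightarrow> 'a measure"
  assumes filtration: "filtration (space M) (\<lambda>t. F (max 0 t))"
    and sets_F_subset: "\<And>t. 0 \<le> t \<Longrightarrow> sets (F t) \<subseteq> sets M"
    and null_sets_F: "null_sets M \<subseteq> sets (F 0)"
    and right_continuous_F: "\<And>t. 0 \<le> t \<Longrightarrow> (\<Inter>s\<in>{t<..}. sets (F s)) = sets (F t)"

definition cadlag :: "(real \<Rightarrow> real) \<Rightarrow> bool" where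
  "cadlag x \<longleftrightarrow>
     (\<forall>t\<ge>0. continuous (at_right t) x) \<and> (\<forall>t>0. \<exists>l. (x \<longlongrightarrow> l) (at_left t))"

locale levy_process = usual_filtered_prob_space M F
  for M :: "'a measure" and F :: "real \<Rightarrow> 'a measure" +
  fixes X :: "real \<Rightarrow> 'a \<Rightarrow> real"
  assumes adapted: "\<And>t. 0 \<le> t \<Longrightarrow> X t \<in> borel_measurable (F t)"
    and cadlag_paths: "\<And>\<omega>. \<omega> \<in> space M \<Longrightarrow> cadlag (\<lambda>t. X t \<omega>)"
    and start: "AE \<omega> in M. X 0 \<omega> = 0"
    and indep_increments: "\<And>s t. 0 \<le> s \<Longrightarrow> s \<le> t \<Longrightarrow>
          prob_space.indep_set M (sets (F s))
            (sets (vimage_algebra (space M) (\<lambda>\<omega>. X t \<omega> - X s \<omega>) borel))"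
    and stationary_increments: "\<And>s t. 0 \<le> s \<Longrightarrow> s \<le> t \<Longrightarrow>
          distr M borel (\<lambda>\<omega>. X t \<omega> - X s \<omega>) = distr M borel (X (t - s))"

text \<open>
  A compound Poisson process is a Levy process with finite Levy measure \<open>\<nu>\<close> and neither drift nor
  Gaussian part, i.e. whose Levy--Khintchine exponent is \<open>u \<mapsto> \<integral> (exp (iux) - 1) \<nu>(dx)\<close>.
\<close>

locale compound_poisson_process = levy_process M F X + finite_measure \<nu>
  for M :: "'a measure" and F :: "real \<Rightarrow> 'a measure" and X :: "real \<Rightarrow> 'a \<Rightarrow> real"
    and \<nu> :: "real measure" +
  assumes sets_levy_measure: "sets \<nu> = sets borel"
    and levy_measure_0: "emeasure \<nu> {0} = 0"
    and char_exponent: "\<And>t u. 0 \<le> t \<Longrightarrow>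
          char (distr M borel (X t)) u = exp (complex_of_real t * (\<integral>x. (iexp (u * x) - 1) \<partial>\<nu>))"

definition measure_support :: "'a::topological_space measure \<Rightarrow> 'a set" where
  "measure_support N =
     {x \<in> space N. \<forall>U. open U \<longrightarrow> x \<in> U \<longrightarrow> emeasure N (U \<inter> space N) > 0}"

locale upwards_skip_free_levy_chain = compound_poisson_process M F X \<nu>
  for M :: "'a measure" and F :: "real \<Rightarrow> 'a measure" and X :: "real \<Rightarrow> 'a \<Rightarrow> real"
    and \<nu> :: "real measure" +
  fixes h :: real
  assumes h_pos: "h > 0"
    and support_lattice: "measure_support \<nu> \<subseteq> {h * of_int k | k :: int. True}"
    and support_positive: "measure_support (restrict_space \<nu> {0<..}) = {h}"


section \<open>The Laplace exponent and its right inverse\<close>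

text \<open>
  Polymorphic, so that it serves both as \<open>\<psi>\<close> on the closed right half-plane
  and as the real function \<open>\<psi>\<close> on \<open>[0,\<infinity>)\<close>.
\<close>

definition laplace_exponent ::
    "real measure \<Rightarrow> 'b::{real_normed_field,banach,second_countable_topology} \<Rightarrow> 'b" where
  "laplace_exponent \<nu> \<beta> = (\<integral>x. (exp (\<beta> * of_real x) - 1) \<partial>\<nu>)"

lemma laplace_exponent_of_real:
  "laplace_exponent \<nu> (complex_of_real b) = complex_of_real (laplace_exponent \<nu> b)"
proof -
  have "laplace_exponent \<nu> (complex_of_real b) = (\<integral>x. complex_of_real (exp (b * x) - 1) \<partial>\<nu>)"
    unfolding laplace_exponent_def by (simp add: exp_of_real flip: of_real_mult)
  also have "\<dots> = complex_of_real (laplace_exponent \<nu> b)"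
    unfolding integral_complex_of_real laplace_exponent_def by simp
  finally show ?thesis .
qed

definition largest_root :: "real measure \<Rightarrow> real" where
  "largest_root \<nu> = (GREATEST b. 0 \<le> b \<and> laplace_exponent \<nu> b = 0)"

definition Phi :: "real measure \<Rightarrow> real \<Rightarrow> real" where
  "Phi \<nu> = inv_into {largest_root \<nu>..} (laplace_exponent \<nu>)"


section \<open>Running extrema and the times at which they are attained\<close>

definition running_sup :: "(real \<Rightarrow> 'a \<Rightarrow> real) \<Rightarrow> real \<Rightarrow> 'a \<Rightarrow> real" where
  "running_sup X t \<omega> = (SUP s\<in>{0..t}. X s \<omega>)"

definition running_inf :: "(real \<Rightarrow> 'a \<Rightarrow> real) \<Rightarrow> real \<Rightarrow> 'a \<Rightarrow> real" where
  "running_inf X t \<omega> = (INF s\<in>{0..t}. X s \<omega>)"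

definition first_sup_time :: "(real \<Rightarrow> 'a \<Rightarrow> real) \<Rightarrow> real \<Rightarrow> 'a \<Rightarrow> real" where
  "first_sup_time X t \<omega> = Inf {s \<in> {0..t}. X s \<omega> = running_sup X t \<omega>}"

definition last_inf_time :: "(real \<Rightarrow> 'a \<Rightarrow> real) \<Rightarrow> real \<Rightarrow> 'a \<Rightarrow> real" where
  "last_inf_time X t \<omega> = Sup {s \<in> {0..t}. X s \<omega> = running_inf X s \<omega>}"

definition independent_exponential ::
    "'a measure \<Rightarrow> (real \<Rightarrow> 'a \<Rightarrow> real) \<Rightarrow> real \<Rightarrow> ('a \<Rightarrow> real) \<Rightarrow> bool" where
  "independent_exponential M X p e \<longleftrightarrow>
     distributed M lborel e (exponential_density p) \<and>
     prob_space.indep_set M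
       (sets (vimage_algebra (space M) e borel))
       (sets (vimage_algebra (space M) (\<lambda>\<omega>. \<lambda>t\<in>{0..}. X t \<omega>) (\<Pi>\<^sub>M t\<in>{0..}. borel)))"


section \<open>The functions determining the Wiener--Hopf factors\<close>

text \<open>The first argument is the arbitrary multiplicative normalisation constant.\<close>

definition kappa_star ::
    "real \<Rightarrow> 'a measure \<Rightarrow> (real \<Rightarrow> 'a \<Rightarrow> real) \<Rightarrow> complex \<Rightarrow> complex \<Rightarrow> complex" where
  "kappa_star c M X \<alpha> \<beta> = of_real c * exp
     (LINT t:{0<..}|lborel. LINT x:{0<..}|distr M borel (X t).
        (exp (- of_real t) - exp (- \<alpha> * of_real t - \<beta> * of_real x)) * (1 / of_real t))"

definition kappa_hat ::
    "real \<Rightarrow> 'a measure \<Rightarrow> (real \<Rightarrow> 'a \<Rightarrow> real) \<Rightarrow> complex \<Rightarrow> complex \<Rightarrow> complex" where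
  "kappa_hat c M X \<alpha> \<beta> = of_real c * exp
     (LINT t:{0<..}|lborel. LINT x:{..0}|distr M borel (X t).
        (exp (- of_real t) - exp (- \<alpha> * of_real t + \<beta> * of_real x)) * (1 / of_real t))"

end

theory Submission
  imports Defs "HOL-Complex_Analysis.Complex_Analysis" "HOL-Real_Asymp.Real_Asymp"
begin

text \<open>
  By Levy uniqueness \<open>X t\<close> has the law of \<open>h (N - I)\<close> with \<open>N\<close> Poisson and \<open>I\<close> a sum of \<open>N\<close>
  independent copies of a variable on the natural numbers. Write \<open>B\<close> for its generating function,
  \<open>\<lambda>\<close> for the total mass of \<open>\<nu>\<close>, \<open>w = exp (- \<beta> h)\<close> and \<open>w0 r = exp (- \<Phi>(r) h)\<close>, so that
  \<open>w (r - \<psi> \<beta>) = (r + \<lambda>) w - \<lambda> B w\<close> vanishes at \<open>w0 r\<close>.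

  Part (i): sampled on the grid of mesh \<open>1 / m\<close>, the maximum and its first argument of a
  geometrically killed walk satisfy Lindley's one-step recursion, and likewise the minimum and its
  last argument. As \<open>m\<close> grows the grid functionals converge pathwise, because the paths are cadlag
  and lattice valued, and the recursions become
  \<open>(r + \<lambda>) \<pi> k = \<lambda> (\<Sum>i. b i * \<pi> (k - 1 + i))\<close> with \<open>r = p + \<alpha>\<close>. For the supremum (\<open>k > 0\<close>) the
  bounded solution is geometric with ratio \<open>w0 r\<close>; for the infimum (\<open>k < 0\<close>) the generating function
  times \<open>(r + \<lambda>) w - \<lambda> B w\<close> is affine in \<open>w\<close> and vanishes at \<open>w0 r\<close>. Neither the boundary weight of
  the supremum nor the source term of the infimum depends on \<open>\<alpha>\<close>, so \<open>\<alpha> = 0\<close> fixes the constants.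

  Part (ii): expanding over the Poisson variable turns the exponents into series over the jump
  chain. Kemperman's formula sums the upward part to a logarithm of \<open>1 - w0 \<alpha> * w\<close>. On the
  unit circle both parts add up to a logarithm of \<open>\<alpha> - \<psi>\<close>, which determines the downward part there
  and, by the maximum modulus principle, on the whole disc.
\<close>

section \<open>Probability generating functions and Kemperman's formula\<close>

text \<open>The grid reduces path functionals to increments at deterministic times. For exponential
  \<open>e\<close> the number of cells, the ceiling of \<open>m * e\<close>, is geometric on the
  positive integers, so after its first step the sampled walk either stops or starts afresh; this
  closes the recursions. Two jumps in one cell have probability of order \<open>1 / m^2\<close>, so
  only the empty cell and the single jump survive multiplication by \<open>m\<close>; killing,
  discounting and jumping add up to the rate \<open>p + \<alpha> + \<lambda>\<close>. The boundary
  terms lose \<alpha> for a pathwise reason: a supremum equal to 0 is first attained at time 0, and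
  the source of the infimum recursion comes from walks whose last minimum is at grid time 0, which
  are not discounted. In part (ii) the upward series at \<open>1 / w\<close> and the downward series
  at \<open>w\<close> have only the circle \<open>|w| = 1\<close> in common. The term
  \<open>exp (- t)\<close> in both exponents is the case \<open>\<alpha> = 1\<close>,
  \<open>\<beta> = 0\<close>; it produces the constants \<open>k_star = c_star / (1 - w0 1)\<close>
  and \<open>k_hat = c_hat * (1 - w0 1)\<close>. The identities for the infimum and for
  \<open>kappa_hat\<close> are proved multiplied out, so that the exceptional \<beta> is reached by
  comparing derivatives at a common zero.\<close>

lemma powser_unit_disc:
  fixes a :: "nat \<Rightarrow> real"
  assumes a: "summable (\<lambda>n. \<bar>a n\<bar>)"
  shows continuous_on_powser_cball:
      "continuous_on (cball 0 1) (\<lambda>w::'b::{real_normed_field,banach}. \<Sum>n. of_real (a n) * w ^ n)"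
    and powser_differentiable: "norm (v::'b) < 1 \<Longrightarrow>
      \<exists>D. ((\<lambda>w. \<Sum>n. of_real (a n) * w ^ n) has_field_derivative D) (at v)"
proof -
  have b: "norm (of_real (a n) * w ^ n) \<le> \<bar>a n\<bar>" if "norm w \<le> 1" for n and w :: 'b
    using that by (auto simp: norm_mult norm_power intro!: mult_left_le power_le_one)
  have "uniform_limit (cball 0 1) (\<lambda>n w. \<Sum>i<n. of_real (a i) * w ^ i)
          (\<lambda>w::'b. \<Sum>i. of_real (a i) * w ^ i) sequentially"
    by (rule Weierstrass_m_test[OF _ a]) (use b in auto)
  then show "continuous_on (cball 0 1) (\<lambda>w::'b. \<Sum>n. of_real (a n) * w ^ n)"
    by (rule uniform_limit_theorem[rotated]) (auto intro!: always_eventually continuous_intros)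
  have "summable (\<lambda>n. of_real (a n) * (1::'b) ^ n)"
    by (rule summable_norm_cancel) (use a in simp)
  note deriv = termdiffs_strong[OF this]
  show "\<exists>D. ((\<lambda>w. \<Sum>n. of_real (a n) * w ^ n) has_field_derivative D) (at v)" if "norm v < 1"
  proof -
    have "norm v < norm (1::'b)" using that by simp
    from deriv[OF this] show ?thesis by (rule exI)
  qed
qed

lemma powser_holomorphic:
  fixes a :: "nat \<Rightarrow> real"
  assumes "summable (\<lambda>n. \<bar>a n\<bar>)"
  shows "(\<lambda>w::complex. \<Sum>n. of_real (a n) * w ^ n) holomorphic_on (ball 0 1)"
  unfolding holomorphic_on_def field_differentiable_def
proof
  fix v :: complex assume "v \<in> ball 0 1"
  then obtain D where "((\<lambda>w. \<Sum>n. of_real (a n) * w ^ n) has_field_derivative D) (at v)"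
    using powser_differentiable[OF assms, of v] by auto
  then show "\<exists>D. ((\<lambda>w. \<Sum>n. of_real (a n) * w ^ n) has_field_derivative D) (at v within ball 0 1)"
    using has_field_derivative_at_within by blast
qed

lemma pmf_nat_expectation_sums:
  fixes f :: "nat \<Rightarrow> 'b::{banach, second_countable_topology}"
  assumes "\<And>i. norm (f i) \<le> C"
  shows "(\<lambda>i. pmf p i *\<^sub>R f i) sums (\<integral>i. f i \<partial>measure_pmf p)"
proof -
  have int: "integrable (measure_pmf p) f"
    by (rule measure_pmf.integrable_const_bound[where B=C]) (use assms in auto)
  then have "integrable (count_space UNIV) (\<lambda>i. pmf p i *\<^sub>R f i)"
    unfolding measure_pmf_eq_density by (subst (asm) integrable_density) auto
  then have "(\<lambda>i. pmf p i *\<^sub>R f i) sums (\<integral>i. pmf p i *\<^sub>R f i \<partial>count_space UNIV)"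
    by (rule sums_integral_count_space_nat)
  also have "(\<integral>i. pmf p i *\<^sub>R f i \<partial>count_space UNIV) = (\<integral>i. f i \<partial>measure_pmf p)"
    unfolding measure_pmf_eq_density by (subst integral_density) auto
  finally show ?thesis .
qed

lemma pmf_nat_sums_1: "pmf (p :: nat pmf) sums 1"
  using pmf_nat_expectation_sums[of "\<lambda>_. 1::real" 1 p] by simp

text \<open>The field is left open: real arguments serve \<open>psi\<close> and \<open>w0\<close>,
  complex ones the transforms and the unit circle.\<close>

definition pgf :: "nat pmf \<Rightarrow> 'b::{real_normed_field,banach} \<Rightarrow> 'b" where
  "pgf p w = (\<Sum>i. of_real (pmf p i) * w ^ i)"

lemma summable_norm_pgf:
  fixes w :: "'b::{real_normed_field,banach}"
  assumes "norm w \<le> 1"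
  shows "summable (\<lambda>i. norm (of_real (pmf p i) * w ^ i))"
proof (rule summable_comparison_test')
  show "summable (pmf p)" using pmf_nat_sums_1 by (rule sums_summable)
  show "norm (norm (of_real (pmf p n) * w ^ n)) \<le> pmf p n" for n
    using power_le_one[of "norm w" n] assms
    by (simp add: norm_mult norm_power mult_left_le)
qed

lemma summable_pgf:
  fixes w :: "'b::{real_normed_field,banach}"
  assumes "norm w \<le> 1"
  shows "summable (\<lambda>i. of_real (pmf p i) * w ^ i)"
  using summable_norm_pgf[OF assms] by (rule summable_norm_cancel)

lemma pgf_sums:
  fixes w :: "'b::{real_normed_field,banach}"
  assumes "norm w \<le> 1"
  shows "(\<lambda>i. of_real (pmf p i) * w ^ i) sums pgf p w"
  unfolding pgf_def using summable_pgf[OF assms] by (rule summable_sums)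

lemma pgf_eq_expectation:
  fixes w :: "'b::{real_normed_field,banach,second_countable_topology}"
  assumes "norm w \<le> 1"
  shows "pgf p w = (\<integral>i. w ^ i \<partial>measure_pmf p)"
proof -
  have "(\<lambda>i. pmf p i *\<^sub>R w ^ i) sums (\<integral>i. w ^ i \<partial>measure_pmf p)"
    by (rule pmf_nat_expectation_sums[where C=1]) (use assms in \<open>simp add: norm_power power_le_one\<close>)
  with pgf_sums[OF assms] show ?thesis
    by (simp add: scaleR_conv_of_real sums_iff)
qed

lemma pgf_1 [simp]: "pgf p (1 :: 'b::{real_normed_field,banach}) = 1"
proof -
  have "(\<lambda>i. of_real (pmf p i) :: 'b) sums of_real 1"
    by (rule sums_of_real[OF pmf_nat_sums_1])
  then show ?thesis by (simp add: pgf_def sums_iff)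
qed

lemma pgf_0 [simp]: "pgf p (0 :: 'b::{real_normed_field,banach}) = of_real (pmf p 0)"
  unfolding pgf_def using powser_zero[of "\<lambda>i. of_real (pmf p i) :: 'b"] by simp

lemma norm_pgf_le:
  fixes w :: "'b::{real_normed_field,banach}"
  assumes "norm w \<le> 1"
  shows "norm (pgf p w) \<le> pgf p (norm w)"
proof -
  have "norm (pgf p w) \<le> (\<Sum>i. norm (of_real (pmf p i) * w ^ i))"
    unfolding pgf_def by (rule summable_norm[OF summable_norm_pgf[OF assms]])
  also have "\<dots> = pgf p (norm w)"
    by (simp add: pgf_def norm_mult norm_power)
  finally show ?thesis .
qed

lemma pgf_mono:
  assumes "0 \<le> x" "x \<le> y" "y \<le> (1::real)"
  shows "pgf p x \<le> pgf p y"
  unfolding pgf_def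
  by (intro suminf_le mult_left_mono)
     (use assms summable_pgf[of x p] summable_pgf[of y p] in \<open>auto intro: power_mono\<close>)

lemma summable_abs_pmf: "summable (\<lambda>i. \<bar>pmf (p :: nat pmf) i\<bar>)"
  using sums_summable[OF pmf_nat_sums_1] by simp

lemma continuous_on_pgf:
  "continuous_on (cball 0 1) (pgf p :: 'b \<Rightarrow> 'b::{real_normed_field,banach})"
  unfolding pgf_def by (rule continuous_on_powser_cball[OF summable_abs_pmf])

lemma pgf_differentiable:
  fixes w :: "'b::{real_normed_field,banach}"
  assumes "norm w < 1"
  shows "\<exists>D. (pgf p has_field_derivative D) (at w)"
  unfolding pgf_def using assms by (rule powser_differentiable[OF summable_abs_pmf])

section \<open>Convolution powers of the step law and first hitting times\<close>

primrec iid_sum :: "nat pmf \<Rightarrow> nat \<Rightarrow> nat pmf" where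
  "iid_sum p 0 = return_pmf 0"
| "iid_sum p (Suc n) = map_pmf (\<lambda>(x, y). x + y) (pair_pmf p (iid_sum p n))"

lemma pmf_iid_sum_Suc:
  "pmf (iid_sum p (Suc n)) k = (\<Sum>i\<le>k. pmf p i * pmf (iid_sum p n) (k - i))"
proof -
  have eq: "(\<lambda>(x, y). x + y) -` {k} = (\<lambda>i. (i, k - i)) ` {..k}"
    by (auto simp: image_iff)
  have "pmf (iid_sum p (Suc n)) k = measure (pair_pmf p (iid_sum p n)) ((\<lambda>i. (i, k - i)) ` {..k})"
    by (simp add: pmf_map eq)
  also have "\<dots> = (\<Sum>i\<le>k. pmf p i * pmf (iid_sum p n) (k - i))"
    by (subst measure_measure_pmf_finite) (auto simp: sum.reindex inj_on_def pmf_pair)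
  finally show ?thesis .
qed

text \<open>In formal power series convolution powers become powers, and their formal derivative
  supplies the algebra behind Kemperman's formula.\<close>

lemma fps_iid_sum: "Abs_fps (pmf (iid_sum p n)) = Abs_fps (pmf p) ^ n"
proof (induction n)
  case 0
  show ?case by (simp add: fps_eq_iff indicator_def)
next
  case (Suc n)
  show ?case
    by (rule fps_ext) (simp del: iid_sum.simps add: pmf_iid_sum_Suc fps_mult_nth atLeast0AtMost flip: Suc)
qed

lemma pgf_iid_sum:
  fixes w :: "'b::{real_normed_field,banach}"
  assumes "norm w \<le> 1"
  shows "pgf (iid_sum p n) w = pgf p w ^ n"
proof (induction n)
  case 0
  have "(\<lambda>i. of_real (pmf (return_pmf 0) i) * w ^ i) = (\<lambda>i. if i = 0 then 1 else 0)"
    by (auto simp: fun_eq_iff)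
  with sums_single[of 0 "\<lambda>_. 1::'b"] show ?case by (simp add: pgf_def sums_iff)
next
  case (Suc n)
  have "pgf p w * pgf (iid_sum p n) w =
      (\<Sum>k. \<Sum>i\<le>k. (of_real (pmf p i) * w ^ i) * (of_real (pmf (iid_sum p n) (k - i)) * w ^ (k - i)))"
    unfolding pgf_def by (rule Cauchy_product[OF summable_norm_pgf summable_norm_pgf]) (use assms in auto)
  also have "\<dots> = pgf (iid_sum p (Suc n)) w"
    unfolding pgf_def pmf_iid_sum_Suc of_real_sum sum_distrib_right
    by (intro suminf_cong sum.cong) (auto simp: simp flip: power_add)
  finally show ?case by (simp del: iid_sum.simps add: Suc)
qed

text \<open>
  \<open>first_hit p n k\<close> is the probability that the upwards skip-free walk with steps \<open>1 - i\<close>,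
  \<open>i\<close> distributed as \<open>p\<close>, first hits \<open>k\<close> at time \<open>n\<close> (Kemperman's formula).
\<close>

definition first_hit :: "nat pmf \<Rightarrow> nat \<Rightarrow> nat \<Rightarrow> real" where
  "first_hit p n k = (if n = 0 then of_bool (k = 0)
     else if k \<le> n then real k / real n * pmf (iid_sum p n) (n - k) else 0)"

text \<open>First-step analysis: from distance \<open>k\<close> a step \<open>1 - i\<close> leaves
  the distance \<open>k - 1 + i\<close>. With \<open>b\<close> the series of the step law, the sum
  over \<open>i\<close> splits into a multiple of a coefficient of \<open>b * b ^ n\<close> and one
  of \<open>X * b' * b ^ n\<close>, and the latter comes from the derivative of
  \<open>b ^ (n + 1)\<close>.\<close>

lemma first_hit_Suc:
  assumes "1 \<le> k"
  shows "first_hit p (Suc n) k = (\<integral>i. first_hit p n (k - 1 + i) \<partial>measure_pmf p)"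
proof (cases "k \<le> Suc n")
  case False
  then have "first_hit p n (k - 1 + i) = 0" for i
    by (auto simp: first_hit_def)
  then show ?thesis using False by (simp add: first_hit_def)
next
  case k: True
  \<comment> \<open>Being at height \<open>k\<close> after \<open>n + 1\<close> steps means that the
    variables \<open>i\<close> add up to \<open>N\<close>; a first step with \<open>i > N\<close>
    puts the target out of reach of the remaining \<open>n\<close> steps.\<close>
  define N where "N = Suc n - k"
  define b where "b = Abs_fps (pmf p)"
  have N: "k - 1 + i \<le> n \<longleftrightarrow> i \<le> N" for i
    using k assms unfolding N_def by auto
  have exp: "(\<integral>i. first_hit p n (k - 1 + i) \<partial>measure_pmf p) = (\<Sum>i\<le>N. first_hit p n (k - 1 + i) * pmf p i)"
    by (rule integral_measure_pmf_real) (use N in \<open>auto simp: first_hit_def split: if_splits\<close>)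
  show ?thesis
  \<comment> \<open>The general computation divides by \<open>n\<close>; at \<open>n = 0\<close> the
    indicator of \<open>k = 0\<close> takes the place of the quotient.\<close>
  proof (cases "n = 0")
    case True
    with k assms have "k = 1" by simp
    then show ?thesis unfolding exp using True
      by (simp add: first_hit_def N_def pmf_iid_sum_Suc del: iid_sum.simps(2))
  next
    case n: False
    have b: "pmf (iid_sum p m) i = b ^ m $ i" for m i
      by (metis b_def fps_iid_sum fps_nth_Abs_fps)
    \<comment> \<open>The \<open>N\<close>-th coefficient of \<open>X\<close> times the derivative
      of \<open>b ^ (n + 1)\<close>, computed directly and by the power rule.\<close>
    have deriv: "(\<Sum>i\<le>N. real i * pmf p i * b ^ n $ (N - i)) = real N / real (Suc n) * b ^ Suc n $ N"
    proof -
      have "fps_X * fps_deriv (b ^ Suc n) = of_nat (Suc n) * (fps_X * fps_deriv b * b ^ n)"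
        by (subst fps_deriv_power) (simp add: algebra_simps flip: fps_of_nat)
      then have "(fps_X * fps_deriv (b ^ Suc n)) $ N = of_nat (Suc n) * (fps_X * fps_deriv b * b ^ n) $ N"
        by (metis fps_mult_of_nat_nth(1))
      moreover have "(fps_X * fps_deriv c) $ m = real m * c $ m" for c :: "real fps" and m
        by (cases m) auto
      ultimately have "real N * b ^ Suc n $ N = real (Suc n) * (\<Sum>i\<le>N. real i * b $ i * b ^ n $ (N - i))"
        by (simp only: fps_mult_nth[of "fps_X * fps_deriv b"] atLeast0AtMost)
      then show ?thesis by (simp add: b_def field_simps)
    qed
    have conv: "(\<Sum>i\<le>N. pmf p i * b ^ n $ (N - i)) = b ^ Suc n $ N"
      by (simp add: fps_mult_nth b_def atLeast0AtMost)
    have "(\<Sum>i\<le>N. first_hit p n (k - 1 + i) * pmf p i)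
        = (\<Sum>i\<le>N. (real (k - 1) * (pmf p i * b ^ n $ (N - i)) + real i * pmf p i * b ^ n $ (N - i)) / real n)"
    proof (rule sum.cong[OF refl])
      fix i assume "i \<in> {..N}"
      then have *: "k - 1 + i \<le> n" "n - (k - 1 + i) = N - i" using k assms by (auto simp: N_def)
      show "first_hit p n (k - 1 + i) * pmf p i
         = (real (k - 1) * (pmf p i * b ^ n $ (N - i)) + real i * pmf p i * b ^ n $ (N - i)) / real n"
        unfolding first_hit_def * using n *(1) by (simp add: b field_simps)
    qed
    also have "\<dots> = (real (k - 1) + real N / real (Suc n)) * b ^ Suc n $ N / real n"
      by (simp only: conv deriv sum.distrib flip: sum_divide_distrib sum_distrib_left)
         (simp only: distrib_right)
    also have "(real (k - 1) + real N / real (Suc n)) = real k * real n / real (Suc n)"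
      using k assms by (simp add: N_def of_nat_diff field_simps)
    finally show ?thesis unfolding exp using n k by (simp add: first_hit_def b N_def del: iid_sum.simps)
  qed
qed

text \<open>The powers of the fixed point and the partial sums obey the same one-step equation and
  agree at \<open>k = 0\<close>. Their difference is at most 1 initially and shrinks by the factor
  \<open>\<rho>\<close> with every further term. Probabilistically, \<open>w ^ k\<close> is the
  chance of reaching \<open>k\<close> when each step is survived with probability
  \<open>\<rho>\<close>.\<close>

lemma first_hit_sums:
  assumes \<rho>: "0 \<le> \<rho>" "\<rho> < 1" and w: "0 \<le> w" "w \<le> 1" "w = \<rho> * pgf p w"
  shows "(\<lambda>n. \<rho> ^ n * first_hit p n k) sums w ^ k"
proof -
  define F where "F N k = (\<Sum>n\<le>N. \<rho> ^ n * first_hit p n k)" for N k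
  have F0: "F N 0 = 1" for N
    by (simp add: F_def first_hit_def if_distrib cong: if_cong)
  have fin: "\<exists>C. \<forall>k. \<bar>first_hit p n k\<bar> \<le> C" for n
  proof -
    have "\<bar>first_hit p n k\<bar> \<le> 1" for k
      unfolding first_hit_def
      by (auto simp: abs_mult simp del: times_divide_eq_left intro!: mult_le_one pmf_le_1)
    then show ?thesis by blast
  qed
  have int1: "integrable (measure_pmf p) (\<lambda>i. first_hit p n (k + i))" for n k
  proof -
    from fin[of n] obtain C where "\<bar>first_hit p n j\<bar> \<le> C" for j by blast
    then show ?thesis
      by (intro measure_pmf.integrable_const_bound[where B=C]) auto
  qed
  have FSuc: "F (Suc N) k = \<rho> * (\<integral>i. F N (k - 1 + i) \<partial>measure_pmf p)" if "1 \<le> k" for N k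
  proof -
    have "F (Suc N) k = first_hit p 0 k + (\<Sum>n\<le>N. \<rho> ^ Suc n * first_hit p (Suc n) k)"
      unfolding F_def by (subst sum.atMost_Suc_shift) simp
    also have "\<dots> = \<rho> * (\<Sum>n\<le>N. \<rho> ^ n * (\<integral>i. first_hit p n (k - 1 + i) \<partial>measure_pmf p))"
      using that by (simp only: first_hit_Suc sum_distrib_left) (simp add: first_hit_def mult.assoc)
    also have "(\<Sum>n\<le>N. \<rho> ^ n * (\<integral>i. first_hit p n (k - 1 + i) \<partial>measure_pmf p))
       = (\<integral>i. F N (k - 1 + i) \<partial>measure_pmf p)"
      unfolding F_def by (subst Bochner_Integration.integral_sum) (auto intro: int1)
    finally show ?thesis .
  qed
  have intF: "integrable (measure_pmf p) (\<lambda>i. F N (k + i))" for N k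
    unfolding F_def by (intro Bochner_Integration.integrable_sum integrable_mult_right int1)
  have intw: "integrable (measure_pmf p) (\<lambda>i. w ^ (k + i))" for k
    by (rule measure_pmf.integrable_const_bound[where B=1]) (use w in \<open>auto intro: power_le_one\<close>)
  have bound: "\<bar>w ^ k - F N k\<bar> \<le> \<rho> ^ N" for N k
  proof (induction N arbitrary: k)
    case 0
    show ?case using w by (cases "k = 0") (auto simp: F_def first_hit_def power_le_one)
  next
    case (Suc N)
    show ?case
    proof (cases "k = 0")
      case True
      then show ?thesis using \<rho> by (simp add: F0)
    next
      case False
      have "w ^ k = w ^ (k - 1) * (\<rho> * pgf p w)"
        using False w(3) by (cases k) auto
      also have "\<dots> = \<rho> * (\<integral>i. w ^ (k - 1 + i) \<partial>measure_pmf p)"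
        using w by (subst pgf_eq_expectation) (auto simp: power_add)
      finally have "w ^ k - F (Suc N) k = \<rho> * (\<integral>i. w ^ (k - 1 + i) \<partial>measure_pmf p)
          - \<rho> * (\<integral>i. F N (k - 1 + i) \<partial>measure_pmf p)"
        using False by (subst FSuc) auto
      also have "\<dots> = \<rho> * (\<integral>i. w ^ (k - 1 + i) - F N (k - 1 + i) \<partial>measure_pmf p)"
        by (subst Bochner_Integration.integral_diff[OF intw intF]) (simp add: right_diff_distrib)
      also have "\<bar>\<rho> * (\<integral>i. w ^ (k - 1 + i) - F N (k - 1 + i) \<partial>measure_pmf p)\<bar> \<le> \<rho> * (\<integral>i. \<rho> ^ N \<partial>measure_pmf p)"
        unfolding abs_mult using \<rho>
        by (intro mult_mono order.trans[OF integral_abs_bound integral_mono] Bochner_Integration.integrable_diff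
             integrable_abs intw intF) (auto intro: Suc)
      finally show ?thesis by simp
    qed
  qed
  have "(\<lambda>N. w ^ k - F N k) \<longlonglongrightarrow> 0"
    by (rule Lim_null_comparison[OF _ LIMSEQ_realpow_zero[OF \<rho>]]) (use bound in auto)
  then have "(\<lambda>N. w ^ k - (w ^ k - F N k)) \<longlonglongrightarrow> w ^ k - 0"
    by (intro tendsto_intros)
  then show ?thesis unfolding sums_def_le F_def by simp
qed

section \<open>The law of the chain\<close>

lemma integral_bind_pmf_bounded:
  fixes f :: "'a \<Rightarrow> real"
  assumes "\<And>x. \<bar>f x\<bar> \<le> C"
  shows "(\<integral>x. f x \<partial>bind_pmf p q) = (\<integral>x. \<integral>y. f y \<partial>q x \<partial>p)"
  unfolding measure_pmf_bind
  by (rule integral_bind[where K="count_space UNIV" and B'=1 and B=C])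
     (use assms in \<open>auto simp: measure_pmf.emeasure_space_1 space_subprob_algebra
        intro: measure_pmf.subprob_space_axioms\<close>)

lemma integral_bind_pmf_bounded_complex:
  fixes f :: "'a \<Rightarrow> complex"
  assumes C: "\<And>x. norm (f x) \<le> C"
  shows "(\<integral>x. f x \<partial>bind_pmf p q) = (\<integral>x. \<integral>y. f y \<partial>q x \<partial>p)"
proof -
  have int: "integrable (measure_pmf r) f" for r
    by (rule measure_pmf.integrable_const_bound[where B=C]) (use C in auto)
  have int2: "integrable (measure_pmf p) (\<lambda>x. \<integral>y. f y \<partial>q x)"
  proof (rule measure_pmf.integrable_const_bound[where B=C])
    have "norm (\<integral>y. f y \<partial>q x) \<le> (\<integral>y. C \<partial>q x)" for x
      by (rule order.trans[OF integral_norm_bound integral_mono]) (use int C in auto)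
    then show "AE x in p. norm (\<integral>y. f y \<partial>q x) \<le> C" by simp
  qed auto
  have re: "\<bar>Re (f x)\<bar> \<le> C" and im: "\<bar>Im (f x)\<bar> \<le> C" for x
    using C[of x] abs_Re_le_cmod[of "f x"] abs_Im_le_cmod[of "f x"] by auto
  show ?thesis
    by (rule complex_eqI)
       (simp_all add: int int2 integral_bind_pmf_bounded[OF re] integral_bind_pmf_bounded[OF im]
          flip: integral_Re integral_Im)
qed

definition skip_free_pmf :: "real \<Rightarrow> nat pmf \<Rightarrow> int pmf" where
  "skip_free_pmf x p =
     bind_pmf (poisson_pmf x) (\<lambda>n. map_pmf (\<lambda>i. int n - int i) (iid_sum p n))"

text \<open>Conditioning on the number of jumps. This one expansion yields the characteristic
  function, the behaviour over a short mesh cell and the integrands of the kappa functions.\<close>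

lemma skip_free_pmf_sums:
  fixes f :: "int \<Rightarrow> complex"
  assumes x: "x > 0" and C: "\<And>k. norm (f k) \<le> C"
  shows "(\<lambda>n. (x ^ n / fact n * exp (- x)) *\<^sub>R (\<integral>i. f (int n - int i) \<partial>iid_sum p n))
           sums (\<integral>k. f k \<partial>skip_free_pmf x p)"
proof -
  have eq: "(\<integral>k. f k \<partial>skip_free_pmf x p) = (\<integral>n. (\<integral>i. f (int n - int i) \<partial>iid_sum p n) \<partial>poisson_pmf x)"
    unfolding skip_free_pmf_def by (subst integral_bind_pmf_bounded_complex[OF C]) simp
  have int: "integrable (measure_pmf r) f" for r
    by (rule measure_pmf.integrable_const_bound[where B=C]) (use C in auto)
  have "norm (\<integral>i. f (int n - int i) \<partial>iid_sum p n) \<le> (\<integral>i. C \<partial>iid_sum p n)" for n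
    by (rule order.trans[OF integral_norm_bound integral_mono])
       (auto intro!: C measure_pmf.integrable_const_bound[where B=C])
  then have "(\<lambda>n. pmf (poisson_pmf x) n *\<^sub>R (\<integral>i. f (int n - int i) \<partial>iid_sum p n))
           sums (\<integral>n. (\<integral>i. f (int n - int i) \<partial>iid_sum p n) \<partial>poisson_pmf x)"
    by (intro pmf_nat_expectation_sums[where C=C]) simp
  then show ?thesis unfolding eq using x by simp
qed

lemma char_skip_free_pmf:
  assumes x: "x > 0"
  shows "char (distr (skip_free_pmf x p) borel (\<lambda>k. h * of_int k)) u
     = exp (of_real x * (iexp (u * h) * pgf p (iexp (- (u * h))) - 1))"
proof -
  define z where "z = iexp (u * h)"
  have z: "norm z = 1" "iexp (- (u * h)) = inverse z"
    unfolding z_def by (simp_all add: exp_minus)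
  have "char (distr (skip_free_pmf x p) borel (\<lambda>k. h * of_int k)) u
     = (\<integral>k. iexp (u * (h * of_int k)) \<partial>skip_free_pmf x p)"
    unfolding char_def by (subst integral_distr) auto
  also have "(\<lambda>k. iexp (u * (h * of_int k))) = (\<lambda>k. z powi k)"
    by (simp add: z_def fun_eq_iff exp_power_int mult_ac)
  finally have eq: "char (distr (skip_free_pmf x p) borel (\<lambda>k. h * of_int k)) u
     = (\<integral>k. z powi k \<partial>skip_free_pmf x p)" .
  have z0: "z \<noteq> 0" using z by auto
  \<comment> \<open>Given \<open>n\<close> jumps the transform is an \<open>n\<close>-th power; as
    \<open>z\<close> has modulus 1, \<open>inverse z\<close> lies in the closed disc where the
    generating function converges.\<close>
  have inner: "(\<integral>i. z powi (int n - int i) \<partial>iid_sum p n) = (z * pgf p (inverse z)) ^ n" for n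
  proof -
    have "(\<integral>i. z powi (int n - int i) \<partial>iid_sum p n) = (\<integral>i. z ^ n * inverse z ^ i \<partial>iid_sum p n)"
      using z0 by (simp add: power_int_diff divide_inverse power_inverse)
    also have "\<dots> = z ^ n * pgf (iid_sum p n) (inverse z)"
      using z by (simp add: pgf_eq_expectation norm_inverse)
    finally show ?thesis using z by (simp add: pgf_iid_sum norm_inverse power_mult_distrib)
  qed
  define s where "s = z * pgf p (inverse z)"
  have "(\<lambda>n. (x ^ n / fact n * exp (- x)) *\<^sub>R s ^ n) sums (\<integral>k. z powi k \<partial>skip_free_pmf x p)"
    unfolding s_def inner[symmetric]
    by (rule skip_free_pmf_sums[OF x, where C=1]) (simp add: norm_power_int z)
  moreover have "(\<lambda>n. exp (- of_real x) * (inverse (fact n) *\<^sub>R (of_real x * s) ^ n)) sums (exp (- of_real x) * exp (of_real x * s))"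
    by (rule sums_mult[OF exp_converges])
  moreover have "(x ^ n / fact n * exp (- x)) *\<^sub>R s ^ n = exp (- of_real x) * (inverse (fact n) *\<^sub>R (of_real x * s) ^ n)" for n
    by (simp add: scaleR_conv_of_real power_mult_distrib divide_inverse exp_minus exp_of_real)
  ultimately have "(\<integral>k. z powi k \<partial>skip_free_pmf x p) = exp (- of_real x) * exp (of_real x * s)"
    by (simp add: sums_iff)
  also have "\<dots> = exp (of_real x * (s - 1))" by (simp add: algebra_simps flip: exp_add)
  finally show ?thesis unfolding eq s_def z(2) by (simp add: z_def)
qed

text \<open>The complement of the support is covered by open null sets, and Lindelof's theorem
  reduces the cover to a countable one.\<close>

lemma null_compl_measure_support:
  fixes N :: "'a::second_countable_topology measure"
  assumes sets: "sets N = sets borel"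
  obtains A where "A \<in> null_sets N" "- measure_support N \<subseteq> A"
proof -
  define \<F> where "\<F> = {U. open U \<and> emeasure N U = 0}"
  have sp: "space N = UNIV" using sets_eq_imp_space_eq[OF sets] by simp
  have "\<And>S. S \<in> \<F> \<Longrightarrow> open S" by (auto simp: \<F>_def)
  then obtain \<G> where G: "\<G> \<subseteq> \<F>" "countable \<G>" "\<Union>\<G> = \<Union>\<F>" by (rule Lindelof)
  have "- measure_support N \<subseteq> \<Union>\<F>"
    unfolding measure_support_def \<F>_def sp by (auto simp: not_gr_zero)
  moreover have "U \<in> null_sets N" if "U \<in> \<G>" for U
    using that G(1) sets by (auto simp: \<F>_def null_sets_def)
  then have "\<Union>\<G> \<in> null_sets N"
    using null_sets_UN'[of \<G> "\<lambda>U. U" N] G(2) by simp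
  ultimately show ?thesis using G(3) that by metis
qed

section \<open>The jump law on the lattice and the law of the chain at a fixed time\<close>

context upwards_skip_free_levy_chain
begin

definition lam :: real where "lam = measure \<nu> UNIV"

text \<open>Lattice points are counted downwards from the only upward jump: index 0 is
  \<open>h\<close>, and every other index is a point at or below 0. The jump law thus becomes a law
  on the naturals, with a generating function in powers of \<open>exp (- \<beta> h)\<close>.\<close>

definition site :: "nat \<Rightarrow> real" where "site i = h * (1 - real i)"

definition step_pmf :: "nat pmf" where
  "step_pmf = embed_pmf (\<lambda>i. measure \<nu> {site i} / lam)"

lemma inj_site: "inj site"
  using h_pos by (auto simp: inj_def site_def)

lemma space_nu [simp]: "space \<nu> = UNIV"
  using sets_eq_imp_space_eq[OF sets_levy_measure] by simp

lemma borel_sets_nu [measurable_cong]: "sets \<nu> = sets borel"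
  by (rule sets_levy_measure)

text \<open>Lindelof again, now for the measure restricted to the positive half-line. Since
  \<open>h\<close> is a support point the half-line has positive mass, and with everything but
  \<open>h\<close> null this mass must sit at \<open>h\<close>.\<close>

lemma emeasure_positive_part: "emeasure \<nu> ({0<..} - {h}) = 0" "emeasure \<nu> {h} > 0"
proof -
  let ?R = "restrict_space \<nu> {0<..}"
  have em: "emeasure ?R (U \<inter> space ?R) = emeasure \<nu> (U \<inter> {0<..})" if "open U" for U
    by (subst emeasure_restrict_space)
       (use that in \<open>auto simp: space_restrict_space sets_levy_measure intro!: arg_cong[where f="emeasure \<nu>"]\<close>)
  have sp: "space ?R = {0<..}" by (simp add: space_restrict_space)
  define \<F> where "\<F> = {U. open U \<and> emeasure \<nu> (U \<inter> {0<..}) = 0}"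
  have "\<And>S. S \<in> \<F> \<Longrightarrow> open S" by (auto simp: \<F>_def)
  then obtain \<G> where G: "\<G> \<subseteq> \<F>" "countable \<G>" "\<Union>\<G> = \<Union>\<F>" by (rule Lindelof)
  have sub: "{0<..} - {h} \<subseteq> \<Union>\<F>"
  proof
    fix x assume "x \<in> {0<..} - {h}"
    then have "x \<notin> measure_support ?R" "x \<in> {0<..}" by (auto simp: support_positive)
    then show "x \<in> \<Union>\<F>"
      unfolding measure_support_def \<F>_def sp by (auto simp: not_gr_zero em[unfolded sp])
  qed
  have "(\<Union>U\<in>\<G>. U \<inter> {0<..}) \<in> null_sets \<nu>"
    by (rule null_sets_UN') (use G(1,2) in \<open>auto simp: \<F>_def null_sets_def sets_levy_measure\<close>)
  moreover have "{0<..} - {h} \<subseteq> (\<Union>U\<in>\<G>. U \<inter> {0<..})" using sub G(3) by auto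
  moreover have "{0<..} - {h} \<in> sets \<nu>" by simp
  ultimately show 0: "emeasure \<nu> ({0<..} - {h}) = 0"
    by (metis null_setsD1 null_sets_subset)
  have "h \<in> measure_support ?R" by (simp add: support_positive)
  then have "emeasure \<nu> (UNIV \<inter> {0<..}) > 0"
    unfolding measure_support_def using em[of UNIV] by (metis (mono_tags, lifting) UNIV_I mem_Collect_eq open_UNIV)
  also have "UNIV \<inter> {0<..} = ({0<..} - {h}) \<union> {h}" using h_pos by auto
  also have "emeasure \<nu> (({0<..} - {h}) \<union> {h}) = emeasure \<nu> ({0<..} - {h}) + emeasure \<nu> {h}"
    by (rule plus_emeasure[symmetric]) auto
  finally show "emeasure \<nu> {h} > 0" using 0 by simp
qed

lemma lam_pos: "lam > 0"
proof -
  have "emeasure \<nu> UNIV \<ge> emeasure \<nu> {h}" by (rule emeasure_mono) auto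
  with emeasure_positive_part(2) have "emeasure \<nu> UNIV > 0" by order
  then show ?thesis by (simp add: lam_def emeasure_eq_measure)
qed

text \<open>Two null sets cover the complement: the points off the support, which disposes of the
  nonpositive ones outside the lattice, and the positive half-line without \<open>h\<close>.\<close>

lemma emeasure_compl_range_site: "emeasure \<nu> (- range site) = 0"
proof -
  obtain A where A: "A \<in> null_sets \<nu>" "- measure_support \<nu> \<subseteq> A"
    by (rule null_compl_measure_support[OF sets_levy_measure])
  have "- range site \<subseteq> A \<union> ({0<..} - {h})"
  proof
    fix x assume x: "x \<in> - range site"
    show "x \<in> A \<union> ({0<..} - {h})"
    proof (cases "x > 0")
      case True
      have "site 0 = h" by (simp add: site_def)
      with x have "x \<noteq> h" by (metis ComplD rangeI)
      with True show ?thesis by auto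
    next
      case False
      have "x \<notin> measure_support \<nu>"
      proof
        assume "x \<in> measure_support \<nu>"
        then obtain k :: int where k: "x = h * of_int k" using support_lattice by auto
        with False h_pos have "k \<le> 0" by (simp add: mult_le_0_iff not_less)
        then have "x = site (nat (1 - k))" by (simp add: site_def k)
        with x show False by auto
      qed
      with A show ?thesis by auto
    qed
  qed
  moreover have "A \<union> ({0<..} - {h}) \<in> null_sets \<nu>"
    using A emeasure_positive_part(1) by (intro null_sets.Un null_setsI) auto
  moreover have "range site \<in> sets borel" by (rule sets.countable) auto
  then have "- range site \<in> sets \<nu>" by (simp add: sets_levy_measure borel_comp)
  ultimately show ?thesis by (metis null_setsD1 null_sets_subset)
qed

lemma emeasure_nu:
  assumes [measurable]: "A \<in> sets borel"
  shows "emeasure \<nu> A = (\<integral>\<^sup>+i. emeasure \<nu> {site i} \<partial>count_space {i. site i \<in> A})"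
proof -
  have [measurable]: "range site \<in> sets borel"
    by (rule sets.countable) auto
  have "emeasure \<nu> A = emeasure \<nu> (A \<inter> range site) + emeasure \<nu> (A - range site)"
    by (subst plus_emeasure) (auto intro!: arg_cong[where f="emeasure \<nu>"])
  also have "emeasure \<nu> (A - range site) = 0"
    using emeasure_mono[of "A - range site" "- range site" \<nu>] emeasure_compl_range_site
    by (auto simp: sets_levy_measure borel_comp)
  also have "A \<inter> range site = (\<Union>i\<in>{i. site i \<in> A}. {site i})" by auto
  also have "emeasure \<nu> \<dots> = (\<integral>\<^sup>+i. emeasure \<nu> {site i} \<partial>count_space {i. site i \<in> A})"
    by (rule emeasure_UN_countable) (use inj_site in \<open>auto simp: disjoint_family_on_def inj_def\<close>)
  finally show ?thesis by simp
qed

lemma pmf_step: "pmf step_pmf i = measure \<nu> {site i} / lam"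
  unfolding step_pmf_def
proof (rule pmf_embed_pmf)
  show "0 \<le> measure \<nu> {site i} / lam" for i using lam_pos by simp
  have "(\<integral>\<^sup>+i. ennreal (measure \<nu> {site i} / lam) \<partial>count_space UNIV)
      = (\<integral>\<^sup>+i. emeasure \<nu> {site i} * ennreal (inverse lam) \<partial>count_space UNIV)"
    using lam_pos by (intro nn_integral_cong) (simp add: emeasure_eq_measure divide_inverse ennreal_mult')
  also have "\<dots> = emeasure \<nu> UNIV * ennreal (inverse lam)"
    using emeasure_nu[of UNIV] by (simp add: nn_integral_multc)
  also have "\<dots> = 1"
    using lam_pos by (simp add: emeasure_eq_measure lam_def flip: ennreal_mult ennreal_1)
  finally show "(\<integral>\<^sup>+i. ennreal (measure \<nu> {site i} / lam) \<partial>count_space UNIV) = 1" .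
qed

lemma pmf_step_0: "pmf step_pmf 0 > 0"
proof -
  have "measure \<nu> {site 0} > 0"
    using emeasure_positive_part(2) by (simp add: site_def emeasure_eq_measure)
  then show ?thesis using lam_pos by (simp add: pmf_step)
qed

lemma nu_eq_distr: "\<nu> = distr (density (measure_pmf step_pmf) (\<lambda>_. ennreal lam)) borel site"
proof (rule measure_eqI)
  fix A assume A: "A \<in> sets \<nu>"
  then have [measurable]: "A \<in> sets borel" by (simp add: sets_levy_measure)
  have "emeasure \<nu> A = (\<integral>\<^sup>+i. ennreal (pmf step_pmf i) * ennreal lam \<partial>count_space {i. site i \<in> A})"
    unfolding emeasure_nu[OF \<open>A \<in> sets borel\<close>]
    by (intro nn_integral_cong) (use lam_pos in \<open>simp add: pmf_step emeasure_eq_measure flip: ennreal_mult\<close>)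
  also have "\<dots> = emeasure (measure_pmf step_pmf) {i. site i \<in> A} * ennreal lam"
    by (simp add: nn_integral_multc nn_integral_pmf)
  also have "\<dots> = emeasure (distr (density (measure_pmf step_pmf) (\<lambda>_. ennreal lam)) borel site) A"
    by (subst emeasure_distr) (auto simp: emeasure_density nn_integral_cmult vimage_def mult.commute)
  finally show "emeasure \<nu> A = emeasure (distr (density (measure_pmf step_pmf) (\<lambda>_. ennreal lam)) borel site) A" .
qed (simp add: sets_levy_measure)

lemma integral_nu:
  fixes f :: "real \<Rightarrow> 'b::{banach, second_countable_topology}"
  assumes [measurable]: "f \<in> borel_measurable borel"
  shows "(\<integral>x. f x \<partial>\<nu>) = lam *\<^sub>R (\<integral>i. f (site i) \<partial>step_pmf)"
proof -
  have "(\<integral>x. f x \<partial>\<nu>) = (\<integral>i. f (site i) \<partial>density (measure_pmf step_pmf) (\<lambda>_. ennreal lam))"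
    by (subst nu_eq_distr, subst integral_distr) auto
  also have "\<dots> = lam *\<^sub>R (\<integral>i. f (site i) \<partial>step_pmf)"
    by (subst integral_density) (use lam_pos in auto)
  finally show ?thesis .
qed

text \<open>The norm condition expresses \<open>Re \<beta> \<ge> 0\<close> in a form common to the
  real and the complex field. It also holds on the imaginary axis, where the Laplace exponent is the
  characteristic exponent.\<close>

lemma laplace_exponent_eq:
  fixes \<beta> :: "'b::{real_normed_field,banach,second_countable_topology}"
  assumes "norm (exp (- (\<beta> * of_real h))) \<le> 1"
  shows "laplace_exponent \<nu> \<beta>
    = of_real lam * (exp (\<beta> * of_real h) * pgf step_pmf (exp (- (\<beta> * of_real h))) - 1)"
proof -
  let ?w = "exp (- (\<beta> * of_real h))"
  have int: "integrable (measure_pmf step_pmf) (\<lambda>i. ?w ^ i)"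
    by (rule measure_pmf.integrable_const_bound[where B=1])
       (use assms in \<open>auto simp: norm_power intro!: AE_pmfI power_le_one\<close>)
  have e: "exp (\<beta> * of_real (site i)) = exp (\<beta> * of_real h) * ?w ^ i" for i
    by (simp add: site_def algebra_simps flip: exp_add exp_of_nat_mult)
  have "laplace_exponent \<nu> \<beta> = lam *\<^sub>R (\<integral>i. exp (\<beta> * of_real (site i)) - 1 \<partial>step_pmf)"
    unfolding laplace_exponent_def
    by (rule integral_nu) (intro borel_measurable_continuous_onI continuous_intros)
  also have "(\<integral>i. exp (\<beta> * of_real (site i)) - 1 \<partial>step_pmf) = exp (\<beta> * of_real h) * pgf step_pmf ?w - 1"
    using assms int by (simp add: e pgf_eq_expectation)
  finally show ?thesis by (simp add: scaleR_conv_of_real)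
qed

lemma random_variable_X: "0 \<le> t \<Longrightarrow> X t \<in> borel_measurable M"
proof -
  assume t: "0 \<le> t"
  have "space (F t) = space M"
    using filtration t unfolding filtration_def by (metis max.absorb2 subalgebra_def)
  then show "X t \<in> borel_measurable M"
    using adapted[OF t] sets_F_subset[OF t] by (auto simp: measurable_def)
qed

lemma distr_X:
  assumes t: "t > 0"
  shows "distr M borel (X t) = distr (skip_free_pmf (lam * t) step_pmf) borel (\<lambda>k. h * of_int k)"
proof (rule Levy_uniqueness)
  show "real_distribution (distr M borel (X t))"
    unfolding real_distribution_def real_distribution_axioms_def
    using random_variable_X[of t] t by (auto intro!: prob_space_distr)
  show "real_distribution (distr (skip_free_pmf (lam * t) step_pmf) borel (\<lambda>k. h * of_int k))"
    unfolding real_distribution_def real_distribution_axioms_def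
    by (auto intro!: measure_pmf.prob_space_distr)
  show "char (distr M borel (X t)) = char (distr (skip_free_pmf (lam * t) step_pmf) borel (\<lambda>k. h * of_int k))"
  proof
    fix u
    have "(\<integral>x. (iexp (u * x) - 1) \<partial>\<nu>) = laplace_exponent \<nu> (\<i> * of_real u)"
      by (simp add: laplace_exponent_def mult.assoc)
    also have "\<dots> = of_real lam * (iexp (u * h) * pgf step_pmf (iexp (- (u * h))) - 1)"
      by (subst laplace_exponent_eq) (simp_all add: mult.assoc)
    finally have I: "(\<integral>x. (iexp (u * x) - 1) \<partial>\<nu>)
        = of_real lam * (iexp (u * h) * pgf step_pmf (iexp (- (u * h))) - 1)" .
    have "char (distr M borel (X t)) u
        = exp (of_real (lam * t) * (iexp (u * h) * pgf step_pmf (iexp (- (u * h))) - 1))"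
      using t by (simp only: char_exponent less_imp_le I) (simp only: of_real_mult mult_ac)
    then show "char (distr M borel (X t)) u
      = char (distr (skip_free_pmf (lam * t) step_pmf) borel (\<lambda>k. h * of_int k)) u"
      using t lam_pos by (simp only: char_skip_free_pmf mult_pos_pos)
  qed
qed

end

section \<open>The Laplace exponent and its inverse\<close>

context upwards_skip_free_levy_chain
begin

abbreviation psi :: "real \<Rightarrow> real" where "psi \<equiv> laplace_exponent \<nu>"

lemma psi_eq: "0 \<le> b \<Longrightarrow> psi b = lam * (exp (b * h) * pgf step_pmf (exp (- (b * h))) - 1)"
  using laplace_exponent_eq[of b] h_pos by simp

lemma psi_0: "psi 0 = 0"
  by (simp add: psi_eq)

text \<open>Convexity of the exponential on the segment from 0, integrated against the jump law.
  This chord inequality from the origin is the source of the monotonicity of \<open>psi\<close> and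
  of the sign of its derivative.\<close>

lemma psi_star_shaped:
  assumes s: "0 \<le> s" "s \<le> 1" and b: "0 \<le> b"
  shows "psi (s * b) \<le> s * psi b"
proof -
  have int: "integrable (measure_pmf step_pmf) (\<lambda>i. exp (c * site i))" if "0 \<le> c" for c
  proof (rule measure_pmf.integrable_const_bound[where B="exp (c * h)"])
    have "site i \<le> h" for i using h_pos by (simp add: site_def algebra_simps)
    then show "AE i in step_pmf. norm (exp (c * site i)) \<le> exp (c * h)"
      using that by (auto intro!: AE_pmfI mult_left_mono)
  qed auto
  have eq: "psi c = lam * (\<integral>i. exp (c * site i) - 1 \<partial>step_pmf)" for c
    unfolding laplace_exponent_def by (subst integral_nu) auto
  have star: "exp (s * y) \<le> (1 - s) + s * exp y" for y :: real
    using convex_onD[OF exp_convex, of s 0 y] s by simp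
  have "exp (s * b * site i) - 1 \<le> s * (exp (b * site i) - 1)" for i
    using star[of "b * site i"] by (simp add: right_diff_distrib mult.assoc)
  then have "(\<integral>i. exp (s * b * site i) - 1 \<partial>step_pmf) \<le> (\<integral>i. s * (exp (b * site i) - 1) \<partial>step_pmf)"
    (is "?I \<le> _")
    by (intro integral_mono Bochner_Integration.integrable_diff integrable_mult_right int) (use s b in auto)
  also have "\<dots> = s * (\<integral>i. exp (b * site i) - 1 \<partial>step_pmf)" (is "_ = s * ?J")
    by (rule integral_mult_right_zero)
  finally have "lam * ?I \<le> lam * (s * ?J)" using lam_pos by simp
  then show ?thesis unfolding eq by (simp only: mult.left_commute)
qed

text \<open>Writing \<open>b\<close> as the fraction \<open>b / b'\<close> of \<open>b'\<close>
  turns the chord inequality into a lower bound at the farther point.\<close>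

lemma psi_less:
  assumes "0 < b" "b < b'" "0 < psi b"
  shows "psi b' \<ge> b' / b * psi b" "psi b < psi b'"
proof -
  have "psi (b / b' * b') \<le> b / b' * psi b'"
    by (rule psi_star_shaped) (use assms in auto)
  then show *: "psi b' \<ge> b' / b * psi b" using assms by (simp add: field_simps)
  have "1 * psi b < b' / b * psi b" using assms by (intro mult_strict_right_mono) auto
  with * show "psi b < psi b'" by simp
qed

text \<open>Only the upward jump is kept in the generating function; its positive probability forces
  exponential growth.\<close>

lemma psi_lower: "0 \<le> b \<Longrightarrow> psi b \<ge> lam * (exp (b * h) * pmf step_pmf 0 - 1)"
  using pgf_mono[of 0 "exp (- (b * h))" step_pmf] h_pos lam_pos
  by (simp add: psi_eq)

lemma psi_large: "\<exists>b>c. psi b > r"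
proof -
  have "filterlim (\<lambda>b. lam * (exp (b * h) * pmf step_pmf 0 - 1)) at_top at_top"
    using h_pos lam_pos pmf_step_0 by real_asymp
  then have "eventually (\<lambda>b. lam * (exp (b * h) * pmf step_pmf 0 - 1) > r) at_top"
    by (simp add: filterlim_at_top_dense)
  then have "eventually (\<lambda>b. b > c \<and> psi b > r) at_top"
    using eventually_gt_at_top[of "max 0 c"]
  proof eventually_elim
    case (elim b)
    then show ?case using psi_lower[of b] by simp
  qed
  then show ?thesis by (metis (mono_tags, lifting) eventually_at_top_linorder order_refl)
qed

lemma continuous_on_psi: "continuous_on {0..} psi"
proof -
  have "continuous_on {0..} (\<lambda>b. lam * (exp (b * h) * pgf step_pmf (exp (- (b * h))) - 1))"
    by (intro continuous_intros continuous_on_compose2[OF continuous_on_pgf]) (use h_pos in auto)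
  then show ?thesis by (rule continuous_on_eq) (simp add: psi_eq)
qed

lemma psi_differentiable:
  assumes "b > 0"
  shows "\<exists>D. DERIV psi b :> D"
proof -
  obtain D where D: "DERIV (pgf step_pmf) (exp (- (b * h))) :> D"
    using pgf_differentiable[of "exp (- (b * h))"] assms h_pos by auto
  have "DERIV (\<lambda>b. lam * (exp (b * h) * pgf step_pmf (exp (- (b * h))) - 1)) b :>
     lam * (exp (b * h) * (D * (exp (- (b * h)) * - h)) + (exp (b * h) * h) * pgf step_pmf (exp (- (b * h))))"
    by (rule derivative_eq_intros DERIV_chain2[of "pgf step_pmf" D "\<lambda>b. exp (- (b * h))", OF D] refl | simp add: algebra_simps)+
  \<comment> \<open>The closed form is available for nonnegative arguments; \<open>b > 0\<close>
    leaves a neighbourhood on which it can be differentiated.\<close>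
  moreover have "eventually (\<lambda>c. psi c = lam * (exp (c * h) * pgf step_pmf (exp (- (c * h))) - 1)) (nhds b)"
    using eventually_nhds_in_open[of "{0<..}" b] assms by (auto elim!: eventually_mono simp: psi_eq)
  ultimately show ?thesis by (auto simp: DERIV_cong_ev)
qed

text \<open>The roots form a closed set, bounded because \<open>psi\<close> stays positive after any
  point where it is positive; so the supremum is itself a root. A nonpositive value further right
  would, by the intermediate value theorem, create a larger root.\<close>

lemma largest_root:
  shows largest_root_nonneg: "0 \<le> largest_root \<nu>"
    and psi_largest_root: "psi (largest_root \<nu>) = 0"
    and psi_pos: "largest_root \<nu> < b \<Longrightarrow> 0 < psi b"
proof -
  define R where "R = {b. 0 \<le> b \<and> psi b = 0}"
  obtain B where B: "B > 0" "psi B > 0" using psi_large by blast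
  have bdd: "b \<le> B" if "b \<in> R" for b
    using psi_less(2)[of B b] B that by (force simp: R_def)
  have "R = {b \<in> {0..}. psi b = 0}" by (auto simp: R_def)
  then have "closed R"
    using continuous_closed_preimage_constant[OF continuous_on_psi] by simp
  moreover have "R \<noteq> {}" "bdd_above R" using psi_0 bdd by (auto simp: R_def intro!: bdd_aboveI)
  ultimately have mem: "Sup R \<in> R" by (metis closed_contains_Sup)
  have "largest_root \<nu> = Sup R"
    unfolding largest_root_def
    by (rule Greatest_equality) (use mem \<open>bdd_above R\<close> in \<open>auto simp: R_def intro!: cSup_upper\<close>)
  then show 0: "0 \<le> largest_root \<nu>" "psi (largest_root \<nu>) = 0" using mem by (auto simp: R_def)
  show "0 < psi b" if "largest_root \<nu> < b" for b
  proof (rule ccontr)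
    assume "\<not> 0 < psi b"
    obtain c where c: "c > b" "psi c > 0" using psi_large by blast
    have "continuous_on {b..c} psi"
      using continuous_on_psi by (rule continuous_on_subset) (use 0 that in auto)
    then obtain x where "b \<le> x" "x \<le> c" "psi x = 0"
      using IVT'[of psi b 0 c] \<open>\<not> 0 < psi b\<close> c by auto
    then have "x \<in> R" using 0 that by (auto simp: R_def)
    then have "x \<le> Sup R" using \<open>bdd_above R\<close> by (rule cSup_upper)
    with \<open>b \<le> x\<close> that show False by (simp add: \<open>largest_root \<nu> = Sup R\<close>)
  qed
qed

lemma psi_inj: "inj_on psi {largest_root \<nu>..}"
proof (rule linorder_inj_onI')
  fix b c assume *: "b \<in> {largest_root \<nu>..}" "c \<in> {largest_root \<nu>..}" "b < c"
  show "psi b \<noteq> psi c"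
  proof (cases "b = largest_root \<nu>")
    case True
    then show ?thesis using psi_pos[of c] psi_largest_root * by auto
  next
    case False
    then have "largest_root \<nu> < b" using * by auto
    then show ?thesis using psi_less(2)[of b c] psi_pos[of b] largest_root_nonneg * by auto
  qed
qed

lemma Phi_psi: "largest_root \<nu> \<le> b \<Longrightarrow> Phi \<nu> (psi b) = b"
  unfolding Phi_def by (rule inv_into_f_f[OF psi_inj]) auto

lemma Phi_ge: "0 \<le> r \<Longrightarrow> largest_root \<nu> \<le> Phi \<nu> r"
  and psi_Phi: "0 \<le> r \<Longrightarrow> psi (Phi \<nu> r) = r"
proof -
  assume r: "0 \<le> r"
  obtain c where c: "c > largest_root \<nu>" "psi c > r" using psi_large by blast
  have "continuous_on {largest_root \<nu>..c} psi"
    using continuous_on_psi by (rule continuous_on_subset) (use largest_root_nonneg in auto)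
  then obtain x where "largest_root \<nu> \<le> x" "psi x = r"
    using IVT'[of psi "largest_root \<nu>" r c] c r psi_largest_root by auto
  then have "r \<in> psi ` {largest_root \<nu>..}" by auto
  then show "largest_root \<nu> \<le> Phi \<nu> r" "psi (Phi \<nu> r) = r"
    using inv_into_into[of r psi "{largest_root \<nu>..}"] f_inv_into_f[of r psi "{largest_root \<nu>..}"]
    by (auto simp: Phi_def)
qed

lemma Phi_gt: "0 < r \<Longrightarrow> largest_root \<nu> < Phi \<nu> r"
  using Phi_ge[of r] psi_Phi[of r] psi_largest_root by (metis less_irrefl less_eq_real_def)

lemma Phi_pos: "0 < r \<Longrightarrow> 0 < Phi \<nu> r"
  using Phi_gt largest_root_nonneg by force

lemma psi_eq_iff_Phi:
  assumes "0 < r" "0 < b"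
  shows "psi b = r \<longleftrightarrow> b = Phi \<nu> r"
proof
  assume b: "psi b = r"
  then show "b = Phi \<nu> r"
    using psi_less(2)[of b "Phi \<nu> r"] psi_less(2)[of "Phi \<nu> r" b] psi_Phi[of r] Phi_pos[of r] assms
    by (cases b "Phi \<nu> r" rule: linorder_cases) auto
qed (use psi_Phi assms in auto)

lemma ex1_psi_root: "0 < r \<Longrightarrow> \<exists>!b. 0 < b \<and> psi b = r"
  using psi_eq_iff_Phi Phi_pos by metis

lemma DERIV_psi_Phi:
  assumes r: "0 < r"
  shows "DERIV psi (Phi \<nu> r) :> deriv psi (Phi \<nu> r)" "0 < deriv psi (Phi \<nu> r)"
    "deriv (Phi \<nu>) r = inverse (deriv psi (Phi \<nu> r))"
proof -
  let ?b = "Phi \<nu> r"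
  have b: "?b > 0" "psi ?b = r" using Phi_pos psi_Phi r by auto
  from psi_differentiable[OF b(1)] obtain D where D: "DERIV psi ?b :> D" ..
  show D': "DERIV psi ?b :> deriv psi ?b"
    using D by (metis DERIV_imp_deriv)
  then have lim: "((\<lambda>c. (psi c - psi ?b) / (c - ?b)) \<longlongrightarrow> deriv psi ?b) (at_right ?b)"
    using has_field_derivative_at_within[OF D', of "{?b<..}"] by (simp add: has_field_derivative_iff)
  \<comment> \<open>By the chord inequality, secants to the right of \<open>?b\<close> have slope at
    least \<open>r / ?b\<close>, which keeps the derivative away from 0.\<close>
  have "eventually (\<lambda>c. r / ?b \<le> (psi c - psi ?b) / (c - ?b)) (at_right ?b)"
    using eventually_at_right_less[of ?b]
  proof eventually_elim
    case (elim c)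
    have "c / ?b * psi ?b \<le> psi c" using psi_less(1)[of ?b c] b elim r by simp
    then have "r / ?b * (c - ?b) \<le> psi c - psi ?b" using b by (simp add: field_simps)
    then show ?case using elim by (simp add: pos_le_divide_eq)
  qed
  then have "r / ?b \<le> deriv psi ?b"
    using tendsto_lowerbound[OF lim] by simp
  moreover have "r / ?b > 0" using b r by simp
  ultimately show pos: "0 < deriv psi ?b" by linarith
  \<comment> \<open>A point strictly between the largest root and \<open>?b\<close>: from
    \<open>a\<close> onwards \<open>Phi\<close> inverts \<open>psi\<close>, so continuity of the
    inverse can be applied on a genuine neighbourhood.\<close>
  define a where "a = (largest_root \<nu> + ?b) / 2"
  have a: "largest_root \<nu> < a" "a < ?b" using Phi_gt[OF r] by (auto simp: a_def)
  have "isCont (Phi \<nu>) (psi ?b)"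
  proof (rule isCont_inverse_function2[of a ?b "?b + 1" "Phi \<nu>" psi])
    show "Phi \<nu> (psi z) = z" if "a \<le> z" for z using that a by (intro Phi_psi) auto
    show "isCont psi z" if "a \<le> z" for z
    proof -
      have "0 < z" using that a largest_root_nonneg by linarith
      from psi_differentiable[OF this] show ?thesis by (auto intro: DERIV_isCont)
    qed
  qed (use a in auto)
  then have "isCont (Phi \<nu>) r" using b by simp
  then have "DERIV (Phi \<nu>) r :> inverse (deriv psi ?b)"
    by (intro DERIV_inverse_function[where f=psi and a=0 and b="r+1"]) (use D' pos r psi_Phi in auto)
  then show "deriv (Phi \<nu>) r = inverse (deriv psi ?b)" by (rule DERIV_imp_deriv)
qed

definition w0 :: "real \<Rightarrow> real" where "w0 r = exp (- (Phi \<nu> r * h))"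

lemma w0_bounds: "0 < r \<Longrightarrow> 0 < w0 r" "0 < r \<Longrightarrow> w0 r < 1"
  using Phi_pos h_pos by (auto simp: w0_def)

lemma exponent_pgf:
  fixes \<beta> :: "'b::{real_normed_field,banach,second_countable_topology}"
  assumes "norm (exp (- (\<beta> * of_real h))) \<le> 1"
  shows "exp (- (\<beta> * of_real h)) * (of_real r - laplace_exponent \<nu> \<beta>)
    = of_real (r + lam) * exp (- (\<beta> * of_real h)) - of_real lam * pgf step_pmf (exp (- (\<beta> * of_real h)))"
proof -
  have "exp (- (\<beta> * of_real h)) * exp (\<beta> * of_real h) = 1"
    by (simp flip: exp_add)
  then show ?thesis unfolding laplace_exponent_eq[OF assms] by (simp add: algebra_simps)
qed

lemma w0_root: "0 < r \<Longrightarrow> w0 r = lam / (r + lam) * pgf step_pmf (w0 r)"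
  using exponent_pgf[of "Phi \<nu> r" r] psi_Phi[of r] Phi_pos[of r] h_pos lam_pos
  by (simp add: w0_def field_simps)

end

section \<open>Extrema of lattice paths on a grid\<close>

text \<open>The maximum of the partial sums including the empty one, unfolded at the first step so
  that expectations over independent steps unfold in the same way.\<close>

fun walk_max :: "int list \<Rightarrow> int" where
  "walk_max [] = 0"
| "walk_max (x # xs) = max 0 (x + walk_max xs)"

text \<open>The strict comparison settles ties in favour of index 0, which selects the first
  maximiser.\<close>

fun walk_argmax :: "int list \<Rightarrow> nat" where
  "walk_argmax [] = 0"
| "walk_argmax (x # xs) = (if x + walk_max xs > 0 then Suc (walk_argmax xs) else 0)"

fun walk_min :: "int list \<Rightarrow> int" where
  "walk_min [] = 0"
| "walk_min (x # xs) = min 0 (x + walk_min xs)"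

text \<open>The weak comparison settles ties in favour of the later index, which selects the last
  minimiser.\<close>

fun walk_last_argmin :: "int list \<Rightarrow> nat" where
  "walk_last_argmin [] = 0"
| "walk_last_argmin (x # xs) = (if x + walk_min xs \<le> 0 then Suc (walk_last_argmin xs) else 0)"

lemma walk_argmax:
  shows walk_argmax_le: "walk_argmax xs \<le> length xs"
    and sum_walk_argmax: "sum_list (take (walk_argmax xs) xs) = walk_max xs"
    and sum_le_walk_max: "sum_list (take j xs) \<le> walk_max xs"
    and sum_less_walk_max: "j < walk_argmax xs \<Longrightarrow> sum_list (take j xs) < walk_max xs"
proof -
  have "walk_argmax xs \<le> length xs \<and> sum_list (take (walk_argmax xs) xs) = walk_max xs \<and>
    (\<forall>j. sum_list (take j xs) \<le> walk_max xs) \<and>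
    (\<forall>j<walk_argmax xs. sum_list (take j xs) < walk_max xs)"
  proof (induction xs)
    case (Cons x xs)
    have 1: "sum_list (take j (x # xs)) \<le> walk_max (x # xs)" for j
      using Cons by (cases j) (auto simp: max_def dest: spec[of _ "j - 1"] intro: order.trans)
    have 2: "sum_list (take j (x # xs)) < walk_max (x # xs)" if "j < walk_argmax (x # xs)" for j
      using Cons that by (cases j) (auto split: if_splits)
    show ?case using Cons 1 2 by auto
  qed auto
  then show "walk_argmax xs \<le> length xs" "sum_list (take (walk_argmax xs) xs) = walk_max xs"
    "sum_list (take j xs) \<le> walk_max xs"
    "j < walk_argmax xs \<Longrightarrow> sum_list (take j xs) < walk_max xs" by auto
qed

text \<open>The strict part restricts \<open>j\<close> to the length of the list because
  \<open>take\<close> saturates: past the end it repeats the final sum, which may be the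
  minimum.\<close>

lemma walk_last_argmin:
  shows walk_last_argmin_le: "walk_last_argmin xs \<le> length xs"
    and sum_walk_last_argmin: "sum_list (take (walk_last_argmin xs) xs) = walk_min xs"
    and walk_min_le_sum: "walk_min xs \<le> sum_list (take j xs)"
    and walk_min_less_sum: "walk_last_argmin xs < j \<Longrightarrow> j \<le> length xs \<Longrightarrow> walk_min xs < sum_list (take j xs)"
proof -
  have "walk_last_argmin xs \<le> length xs \<and> sum_list (take (walk_last_argmin xs) xs) = walk_min xs \<and>
    (\<forall>j. walk_min xs \<le> sum_list (take j xs)) \<and>
    (\<forall>j. walk_last_argmin xs < j \<longrightarrow> j \<le> length xs \<longrightarrow> walk_min xs < sum_list (take j xs))"
  proof (induction xs)
    case (Cons x xs)
    have 1: "walk_min (x # xs) \<le> sum_list (take j (x # xs))" for j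
      using Cons by (cases j) (auto simp: min_def dest: spec[of _ "j - 1"] intro: order.trans)
    have 2: "walk_min (x # xs) < sum_list (take j (x # xs))"
      if "walk_last_argmin (x # xs) < j" "j \<le> length (x # xs)" for j
    proof (cases j)
      case (Suc i)
      then show ?thesis using Cons that
        by (cases "x + walk_min xs \<le> 0") (auto simp: min_def dest: spec[of _ i] intro: order.strict_trans2)
    qed (use that in auto)
    show ?case using Cons 1 2 by auto
  qed auto
  then show "walk_last_argmin xs \<le> length xs" "sum_list (take (walk_last_argmin xs) xs) = walk_min xs"
    "walk_min xs \<le> sum_list (take j xs)"
    "walk_last_argmin xs < j \<Longrightarrow> j \<le> length xs \<Longrightarrow> walk_min xs < sum_list (take j xs)" by auto
qed

section \<open>Cadlag lattice paths and the convergence of their grid extrema\<close>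

definition lattice_path :: "real \<Rightarrow> (real \<Rightarrow> real) \<Rightarrow> bool" where
  "lattice_path h x \<longleftrightarrow> cadlag x \<and> (\<forall>t\<ge>0. \<exists>k::int. x t = h * of_int k)"

text \<open>\<open>m\<close> is the number of cells per unit of time, \<open>n\<close> the number of
  cells. The floor only converts to \<open>int\<close>; on lattice paths the quotient is already an
  integer.\<close>

definition grid_increments :: "real \<Rightarrow> (real \<Rightarrow> real) \<Rightarrow> nat \<Rightarrow> nat \<Rightarrow> int list" where
  "grid_increments h x m n = map (\<lambda>i. \<lfloor>(x (real (Suc i) / real m) - x (real i / real m)) / h\<rfloor>) [0..<n]"

lemma length_grid_increments [simp]: "length (grid_increments h x m n) = n"
  by (simp add: grid_increments_def)

lemma sum_grid_increments:
  assumes x: "lattice_path h x" "x 0 = 0" and h: "h > 0" and j: "j \<le> n"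
  shows "h * of_int (sum_list (take j (grid_increments h x m n))) = x (real j / real m)"
  using j
proof (induction j)
  case 0
  show ?case using x by simp
next
  case (Suc j)
  have "\<exists>k::int. x (real i / real m) = h * of_int k" for i
    using x(1) by (simp add: lattice_path_def)
  then obtain k l :: int where k: "x (real (Suc j) / real m) = h * of_int k" "x (real j / real m) = h * of_int l"
    by meson
  have "grid_increments h x m n ! j = \<lfloor>(h * of_int k - h * of_int l) / h\<rfloor>"
    using Suc k by (simp add: grid_increments_def)
  also have "(h * of_int k - h * of_int l) / h = of_int (k - l)" using h by (simp add: field_simps)
  finally have "grid_increments h x m n ! j = k - l" by simp
  moreover have "sum_list (take j (grid_increments h x m n)) = l"
    using Suc k h by simp
  ultimately show ?case using Suc k by (simp add: take_Suc_conv_app_nth)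
qed

text \<open>Lattice points at distance less than \<open>h\<close> coincide, so right-continuity
  becomes constancy on a right neighbourhood.\<close>

lemma lattice_path_right_constant:
  assumes x: "lattice_path h x" and h: "h > 0" and s: "0 \<le> s"
  shows "\<exists>d>0. \<forall>u. s \<le> u \<longrightarrow> u < s + d \<longrightarrow> x u = x s"
proof -
  have "(x \<longlongrightarrow> x s) (at_right s)"
    using x s by (auto simp: lattice_path_def cadlag_def continuous_within)
  then have "eventually (\<lambda>u. dist (x u) (x s) < h) (at_right s)"
    using h by (rule tendstoD)
  then obtain b where b: "s < b" "\<And>u. s < u \<Longrightarrow> u < b \<Longrightarrow> dist (x u) (x s) < h"
    unfolding eventually_at_right_field by blast
  have "x u = x s" if "s \<le> u" "u < s + (b - s)" for u
  proof (cases "u = s")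
    case False
    then have "dist (x u) (x s) < h" using b that by auto
    moreover have "0 \<le> u" using s that by simp
    then obtain k :: int where "x u = h * of_int k" using x by (auto simp: lattice_path_def)
    moreover obtain l :: int where "x s = h * of_int l" using x s by (auto simp: lattice_path_def)
    ultimately have "h * \<bar>of_int (k - l)\<bar> < h * 1" using h by (simp add: dist_real_def abs_mult flip: right_diff_distrib)
    then have "\<bar>k - l\<bar> < 1" using h by (simp only: mult_less_cancel_left_pos)
    then show ?thesis using \<open>x u = _\<close> \<open>x s = _\<close> by simp
  qed simp
  moreover have "0 < b - s" using b(1) by simp
  ultimately show ?thesis by blast
qed

text \<open>Bisection: the right and left limits bound the path near each point, and bounds on
  adjacent intervals combine.\<close>

lemma cadlag_bounded:
  assumes "cadlag x" "0 \<le> t"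
  shows "\<exists>B. \<forall>s\<in>{0..t}. \<bar>x s\<bar> \<le> B"
proof -
  define P where "P a b \<longleftrightarrow> (\<exists>B. \<forall>u. 0 \<le> u \<longrightarrow> a \<le> u \<longrightarrow> u \<le> b \<longrightarrow> \<bar>x u\<bar> \<le> B)" for a b
  have "P 0 t"
    using assms(2)
  proof (induction rule: Bolzano)
    case (trans a b c)
    then obtain B C where BC: "\<And>u. 0 \<le> u \<Longrightarrow> a \<le> u \<Longrightarrow> u \<le> b \<Longrightarrow> \<bar>x u\<bar> \<le> B"
      "\<And>u. 0 \<le> u \<Longrightarrow> b \<le> u \<Longrightarrow> u \<le> c \<Longrightarrow> \<bar>x u\<bar> \<le> C"
      unfolding P_def by metis
    have "\<bar>x u\<bar> \<le> max B C" if "0 \<le> u" "a \<le> u" "u \<le> c" for u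
      using BC[of u] that by (cases "u \<le> b") auto
    then show ?case unfolding P_def by blast
  next
    case (local s)
    have "(x \<longlongrightarrow> x s) (at_right s)"
      using assms(1) local by (auto simp: cadlag_def continuous_within)
    then have "eventually (\<lambda>u. dist (x u) (x s) < 1) (at_right s)"
      by (rule tendstoD) simp
    then obtain b where b: "s < b" "\<And>u. s < u \<Longrightarrow> u < b \<Longrightarrow> dist (x u) (x s) < 1"
      unfolding eventually_at_right_field by blast
    \<comment> \<open>At \<open>s = 0\<close> there is no left limit; any negative \<open>a\<close>
      works, since only nonnegative \<open>u\<close> are considered.\<close>
    have "\<exists>a l. a < s \<and> (\<forall>u\<ge>0. a < u \<and> u < s \<longrightarrow> dist (x u) l < 1)"
    proof (cases "s = 0")
      case True
      then show ?thesis by (intro exI[of _ "-1"]) auto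
    next
      case False
      with local have "0 < s" by simp
      then obtain l where "(x \<longlongrightarrow> l) (at_left s)" using assms(1) unfolding cadlag_def by blast
      then have "eventually (\<lambda>u. dist (x u) l < 1) (at_left s)" by (rule tendstoD) simp
      then show ?thesis unfolding eventually_at_left_field by blast
    qed
    then obtain a l where a: "a < s" "\<And>u. 0 \<le> u \<Longrightarrow> a < u \<Longrightarrow> u < s \<Longrightarrow> dist (x u) l < 1" by blast
    have "P a' b'" if ab: "a' \<le> s \<and> s \<le> b' \<and> b' - a' < min (b - s) (s - a)" for a' b'
    proof -
      have "\<bar>x u\<bar> \<le> max (\<bar>x s\<bar> + 1) (\<bar>l\<bar> + 1)" if u: "0 \<le> u" "a' \<le> u" "u \<le> b'" for u
      proof -
        have "a < u" "u < b" using ab u by auto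
        then show ?thesis using a(2)[of u] b(2)[of u] u
          by (cases u s rule: linorder_cases) (auto simp: dist_real_def)
      qed
      then show ?thesis unfolding P_def by blast
    qed
    then show ?case
      using a(1) b(1) by (intro exI[of _ "min (b - s) (s - a)"]) auto
  qed
  then obtain B where "\<And>u. 0 \<le> u \<Longrightarrow> u \<le> t \<Longrightarrow> \<bar>x u\<bar> \<le> B" unfolding P_def by blast
  then show ?thesis by (intro exI[of _ B]) simp
qed

text \<open>A bounded lattice path takes finitely many values on a compact interval, so the maximum
  is attained, and right-constancy makes the infimum of the maximisers a maximiser.\<close>

lemma lattice_path_first_max:
  assumes x: "lattice_path h x" and h: "h > 0" and t: "0 \<le> t"
  obtains s where "s \<in> {0..t}" "\<And>u. u \<in> {0..t} \<Longrightarrow> x u \<le> x s" "\<And>u. 0 \<le> u \<Longrightarrow> u < s \<Longrightarrow> x u < x s"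
proof -
  obtain B where B: "\<And>s. s \<in> {0..t} \<Longrightarrow> \<bar>x s\<bar> \<le> B"
    using cadlag_bounded[of x t] t x unfolding lattice_path_def by blast
  define K where "K = (\<lambda>s. \<lfloor>x s / h\<rfloor>) ` {0..t}"
  have "\<lfloor>- B / h\<rfloor> \<le> \<lfloor>x s / h\<rfloor> \<and> \<lfloor>x s / h\<rfloor> \<le> \<lfloor>B / h\<rfloor>" if "s \<in> {0..t}" for s
    using B[OF that] h by (intro conjI floor_mono divide_right_mono) auto
  then have "K \<subseteq> {\<lfloor>- B / h\<rfloor>..\<lfloor>B / h\<rfloor>}"
    unfolding K_def by auto
  then have fin: "finite K" by (rule finite_subset) simp
  moreover have "K \<noteq> {}" using t by (auto simp: K_def)
  ultimately have "Max K \<in> K" by (rule Max_in)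
  then obtain s0 where s0: "s0 \<in> {0..t}" "Max K = \<lfloor>x s0 / h\<rfloor>" by (auto simp: K_def)
  have floor: "x u = h * of_int \<lfloor>x u / h\<rfloor>" if u: "0 \<le> u" for u
  proof -
    obtain k :: int where "x u = h * of_int k" using x u unfolding lattice_path_def by blast
    then show ?thesis using h by simp
  qed
  have max: "x u \<le> x s0" if u: "u \<in> {0..t}" for u
  proof -
    have "\<lfloor>x u / h\<rfloor> \<le> \<lfloor>x s0 / h\<rfloor>"
      unfolding s0(2)[symmetric] using u fin by (intro Max_ge) (auto simp: K_def)
    then show ?thesis using u s0(1) h by (subst (1 2) floor) auto
  qed
  define A where "A = {u \<in> {0..t}. x u = x s0}"
  have A: "A \<noteq> {}" "bdd_below A" using s0 by (auto simp: A_def intro!: bdd_belowI[of _ 0])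
  have s: "Inf A \<in> {0..t}"
    using A s0 by (auto simp: A_def intro!: cInf_greatest cInf_lower2[of s0])
  obtain d where d: "d > 0" "\<And>u. Inf A \<le> u \<Longrightarrow> u < Inf A + d \<Longrightarrow> x u = x (Inf A)"
    using lattice_path_right_constant[OF x h, of "Inf A"] s by auto
  \<comment> \<open>Some maximiser lies in the interval of constancy to the right of
    \<open>Inf A\<close>, so the value at \<open>Inf A\<close> is maximal too.\<close>
  have "\<exists>u\<in>A. u < Inf A + d" using cInf_less_iff[OF A, of "Inf A + d"] d(1) by auto
  then obtain u where u: "u \<in> A" "u < Inf A + d" ..
  then have "x u = x (Inf A)" using d(2) A(2) by (auto intro: cInf_lower)
  then have eq: "x (Inf A) = x s0" using u by (simp add: A_def)
  show ?thesis
  proof (rule that[OF s])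
    show "x u \<le> x (Inf A)" if "u \<in> {0..t}" for u using max[OF that] eq by simp
    show "x u < x (Inf A)" if "0 \<le> u" "u < Inf A" for u
    proof -
      have "u \<notin> A" using that(2) A(2) cInf_lower by fastforce
      then show ?thesis using that s eq max[of u] by (force simp: A_def)
    qed
  qed
qed

lemma lattice_path_uminus:
  assumes x: "lattice_path h x"
  shows "lattice_path h (\<lambda>t. - x t)"
  unfolding lattice_path_def cadlag_def
proof (intro conjI allI impI)
  fix t :: real
  assume t: "0 \<le> t"
  show "continuous (at_right t) (\<lambda>t. - x t)"
    by (rule continuous_minus) (use x t in \<open>unfold lattice_path_def cadlag_def, blast\<close>)
  obtain k :: int where "x t = h * of_int k" using x t unfolding lattice_path_def by blast
  then show "\<exists>k::int. - x t = h * of_int k" by (intro exI[of _ "- k"]) simp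
next
  fix t :: real
  assume "0 < t"
  then obtain l where "(x \<longlongrightarrow> l) (at_left t)"
    using x unfolding lattice_path_def cadlag_def by blast
  then show "\<exists>l. ((\<lambda>t. - x t) \<longlongrightarrow> l) (at_left t)" by (blast intro: tendsto_minus)
qed

lemma ceiling_grid:
  assumes m: "m > 0" "1 / real m < d" and s: "0 \<le> s"
  defines "j \<equiv> nat \<lceil>real m * s\<rceil>"
  shows "s \<le> real j / real m" "real j / real m < s + 1 / real m" "real j / real m < s + d"
    "\<And>i. i < j \<Longrightarrow> real i / real m < s"
proof -
  have "0 \<le> real m * s" using s by simp
  then have "0 \<le> \<lceil>real m * s\<rceil>" by linarith
  then have j: "real j = of_int \<lceil>real m * s\<rceil>" unfolding j_def by simp
  have "real m * s \<le> real j" "real j < real m * s + 1" unfolding j by linarith+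
  then show "s \<le> real j / real m" "real j / real m < s + 1 / real m" using m by (simp_all add: field_simps)
  then show "real j / real m < s + d" using m by simp
  show "real i / real m < s" if "i < j" for i
  proof -
    have "of_int (int i) < real m * s" using that unfolding j_def by linarith
    then show ?thesis using m by (simp add: field_simps)
  qed
qed

lemma eventually_inverse_less:
  assumes "d > 0"
  shows "eventually (\<lambda>m. m > 0 \<and> 1 / real m < d) sequentially"
  using order_tendstoD(2)[OF lim_1_over_n assms] eventually_gt_at_top[of "0::nat"]
  by eventually_elim auto

text \<open>Let \<open>s\<close> be the first maximiser. On a fine mesh the first grid point at or
  after \<open>s\<close> still sees the maximal value, while all earlier grid points lie before
  \<open>s\<close> and see smaller ones. So the maximum is exact and its index is the ceiling of
  \<open>m * s\<close>. The third claim later frees the weight at level 0 of \<alpha>.\<close>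

lemma grid_max_limit:
  fixes X :: "real \<Rightarrow> 'a \<Rightarrow> real"
  assumes x: "lattice_path h (\<lambda>s. X s \<omega>)" "X 0 \<omega> = 0" and h: "h > 0" and t: "0 < t"
  defines "g m \<equiv> grid_increments h (\<lambda>s. X s \<omega>) m (nat \<lceil>real m * t\<rceil>)"
  shows "eventually (\<lambda>m. h * of_int (walk_max (g m)) = running_sup X t \<omega>) sequentially"
    and "(\<lambda>m. real (walk_argmax (g m)) / real m) \<longlonglongrightarrow> first_sup_time X t \<omega>"
    and "running_sup X t \<omega> = 0 \<Longrightarrow> first_sup_time X t \<omega> = 0"
proof -
  let ?x = "\<lambda>s. X s \<omega>"
  obtain s where s: "s \<in> {0..t}" "\<And>u. u \<in> {0..t} \<Longrightarrow> ?x u \<le> ?x s" "\<And>u. 0 \<le> u \<Longrightarrow> u < s \<Longrightarrow> ?x u < ?x s"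
    by (rule lattice_path_first_max[OF x(1) h less_imp_le[OF t]]) (rule that)
  have sup: "running_sup X t \<omega> = ?x s"
    unfolding running_sup_def by (rule cSup_eq_maximum) (use s in auto)
  have first: "first_sup_time X t \<omega> = s"
    unfolding first_sup_time_def sup
    by (rule cInf_eq_minimum) (use s(1) s(3) in \<open>force simp: not_less[symmetric]\<close>)+
  show "first_sup_time X t \<omega> = 0" if "running_sup X t \<omega> = 0"
    using s(3)[of 0] s(1) that x(2) unfolding first sup by force
  obtain d1 where d1: "d1 > 0" "\<And>u. s \<le> u \<Longrightarrow> u < s + d1 \<Longrightarrow> ?x u = ?x s"
    using lattice_path_right_constant[OF x(1) h, of s] s by auto
  \<comment> \<open>The last grid point may overshoot \<open>t\<close>; right-constancy at
    \<open>t\<close> makes its value harmless.\<close>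
  obtain d2 where d2: "d2 > 0" "\<And>u. t \<le> u \<Longrightarrow> u < t + d2 \<Longrightarrow> ?x u = ?x t"
    using lattice_path_right_constant[OF x(1) h, of t] t by auto
  have ev: "h * of_int (walk_max (g m)) = ?x s \<and> walk_argmax (g m) = nat \<lceil>real m * s\<rceil>"
    if m: "m > 0" "1 / real m < min d1 d2" for m
  proof -
    define n where "n = nat \<lceil>real m * t\<rceil>"
    define j0 where "j0 = nat \<lceil>real m * s\<rceil>"
    have j0n: "j0 \<le> n" unfolding n_def j0_def using s by (intro nat_mono ceiling_mono mult_left_mono) auto
    have gj: "h * of_int (sum_list (take j (g m))) = ?x (real j / real m)" if "j \<le> n" for j
      unfolding g_def using that by (intro sum_grid_increments x h) (simp add: n_def)
    have "1 / real m < d1" "1 / real m < d2" using m by auto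
    note c1 = ceiling_grid[OF m(1) this(1), of s, folded j0_def]
      and c2 = ceiling_grid[OF m(1) this(2), of t, folded n_def]
    have xj0: "?x (real j0 / real m) = ?x s" using c1 s(1) by (intro d1) auto
    have le: "?x (real j / real m) \<le> ?x s" if "j \<le> n" for j
    proof (cases "j = n")
      case True
      have "?x (real n / real m) = ?x t" using c2 t by (intro d2) auto
      then show ?thesis using True s(2)[of t] t by simp
    next
      case False
      then have "real j / real m < t" using c2(4)[of j] that t by simp
      then show ?thesis by (intro s) auto
    qed
    have len: "walk_argmax (g m) \<le> n" using walk_argmax_le[of "g m"] by (simp add: g_def n_def)
    have max: "h * of_int (walk_max (g m)) = ?x (real (walk_argmax (g m)) / real m)"
      using gj[OF len] by (simp add: sum_walk_argmax)
    have "h * of_int (sum_list (take j0 (g m))) \<le> h * of_int (walk_max (g m))"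
      using sum_le_walk_max[of j0 "g m"] h by simp
    then have 1: "h * of_int (walk_max (g m)) = ?x s"
      using gj[OF j0n] xj0 le[OF len] max by linarith
    moreover have "\<not> j0 < walk_argmax (g m)"
    proof
      assume "j0 < walk_argmax (g m)"
      from sum_less_walk_max[OF this] have "h * of_int (sum_list (take j0 (g m))) < h * of_int (walk_max (g m))"
        using h by simp
      then show False using gj[OF j0n] xj0 1 by simp
    qed
    moreover have "\<not> walk_argmax (g m) < j0"
    proof
      assume "walk_argmax (g m) < j0"
      then have "real (walk_argmax (g m)) / real m < s" using c1(4) s by simp
      then show False using s(3)[of "real (walk_argmax (g m)) / real m"] max 1 by simp
    qed
    ultimately show ?thesis by (simp add: j0_def)
  qed
  have event: "eventually (\<lambda>m. m > 0 \<and> 1 / real m < min d1 d2) sequentially"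
    using d1 d2 by (intro eventually_inverse_less) simp
  show "eventually (\<lambda>m. h * of_int (walk_max (g m)) = running_sup X t \<omega>) sequentially"
    using event by eventually_elim (use ev sup in auto)
  show "(\<lambda>m. real (walk_argmax (g m)) / real m) \<longlonglongrightarrow> first_sup_time X t \<omega>"
    unfolding first
  proof (rule real_tendsto_sandwich)
    show "eventually (\<lambda>m. s \<le> real (walk_argmax (g m)) / real m) sequentially"
      using event by eventually_elim (use ev ceiling_grid(1)[of _ "min d1 d2" s] s(1) in auto)
    show "eventually (\<lambda>m. real (walk_argmax (g m)) / real m \<le> s + 1 / real m) sequentially"
      using event by eventually_elim (use ev ceiling_grid(2)[of _ "min d1 d2" s] s(1) in \<open>auto intro: less_imp_le\<close>)
    show "(\<lambda>m. s + 1 / real m) \<longlonglongrightarrow> s"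
      using tendsto_add[OF tendsto_const[of s] lim_1_over_n] by simp
  qed simp
qed

text \<open>\<open>last_inf_time\<close> collects the times at which the path equals its infimum so
  far; the last of these are governed by the minimisers over all of \<open>{0..t}\<close>. The
  supremum of the minimisers need not be one of them, as the path may jump up exactly there. The
  time is therefore squeezed: the grid index exceeds it by at most one cell, and minimisers close to
  it bound the index from below.\<close>

lemma grid_min_limit:
  fixes X :: "real \<Rightarrow> 'a \<Rightarrow> real"
  assumes x: "lattice_path h (\<lambda>s. X s \<omega>)" "X 0 \<omega> = 0" and h: "h > 0" and t: "0 < t"
  defines "g m \<equiv> grid_increments h (\<lambda>s. X s \<omega>) m (nat \<lceil>real m * t\<rceil>)"
  shows "eventually (\<lambda>m. h * of_int (walk_min (g m)) = running_inf X t \<omega>) sequentially"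
    and "(\<lambda>m. real (walk_last_argmin (g m)) / real m) \<longlonglongrightarrow> last_inf_time X t \<omega>"
proof -
  let ?x = "\<lambda>s. X s \<omega>"
  have min_ex: "\<exists>u\<in>{0..s}. (\<forall>v\<in>{0..s}. ?x u \<le> ?x v)" if s: "0 \<le> s" for s
  proof -
    obtain u where "u \<in> {0..s}" "\<And>v. v \<in> {0..s} \<Longrightarrow> - ?x v \<le> - ?x u"
        "\<And>v. 0 \<le> v \<Longrightarrow> v < u \<Longrightarrow> - ?x v < - ?x u"
      by (rule lattice_path_first_max[OF lattice_path_uminus[OF x(1)] h s]) (rule that)
    then show ?thesis by (intro bexI[of _ u]) auto
  qed
  have inf_eq: "running_inf X s \<omega> = ?x u" if "u \<in> {0..s}" "\<forall>v\<in>{0..s}. ?x u \<le> ?x v" for s u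
    unfolding running_inf_def by (rule cInf_eq_minimum) (use that in auto)
  obtain u0 where u0: "u0 \<in> {0..t}" "\<forall>v\<in>{0..t}. ?x u0 \<le> ?x v" using min_ex[of t] t by auto
  define T where "T = {s \<in> {0..t}. ?x s = ?x u0}"
  have T: "T \<noteq> {}" "bdd_above T" using u0 by (auto simp: T_def intro!: bdd_aboveI[of _ t])
  define S where "S = {s \<in> {0..t}. ?x s = running_inf X s \<omega>}"
  have TS: "T \<subseteq> S"
  proof
    fix s assume "s \<in> T"
    then have "running_inf X s \<omega> = ?x s" using u0 by (intro inf_eq) (auto simp: T_def)
    then show "s \<in> S" using \<open>s \<in> T\<close> by (auto simp: S_def T_def)
  qed
  \<comment> \<open>If the infimum so far at \<open>s\<close> is above the overall minimum, the
    overall minimiser \<open>u0\<close> comes later than \<open>s\<close>.\<close>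
  have ST: "\<exists>s'\<in>T. s \<le> s'" if "s \<in> S" for s
  proof (cases "s \<in> T")
    case False
    obtain u where u: "u \<in> {0..s}" "\<forall>v\<in>{0..s}. ?x u \<le> ?x v" using min_ex[of s] \<open>s \<in> S\<close> by (auto simp: S_def)
    then have "?x s = ?x u" using inf_eq[OF u] \<open>s \<in> S\<close> by (auto simp: S_def)
    have "?x s > ?x u0" using False \<open>s \<in> S\<close> u0 by (force simp: S_def T_def)
    moreover have "?x s \<le> ?x u0" if "u0 \<le> s"
      using u(2) u0(1) that \<open>?x s = ?x u\<close> by simp
    ultimately have "\<not> u0 \<le> s" by linarith
    then show ?thesis using u0 by (intro bexI[of _ u0]) (auto simp: T_def)
  qed auto
  have "Sup S = Sup T"
  proof (rule antisym)
    have "bdd_above S" by (auto simp: S_def intro!: bdd_aboveI[of _ t])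
    then show "Sup T \<le> Sup S" using T TS by (intro cSup_subset_mono) auto
    show "Sup S \<le> Sup T" using T TS ST by (intro cSup_mono) auto
  qed
  then have last: "last_inf_time X t \<omega> = Sup T" by (simp add: last_inf_time_def S_def)
  have inf: "running_inf X t \<omega> = ?x u0" using u0 by (rule inf_eq)
  obtain d0 where d0: "d0 > 0" "\<And>u. u0 \<le> u \<Longrightarrow> u < u0 + d0 \<Longrightarrow> ?x u = ?x u0"
    using lattice_path_right_constant[OF x(1) h, of u0] u0 by auto
  obtain d2 where d2: "d2 > 0" "\<And>u. t \<le> u \<Longrightarrow> u < t + d2 \<Longrightarrow> ?x u = ?x t"
    using lattice_path_right_constant[OF x(1) h, of t] t by auto
  have ev: "h * of_int (walk_min (g m)) = ?x u0 \<and> real (walk_last_argmin (g m)) / real m \<le> Sup T + 1 / real m"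
    if m: "m > 0" "1 / real m < min d0 d2" for m
  proof -
    define n where "n = nat \<lceil>real m * t\<rceil>"
    define j0 where "j0 = nat \<lceil>real m * u0\<rceil>"
    define l where "l = walk_last_argmin (g m)"
    have j0n: "j0 \<le> n" unfolding n_def j0_def using u0 by (intro nat_mono ceiling_mono mult_left_mono) auto
    have gj: "h * of_int (sum_list (take j (g m))) = ?x (real j / real m)" if "j \<le> n" for j
      unfolding g_def using that by (intro sum_grid_increments x h) (simp add: n_def)
    have "1 / real m < d0" "1 / real m < d2" using m by auto
    note c1 = ceiling_grid[OF m(1) this(1), of u0, folded j0_def]
      and c2 = ceiling_grid[OF m(1) this(2), of t, folded n_def]
    have xj0: "?x (real j0 / real m) = ?x u0" using c1 u0(1) by (intro d0) auto
    have xn: "?x (real n / real m) = ?x t" using c2 t by (intro d2) auto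
    have below: "real j / real m \<in> {0..t}" if "j < n" for j
      using c2(4)[of j] that t by simp
    have le: "?x u0 \<le> ?x (real j / real m)" if "j \<le> n" for j
    proof (cases "j = n")
      case True
      then show ?thesis using xn u0(2) t by simp
    next
      case False
      then show ?thesis using u0(2) below[of j] that by simp
    qed
    have len: "l \<le> n" using walk_last_argmin_le[of "g m"] by (simp add: g_def n_def l_def)
    have min: "h * of_int (walk_min (g m)) = ?x (real l / real m)"
      using gj[OF len] by (simp add: sum_walk_last_argmin l_def)
    have "h * of_int (walk_min (g m)) \<le> h * of_int (sum_list (take j0 (g m)))"
      using walk_min_le_sum[of "g m" j0] h by simp
    then have 1: "h * of_int (walk_min (g m)) = ?x u0"
      using gj[OF j0n] xj0 le[OF len] min by linarith
    have "real l / real m \<le> Sup T + 1 / real m"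
    \<comment> \<open>The last grid point may lie beyond \<open>t\<close>, but it carries the value
      at \<open>t\<close>, so in this case \<open>t\<close> is itself a minimiser.\<close>
    proof (cases "l = n")
      case True
      then have "t \<in> T" using xn min 1 t by (simp add: T_def)
      then have "t \<le> Sup T" using T(2) by (rule cSup_upper)
      then show ?thesis using c2(2) t True by simp
    next
      case False
      then have "real l / real m \<in> T" using below[of l] len min 1 by (simp add: T_def)
      then have "real l / real m \<le> Sup T" using T(2) by (rule cSup_upper)
      then show ?thesis by (simp add: add_increasing2)
    qed
    with 1 show ?thesis by (simp add: l_def)
  qed
  have event: "eventually (\<lambda>m. m > 0 \<and> 1 / real m < min d0 d2) sequentially"
    using d0 d2 by (intro eventually_inverse_less) simp
  show "eventually (\<lambda>m. h * of_int (walk_min (g m)) = running_inf X t \<omega>) sequentially"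
    using event by eventually_elim (use ev inf in auto)
  show "(\<lambda>m. real (walk_last_argmin (g m)) / real m) \<longlonglongrightarrow> last_inf_time X t \<omega>"
    unfolding last
  proof (rule order_tendstoI)
    fix a assume "a < Sup T"
    \<comment> \<open>A genuine minimiser beyond \<open>a\<close>; the mesh is refined further so
      that a grid point falls into its interval of constancy.\<close>
    then obtain s1 where s1: "s1 \<in> T" "a < s1" using less_cSup_iff[OF T] by auto
    obtain d1 where d1: "d1 > 0" "\<And>u. s1 \<le> u \<Longrightarrow> u < s1 + d1 \<Longrightarrow> ?x u = ?x s1"
      using lattice_path_right_constant[OF x(1) h, of s1] s1 by (auto simp: T_def)
    have "eventually (\<lambda>m. m > 0 \<and> 1 / real m < d1) sequentially"
      using d1 by (intro eventually_inverse_less) simp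
    with event show "eventually (\<lambda>m. a < real (walk_last_argmin (g m)) / real m) sequentially"
    proof eventually_elim
      case (elim m)
      define n where "n = nat \<lceil>real m * t\<rceil>"
      define j where "j = nat \<lceil>real m * s1\<rceil>"
      have s1': "0 \<le> s1" "s1 \<le> t" "?x s1 = ?x u0" using s1 by (auto simp: T_def)
      have jn: "j \<le> n" unfolding n_def j_def using s1' by (intro nat_mono ceiling_mono mult_left_mono) auto
      note c = ceiling_grid[of m d1 s1, folded j_def]
      have xj: "?x (real j / real m) = ?x s1" using c elim s1' by (intro d1) auto
      have sumj: "h * of_int (sum_list (take j (g m))) = ?x (real j / real m)"
        unfolding g_def using jn by (intro sum_grid_increments x h) (simp add: n_def)
      have "\<not> walk_last_argmin (g m) < j"
      proof
        assume "walk_last_argmin (g m) < j"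
        from walk_min_less_sum[OF this] jn have "walk_min (g m) < sum_list (take j (g m))"
          by (simp add: g_def n_def)
        then have "h * of_int (walk_min (g m)) < h * of_int (sum_list (take j (g m)))" using h by simp
        then show False using sumj xj s1' ev elim by simp
      qed
      then have "real j / real m \<le> real (walk_last_argmin (g m)) / real m"
        by (intro divide_right_mono) auto
      then show ?case using c(1) elim s1' s1(2) by simp
    qed
  next
    fix a assume "Sup T < a"
    then have "eventually (\<lambda>m. m > 0 \<and> 1 / real m < a - Sup T) sequentially"
      by (intro eventually_inverse_less) simp
    with event show "eventually (\<lambda>m. real (walk_last_argmin (g m)) / real m < a) sequentially"
    proof eventually_elim
      case (elim m)
      then show ?case using ev[of m] by simp
    qed
  qed
qed

section \<open>Geometrically killed walks\<close>

lemma skip_free_pmf_sums_real: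
  fixes f :: "int \<Rightarrow> real"
  assumes x: "x > 0" and C: "\<And>k. \<bar>f k\<bar> \<le> C"
  shows "(\<lambda>n. x ^ n / fact n * exp (- x) * (\<integral>i. f (int n - int i) \<partial>iid_sum p n))
           sums (\<integral>k. f k \<partial>skip_free_pmf x p)"
proof -
  have "(\<lambda>n. (x ^ n / fact n * exp (- x)) *\<^sub>R (\<integral>i. complex_of_real (f (int n - int i)) \<partial>iid_sum p n))
           sums (\<integral>k. complex_of_real (f k) \<partial>skip_free_pmf x p)"
    by (rule skip_free_pmf_sums[OF x, where C=C]) (use C in simp)
  then have "(\<lambda>n. complex_of_real (x ^ n / fact n * exp (- x) * (\<integral>i. f (int n - int i) \<partial>iid_sum p n)))
           sums complex_of_real (\<integral>k. f k \<partial>skip_free_pmf x p)"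
    by (simp only: integral_complex_of_real scaleR_conv_of_real of_real_mult)
  then show ?thesis by (simp only: sums_of_real_iff)
qed

lemma expectation_iid_sum_1:
  fixes f :: "nat \<Rightarrow> 'b::{banach, second_countable_topology}"
  shows "(\<integral>i. f i \<partial>iid_sum p (Suc 0)) = (\<integral>i. f i \<partial>p)"
proof -
  have "map_pmf (\<lambda>(x, y). x + y) (pair_pmf p (return_pmf 0)) = p"
    by (simp add: pair_return_pmf2 map_pmf_comp case_prod_unfold)
  then show ?thesis by simp
qed

lemma abs_expectation_le:
  fixes f :: "'a \<Rightarrow> real"
  assumes "\<And>x. \<bar>f x\<bar> \<le> C"
  shows "\<bar>\<integral>x. f x \<partial>measure_pmf p\<bar> \<le> C"
proof -
  have "\<bar>\<integral>x. f x \<partial>measure_pmf p\<bar> \<le> (\<integral>x. C \<partial>measure_pmf p)"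
    by (rule order.trans[OF integral_abs_bound integral_mono])
       (auto intro!: assms measure_pmf.integrable_const_bound[where B=C])
  then show ?thesis by simp
qed

text \<open>The terms with no jump and with one jump are split off; the rest is bounded by the
  probability of at least two jumps.\<close>

lemma skip_free_first_order:
  assumes x: "x > 0" and f: "\<And>k. \<bar>f k\<bar> \<le> 1"
  shows "\<bar>(\<integral>k. f k \<partial>skip_free_pmf x p) - exp (- x) * f 0 - x * exp (- x) * (\<integral>i. f (1 - int i) \<partial>p)\<bar> \<le> x\<^sup>2"
proof -
  define A where "A n = (\<integral>i. f (int n - int i) \<partial>iid_sum p n)" for n
  have A: "\<bar>A n\<bar> \<le> 1" for n unfolding A_def by (rule abs_expectation_le) (rule f)
  have s: "(\<lambda>n. x ^ n / fact n * exp (- x) * A n) sums (\<integral>k. f k \<partial>skip_free_pmf x p)"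
    unfolding A_def by (rule skip_free_pmf_sums_real[OF x f])
  have s2: "(\<lambda>n. x ^ (n + 2) / fact (n + 2) * exp (- x) * A (n + 2)) sums
     ((\<integral>k. f k \<partial>skip_free_pmf x p) - exp (- x) * f 0 - x * exp (- x) * (\<integral>i. f (1 - int i) \<partial>p))"
  proof -
    have "A 0 = f 0" by (simp add: A_def)
    moreover have "A (Suc 0) = (\<integral>i. f (1 - int i) \<partial>p)"
      unfolding A_def by (subst expectation_iid_sum_1) simp
    moreover have "(\<lambda>n. x ^ (n + 2) / fact (n + 2) * exp (- x) * A (n + 2)) sums
       ((\<integral>k. f k \<partial>skip_free_pmf x p) - (\<Sum>n<2. x ^ n / fact n * exp (- x) * A n))"
      by (rule sums_split_initial_segment[OF s])
    ultimately show ?thesis by (simp add: numeral_2_eq_2 algebra_simps)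
  qed
  have "pmf (poisson_pmf x) = (\<lambda>n. x ^ n / fact n * exp (- x))" using x by (simp add: fun_eq_iff)
  then have "(\<lambda>n. x ^ n / fact n * exp (- x)) sums 1" using pmf_nat_sums_1[of "poisson_pmf x"] by simp
  from sums_split_initial_segment[OF this, of 2]
  have s3: "(\<lambda>n. x ^ (n + 2) / fact (n + 2) * exp (- x)) sums (1 - (1 + x) * exp (- x))"
    by (simp add: numeral_2_eq_2 algebra_simps)
  have "norm ((\<integral>k. f k \<partial>skip_free_pmf x p) - exp (- x) * f 0 - x * exp (- x) * (\<integral>i. f (1 - int i) \<partial>p))
     \<le> 1 - (1 + x) * exp (- x)"
  proof (rule norm_sums_le[OF s2 s3])
    show "norm (x ^ (n + 2) / fact (n + 2) * exp (- x) * A (n + 2)) \<le> x ^ (n + 2) / fact (n + 2) * exp (- x)" for n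
      using mult_left_mono[OF A[of "n + 2"], of "x ^ (n + 2) / fact (n + 2) * exp (- x)"] x
      by (simp add: abs_mult)
  qed
  also have "\<dots> \<le> x\<^sup>2"
  proof -
    \<comment> \<open>The Poisson tail \<open>1 - (1 + x) * exp (- x)\<close> is at most
      \<open>1 - (1 + x) * (1 - x)\<close>, that is \<open>x^2\<close>.\<close>
    have "(1 + x) * (1 - x) \<le> (1 + x) * exp (- x)"
      using x exp_ge_add_one_self[of "- x"] by (intro mult_left_mono) auto
    then show ?thesis by (simp add: algebra_simps power2_eq_square)
  qed
  finally show ?thesis by simp
qed

text \<open>The infinitesimal generator seen through cells of length \<open>1 / m\<close>: once the
  empty cell is subtracted, the single jump dominates. The function varies with \<open>m\<close>
  because it will contain the expectation over the rest of the walk on the same grid.\<close>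

lemma skip_free_limit:
  fixes f :: "nat \<Rightarrow> int \<Rightarrow> real"
  assumes c: "c > 0" and f: "\<And>m k. \<bar>f m k\<bar> \<le> 1"
    and lim: "\<And>i. (\<lambda>m. f m (1 - int i)) \<longlonglongrightarrow> g i"
  shows "(\<lambda>m. real m * ((\<integral>k. f m k \<partial>skip_free_pmf (c / real m) p) - exp (- c / real m) * f m 0))
           \<longlonglongrightarrow> c * (\<integral>i. g i \<partial>p)"
proof -
  define R where "R m = (\<integral>k. f m k \<partial>skip_free_pmf (c / real m) p) - exp (- c / real m) * f m 0
     - c / real m * exp (- c / real m) * (\<integral>i. f m (1 - int i) \<partial>p)" for m :: nat
  have R: "\<bar>R m\<bar> \<le> (c / real m)\<^sup>2" if "m > 0" for m
    using skip_free_first_order[of "c / m" "f m" p] c f that by (simp add: R_def)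
  have "(\<lambda>m. real m * R m) \<longlonglongrightarrow> 0"
  proof (rule Lim_null_comparison)
    show "eventually (\<lambda>m. norm (real m * R m) \<le> c\<^sup>2 / m) sequentially"
      using eventually_gt_at_top[of "0::nat"]
    proof eventually_elim
      case (elim m)
      have "norm (real m * R m) \<le> real m * (c / real m)\<^sup>2"
        using mult_left_mono[OF R[OF elim], of "real m"] by (simp add: abs_mult)
      also have "\<dots> = c\<^sup>2 / real m" using elim by (simp add: power2_eq_square)
      finally show ?case .
    qed
    show "(\<lambda>m. c\<^sup>2 / real m) \<longlonglongrightarrow> 0" by real_asymp
  qed
  moreover have "(\<lambda>m. \<integral>i. f m (1 - int i) \<partial>p) \<longlonglongrightarrow> (\<integral>i. g i \<partial>p)"
    by (rule integral_dominated_convergence[where w="\<lambda>_. 1"]) (use lim f in auto)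
  moreover have "(\<lambda>m. exp (- c / real m)) \<longlonglongrightarrow> 1" by real_asymp
  ultimately have "(\<lambda>m. real m * R m + c * exp (- c / real m) * (\<integral>i. f m (1 - int i) \<partial>p))
     \<longlonglongrightarrow> 0 + c * 1 * (\<integral>i. g i \<partial>p)"
    by (intro tendsto_intros)
  moreover have "eventually (\<lambda>m. real m * R m + c * exp (- c / real m) * (\<integral>i. f m (1 - int i) \<partial>p)
     = real m * ((\<integral>k. f m k \<partial>skip_free_pmf (c / real m) p) - exp (- c / real m) * f m 0)) sequentially"
    using eventually_gt_at_top[of "0::nat"] by eventually_elim (simp add: R_def field_simps)
  ultimately have "(\<lambda>m. real m * ((\<integral>k. f m k \<partial>skip_free_pmf (c / real m) p) - exp (- c / real m) * f m 0))
      \<longlonglongrightarrow> 0 + c * 1 * (\<integral>i. g i \<partial>p)"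
    by (rule Lim_transform_eventually)
  then show ?thesis by simp
qed

section \<open>Walks stopped at a geometric time\<close>

lemma pmf_replicate_pmf:
  "pmf (replicate_pmf n p) xs = (if length xs = n then prod_list (map (pmf p) xs) else 0)"
proof (induction n arbitrary: xs)
  case 0
  show ?case by (auto simp: indicator_def)
next
  case (Suc n)
  have eq: "replicate_pmf (Suc n) p = map_pmf (\<lambda>(x, xs). x # xs) (pair_pmf p (replicate_pmf n p))"
    by (simp add: pair_pmf_def map_bind_pmf map_pmf_def bind_assoc_pmf bind_return_pmf)
  show ?case
  proof (cases xs)
    case Nil
    then show ?thesis unfolding eq by (simp add: pmf_map vimage_def case_prod_unfold)
  next
    case (Cons y ys)
    have "pmf (map_pmf (\<lambda>(x, xs). x # xs) (pair_pmf p (replicate_pmf n p))) ((\<lambda>(x, xs). x # xs) (y, ys))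
       = pmf (pair_pmf p (replicate_pmf n p)) (y, ys)"
      by (rule pmf_map_inj') (auto simp: inj_def)
    then show ?thesis unfolding eq Cons by (simp add: pmf_pair Suc)
  qed
qed

text \<open>The number of cells needed to cover an exponential time is at least 1, whereas
  \<open>geometric_pmf\<close> starts at 0; hence \<open>Suc n\<close>. The parameter
  \<open>q\<close> is the probability of surviving a cell.\<close>

definition killed_walk :: "real \<Rightarrow> int pmf \<Rightarrow> int list pmf" where
  "killed_walk q J = bind_pmf (geometric_pmf (1 - q)) (\<lambda>n. replicate_pmf (Suc n) J)"

lemma expectation_geometric_pmf:
  fixes f :: "nat \<Rightarrow> real"
  assumes q: "0 < q" "q < 1" and f: "\<And>n. \<bar>f n\<bar> \<le> C"
  shows "(\<integral>n. f n \<partial>geometric_pmf (1 - q)) = (1 - q) * f 0 + q * (\<integral>n. f (Suc n) \<partial>geometric_pmf (1 - q))"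
proof -
  have 1: "(\<lambda>n. pmf (geometric_pmf (1 - q)) n *\<^sub>R g n) sums (\<integral>n. g n \<partial>geometric_pmf (1 - q))"
    if "\<And>n. \<bar>g n\<bar> \<le> C" for g :: "nat \<Rightarrow> real"
    by (rule pmf_nat_expectation_sums[where C=C]) (use that in simp)
  have "(\<lambda>n. q ^ n * (1 - q) * f n) sums (\<integral>n. f n \<partial>geometric_pmf (1 - q))"
    using 1[of f] f q by (simp add: pmf_geometric)
  then have "(\<lambda>n. q ^ Suc n * (1 - q) * f (Suc n)) sums ((\<integral>n. f n \<partial>geometric_pmf (1 - q)) - (1 - q) * f 0)"
    by (subst sums_Suc_iff) simp
  moreover have "(\<lambda>n. q * (q ^ n * (1 - q) * f (Suc n))) sums (q * (\<integral>n. f (Suc n) \<partial>geometric_pmf (1 - q)))"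
    using 1[of "\<lambda>n. f (Suc n)"] f q by (intro sums_mult) (simp add: pmf_geometric)
  ultimately show ?thesis by (simp add: sums_iff mult.assoc)
qed

text \<open>The first step is drawn before the length. By memorylessness of the geometric law the
  walk then ends, leaving \<open>[x]\<close>, or continues as a fresh copy.\<close>

lemma expectation_killed_walk:
  fixes f :: "int list \<Rightarrow> real"
  assumes q: "0 < q" "q < 1" and f: "\<And>xs. \<bar>f xs\<bar> \<le> C"
  shows "(\<integral>xs. f xs \<partial>killed_walk q J) =
    (\<integral>x. q * (\<integral>xs. f (x # xs) \<partial>killed_walk q J) + (1 - q) * f [x] \<partial>J)"
proof -
  define G where "G = geometric_pmf (1 - q)"
  have "killed_walk q J = bind_pmf G (\<lambda>n. bind_pmf J (\<lambda>x. map_pmf (Cons x) (replicate_pmf n J)))"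
    by (simp add: killed_walk_def G_def map_pmf_def)
  also have "\<dots> = bind_pmf J (\<lambda>x. bind_pmf G (\<lambda>n. map_pmf (Cons x) (replicate_pmf n J)))"
    by (rule bind_commute_pmf)
  finally have *: "killed_walk q J = bind_pmf J (\<lambda>x. bind_pmf G (\<lambda>n. map_pmf (Cons x) (replicate_pmf n J)))" .
  have fx: "\<bar>f (x # xs)\<bar> \<le> C" for x xs by (rule f)
  have "(\<integral>xs. f xs \<partial>killed_walk q J) = (\<integral>x. (\<integral>n. (\<integral>xs. f (x # xs) \<partial>replicate_pmf n J) \<partial>G) \<partial>J)"
    by (simp only: * integral_bind_pmf_bounded[OF f] integral_map_pmf)
  also have "\<dots> = (\<integral>x. q * (\<integral>xs. f (x # xs) \<partial>killed_walk q J) + (1 - q) * f [x] \<partial>J)"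
  proof (rule Bochner_Integration.integral_cong[OF refl])
    fix x
    have "\<bar>\<integral>xs. f (x # xs) \<partial>replicate_pmf n J\<bar> \<le> C" for n
      by (rule abs_expectation_le) (rule f)
    from expectation_geometric_pmf[OF q this]
    have "(\<integral>n. (\<integral>xs. f (x # xs) \<partial>replicate_pmf n J) \<partial>G) = (1 - q) * (\<integral>xs. f (x # xs) \<partial>replicate_pmf 0 J)
      + q * (\<integral>n. (\<integral>xs. f (x # xs) \<partial>replicate_pmf (Suc n) J) \<partial>G)"
      unfolding G_def .
    also have "(\<integral>n. (\<integral>xs. f (x # xs) \<partial>replicate_pmf (Suc n) J) \<partial>G) = (\<integral>xs. f (x # xs) \<partial>killed_walk q J)"
      unfolding killed_walk_def G_def by (simp only: integral_bind_pmf_bounded[OF fx])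
    finally show "(\<integral>n. (\<integral>xs. f (x # xs) \<partial>replicate_pmf n J) \<partial>G)
       = q * (\<integral>xs. f (x # xs) \<partial>killed_walk q J) + (1 - q) * f [x]" by simp
  qed
  finally show ?thesis .
qed

text \<open>With \<open>z = exp (- \<alpha> / m)\<close> this is the discount up to the first
  maximiser, localised at level \<open>k\<close>: the joint law of level and time, transformed in
  time only.\<close>

definition max_weight :: "real \<Rightarrow> int \<Rightarrow> int list \<Rightarrow> real" where
  "max_weight z k xs = (if walk_max xs = k then z ^ walk_argmax xs else 0)"

definition min_weight :: "real \<Rightarrow> int \<Rightarrow> int list \<Rightarrow> real" where
  "min_weight z k xs = (if walk_min xs = k then z ^ walk_last_argmin xs else 0)"

lemma weight_bounds:
  assumes "0 \<le> z" "z \<le> 1"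
  shows "0 \<le> max_weight z k xs" "max_weight z k xs \<le> 1" "\<bar>max_weight z k xs\<bar> \<le> 1"
    "0 \<le> min_weight z k xs" "min_weight z k xs \<le> 1" "\<bar>min_weight z k xs\<bar> \<le> 1"
  using assms by (auto simp: max_weight_def min_weight_def power_le_one)

lemma walk_max_nonneg: "0 \<le> walk_max xs" and walk_min_nonpos: "walk_min xs \<le> 0"
  by (induction xs) auto

lemma max_weight_Cons: "0 < k \<Longrightarrow> max_weight z k (x # xs) = z * max_weight z (k - x) xs"
  by (auto simp: max_weight_def)

lemma min_weight_Cons: "k < 0 \<Longrightarrow> min_weight z k (x # xs) = z * min_weight z (k - x) xs"
  by (auto simp: min_weight_def)

text \<open>The extra term counts walks that stay strictly above 0 after their first step. Their
  last minimiser is index 0, so no factor \<open>z\<close> appears; this is the source term without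
  \<alpha>.\<close>

lemma min_weight_Cons_0:
  "min_weight z 0 (x # xs) = z * min_weight z (- x) xs + of_bool (0 < x + walk_min xs)"
  by (auto simp: min_weight_def)

lemma expectation_bounds_01:
  assumes "\<And>xs. 0 \<le> f xs" "\<And>xs. f xs \<le> (1::real)"
  shows "0 \<le> (\<integral>xs. f xs \<partial>measure_pmf p)" "(\<integral>xs. f xs \<partial>measure_pmf p) \<le> 1"
proof -
  show "0 \<le> (\<integral>xs. f xs \<partial>measure_pmf p)" by (rule Bochner_Integration.integral_nonneg) (use assms in auto)
  have "\<bar>f xs\<bar> \<le> 1" for xs using assms[of xs] by simp
  then show "(\<integral>xs. f xs \<partial>measure_pmf p) \<le> 1"
    using abs_expectation_le[of f 1 p] by (simp add: abs_le_iff)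
qed


text \<open>Unfolds the first step and applies the generator limit. The empty-cell contribution is
  left in the expression, to be merged with the full expectation by \<open>limit_aux\<close> into
  the total rate.\<close>

lemma killed_walk_limit:
  fixes W :: "nat \<Rightarrow> int list \<Rightarrow> real"
  assumes p: "p > 0" and c: "c > 0"
    and W: "\<And>m xs. 0 \<le> W m xs" "\<And>m xs. W m xs \<le> 1"
    and lim: "\<And>i. (\<lambda>m. exp (- p / real m) * (\<integral>xs. W m ((1 - int i) # xs) \<partial>killed_walk (exp (- p / real m)) (skip_free_pmf (c / real m) b))
        + (1 - exp (- p / real m)) * W m [1 - int i]) \<longlonglongrightarrow> g i"
  shows "(\<lambda>m. real m * ((\<integral>xs. W m xs \<partial>killed_walk (exp (- p / real m)) (skip_free_pmf (c / real m) b))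
     - exp (- c / real m) * (exp (- p / real m) * (\<integral>xs. W m (0 # xs) \<partial>killed_walk (exp (- p / real m)) (skip_free_pmf (c / real m) b))
        + (1 - exp (- p / real m)) * W m [0]))) \<longlonglongrightarrow> c * (\<integral>i. g i \<partial>b)"
proof -
  define q where "q m = exp (- p / real m)" for m
  define K where "K m = killed_walk (q m) (skip_free_pmf (c / real m) b)" for m
  define f where "f m x = q m * (\<integral>xs. W m (x # xs) \<partial>K m) + (1 - q m) * W m [x]" for m and x :: int
  have q: "0 \<le> q m" "q m \<le> 1" for m using p by (auto simp: q_def)
  have f: "\<bar>f m x\<bar> \<le> 1" for m x
  proof -
    have E: "0 \<le> (\<integral>xs. W m (x # xs) \<partial>K m)" "(\<integral>xs. W m (x # xs) \<partial>K m) \<le> 1"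
      by (rule expectation_bounds_01; rule W)+
    have "f m x \<le> q m * 1 + (1 - q m) * 1"
      unfolding f_def by (intro add_mono mult_left_mono E W) (use q in auto)
    moreover have "0 \<le> f m x"
      unfolding f_def by (intro add_nonneg_nonneg mult_nonneg_nonneg E W) (use q in auto)
    ultimately show ?thesis by simp
  qed
  have "(\<lambda>m. real m * ((\<integral>k. f m k \<partial>skip_free_pmf (c / real m) b) - exp (- c / real m) * f m 0))
           \<longlonglongrightarrow> c * (\<integral>i. g i \<partial>b)"
    by (rule skip_free_limit[OF c f]) (use lim in \<open>simp add: f_def q_def K_def\<close>)
  moreover have "eventually (\<lambda>m. real m * ((\<integral>k. f m k \<partial>skip_free_pmf (c / real m) b) - exp (- c / real m) * f m 0)
     = real m * ((\<integral>xs. W m xs \<partial>K m) - exp (- c / real m) * f m 0)) sequentially"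
    using eventually_gt_at_top[of "0::nat"]
  proof eventually_elim
    case (elim m)
    have "(\<integral>xs. W m xs \<partial>K m) = (\<integral>k. f m k \<partial>skip_free_pmf (c / real m) b)"
      unfolding K_def f_def by (rule expectation_killed_walk[where C=1]) (use p elim W in \<open>auto simp: q_def\<close>)
    then show ?case by simp
  qed
  ultimately have "(\<lambda>m. real m * ((\<integral>xs. W m xs \<partial>K m) - exp (- c / real m) * f m 0)) \<longlonglongrightarrow> c * (\<integral>i. g i \<partial>b)"
    by (rule Lim_transform_eventually)
  then show ?thesis by (simp only: f_def q_def K_def)
qed

section \<open>The recursions in the limit of a vanishing mesh\<close>

context
  fixes p \<alpha> c :: real and b :: "nat pmf"
  assumes p: "p > 0" and \<alpha>: "\<alpha> \<ge> 0" and c: "c > 0"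
begin

private definition "kw m = killed_walk (exp (- p / real m)) (skip_free_pmf (c / real m) b)"

private lemma z: "0 \<le> exp (- \<alpha> / real m)" "exp (- \<alpha> / real m) \<le> 1"
  using \<alpha> by auto

text \<open>Surviving, discounting and not jumping over one cell multiply to a single exponential,
  whose defect from 1 is about \<open>(p + \<alpha> + c) / m\<close>.\<close>

private lemma limit_aux:
  assumes "a \<longlonglongrightarrow> l"
  shows "(\<lambda>m. real m * (a m - exp (- c / real m) * (exp (- p / real m) * (exp (- \<alpha> / real m) * a m))))
      \<longlonglongrightarrow> (p + \<alpha> + c) * l"
proof -
  have "(\<lambda>m. real m * (1 - exp (- (p + \<alpha> + c) / real m))) \<longlonglongrightarrow> p + \<alpha> + c"
    by real_asymp
  from tendsto_mult[OF this assms] show ?thesis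
    by (rule Lim_transform_eventually)
       (auto intro!: always_eventually simp: algebra_simps diff_divide_distrib add_divide_distrib simp flip: exp_add)
qed

text \<open>Away from level 0 a first step merely shifts the level and costs one factor
  \<open>z\<close>, for maxima and minima alike. The condition \<open>k \<noteq> 0\<close> makes the
  weight of the stopped walk \<open>[0]\<close> vanish; at level 0 it would contribute the constant
  \<open>p\<close>.\<close>

lemma weight_recursion_limit:
  fixes W :: "real \<Rightarrow> int \<Rightarrow> int list \<Rightarrow> real"
  assumes bounds: "\<And>m xs. 0 \<le> W (exp (- \<alpha> / real m)) k xs" "\<And>m xs. W (exp (- \<alpha> / real m)) k xs \<le> 1"
    and Cons: "\<And>z x xs. W z k (x # xs) = z * W z (k - x) xs"
    and single: "\<And>z x. W z k [x] = z * of_bool (x = k)"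
    and k: "k \<noteq> 0"
    and lim: "\<And>j. (\<lambda>m. \<integral>xs. W (exp (- \<alpha> / real m)) j xs
      \<partial>killed_walk (exp (- p / real m)) (skip_free_pmf (c / real m) b)) \<longlonglongrightarrow> \<pi> j"
  shows "(p + \<alpha> + c) * \<pi> k = c * (\<integral>i. \<pi> (k - 1 + int i) \<partial>b)"
proof -
  have lim': "(\<lambda>m. \<integral>xs. W (exp (- \<alpha> / real m)) j xs \<partial>kw m) \<longlonglongrightarrow> \<pi> j" for j
    using lim[of j] by (simp add: kw_def)
  have W: "(\<integral>xs. W (exp (- \<alpha> / real m)) k ((1 - int i) # xs) \<partial>kw m)
      = exp (- \<alpha> / real m) * (\<integral>xs. W (exp (- \<alpha> / real m)) (k - 1 + int i) xs \<partial>kw m)" for m i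
    by (simp add: Cons algebra_simps)
  have W0: "(\<integral>xs. W (exp (- \<alpha> / real m)) k (0 # xs) \<partial>kw m)
      = exp (- \<alpha> / real m) * (\<integral>xs. W (exp (- \<alpha> / real m)) k xs \<partial>kw m)" for m
    by (simp add: Cons)
  have "(\<lambda>m. real m * ((\<integral>xs. W (exp (- \<alpha> / real m)) k xs \<partial>kw m)
      - exp (- c / real m) * (exp (- p / real m) * (\<integral>xs. W (exp (- \<alpha> / real m)) k (0 # xs) \<partial>kw m)
        + (1 - exp (- p / real m)) * W (exp (- \<alpha> / real m)) k [0]))) \<longlonglongrightarrow> c * (\<integral>i. \<pi> (k - 1 + int i) \<partial>b)"
    unfolding kw_def
  proof (rule killed_walk_limit[OF p c bounds])
    fix i
    have "(\<lambda>m. exp (- p / real m) * (exp (- \<alpha> / real m) * (\<integral>xs. W (exp (- \<alpha> / real m)) (k - 1 + int i) xs \<partial>kw m))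
         + (1 - exp (- p / real m)) * (exp (- \<alpha> / real m) * of_bool (1 - int i = k))) \<longlonglongrightarrow>
        1 * (1 * \<pi> (k - 1 + int i)) + (1 - 1) * (1 * of_bool (1 - int i = k))"
      by (intro tendsto_intros lim'; real_asymp)
    then show "(\<lambda>m. exp (- p / real m) * (\<integral>xs. W (exp (- \<alpha> / real m)) k ((1 - int i) # xs) \<partial>killed_walk (exp (- p / real m)) (skip_free_pmf (c / real m) b))
        + (1 - exp (- p / real m)) * W (exp (- \<alpha> / real m)) k [1 - int i]) \<longlonglongrightarrow> \<pi> (k - 1 + int i)"
      by (simp only: single W flip: kw_def) simp
  qed
  moreover have "(\<lambda>m. real m * ((\<integral>xs. W (exp (- \<alpha> / real m)) k xs \<partial>kw m)
      - exp (- c / real m) * (exp (- p / real m) * (\<integral>xs. W (exp (- \<alpha> / real m)) k (0 # xs) \<partial>kw m)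
        + (1 - exp (- p / real m)) * W (exp (- \<alpha> / real m)) k [0]))) \<longlonglongrightarrow> (p + \<alpha> + c) * \<pi> k"
    using limit_aux[OF lim'[of k]] k by (simp only: W0 single) simp
  ultimately show ?thesis by (rule LIMSEQ_unique[symmetric])
qed

lemma max_recursion_limit:
  assumes lim: "\<And>j. (\<lambda>m. \<integral>xs. max_weight (exp (- \<alpha> / real m)) j xs
      \<partial>killed_walk (exp (- p / real m)) (skip_free_pmf (c / real m) b)) \<longlonglongrightarrow> \<pi> j"
    and k: "k > 0"
  shows "(p + \<alpha> + c) * \<pi> k = c * (\<integral>i. \<pi> (k - 1 + int i) \<partial>b)"
proof (rule weight_recursion_limit[OF _ _ max_weight_Cons[OF k] _ _ lim])
  show "max_weight z k [x] = z * of_bool (x = k)" for z x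
    using k by (auto simp: max_weight_def)
qed (use k weight_bounds[OF z] in auto)

lemma min_recursion_limit:
  assumes lim: "\<And>j. (\<lambda>m. \<integral>xs. min_weight (exp (- \<alpha> / real m)) j xs
      \<partial>killed_walk (exp (- p / real m)) (skip_free_pmf (c / real m) b)) \<longlonglongrightarrow> \<pi> j"
    and k: "k < 0"
  shows "(p + \<alpha> + c) * \<pi> k = c * (\<integral>i. \<pi> (k - 1 + int i) \<partial>b)"
proof (rule weight_recursion_limit[OF _ _ min_weight_Cons[OF k] _ _ lim])
  show "min_weight z k [x] = z * of_bool (x = k)" for z x
    using k by (auto simp: min_weight_def)
qed (use k weight_bounds[OF z] in auto)

text \<open>Two boundary contributions appear: \<open>p\<close> from walks stopped in a first cell
  without jump, and \<open>\<rho>\<close> from a first jump upwards (\<open>i = 0\<close>) followed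
  by a walk that never goes below its new start.\<close>

lemma min_recursion_limit_0:
  assumes lim: "\<And>k. (\<lambda>m. \<integral>xs. min_weight (exp (- \<alpha> / real m)) k xs
      \<partial>killed_walk (exp (- p / real m)) (skip_free_pmf (c / real m) b)) \<longlonglongrightarrow> \<pi> k"
    and lim0: "(\<lambda>m. \<integral>xs. min_weight 1 0 xs
      \<partial>killed_walk (exp (- p / real m)) (skip_free_pmf (c / real m) b)) \<longlonglongrightarrow> \<rho>"
  shows "(p + \<alpha> + c) * \<pi> 0 - p = c * (\<integral>i. \<pi> (int i - 1) + (if i = 0 then \<rho> else 0) \<partial>b)"
proof -
  have lim': "(\<lambda>m. \<integral>xs. min_weight (exp (- \<alpha> / real m)) j xs \<partial>kw m) \<longlonglongrightarrow> \<pi> j" for j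
    using lim[of j] by (simp add: kw_def)
  have int: "integrable (measure_pmf P) (\<lambda>xs. min_weight (exp (- \<alpha> / real m)) j xs)" for P j m
    by (rule measure_pmf.integrable_const_bound[where B=1]) (use weight_bounds[OF z] in auto)
  have single: "min_weight w 0 [x] = w * of_bool (x = 0) + of_bool (0 < x)" for w x
    by (auto simp: min_weight_def)
  \<comment> \<open>As \<open>walk_min\<close> is a nonpositive integer, the condition says that it
    is 0; the weight with \<open>z = 1\<close> records this event without a discount.\<close>
  have R1: "of_bool (0 < 1 + walk_min xs) = min_weight 1 0 xs" for xs
    using walk_min_nonpos[of xs] by (auto simp: min_weight_def)
  have R2: "of_bool (0 < x + walk_min xs) = (0::real)" if "x \<le> 0" for x xs
    using walk_min_nonpos[of xs] that by auto
  have int1: "integrable (measure_pmf P) (\<lambda>xs. min_weight 1 0 xs)" for P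
    by (rule measure_pmf.integrable_const_bound[where B=1]) (use weight_bounds[of 1] in auto)
  have "(\<lambda>m. real m * ((\<integral>xs. min_weight (exp (- \<alpha> / real m)) 0 xs \<partial>kw m)
      - exp (- c / real m) * (exp (- p / real m) * (\<integral>xs. min_weight (exp (- \<alpha> / real m)) 0 (0 # xs) \<partial>kw m)
        + (1 - exp (- p / real m)) * min_weight (exp (- \<alpha> / real m)) 0 [0]))) \<longlonglongrightarrow>
      c * (\<integral>i. \<pi> (int i - 1) + (if i = 0 then \<rho> else 0) \<partial>b)"
    unfolding kw_def
  proof (rule killed_walk_limit[OF p c])
    fix i
    have "(\<lambda>m. exp (- p / real m) * (exp (- \<alpha> / real m) * (\<integral>xs. min_weight (exp (- \<alpha> / real m)) (int i - 1) xs \<partial>kw m)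
            + (if i = 0 then (\<integral>xs. min_weight 1 0 xs \<partial>kw m) else 0))
         + (1 - exp (- p / real m)) * (exp (- \<alpha> / real m) * of_bool (1 - int i = 0) + of_bool (0 < 1 - int i))) \<longlonglongrightarrow>
        1 * (1 * \<pi> (int i - 1) + (if i = 0 then \<rho> else 0)) + (1 - 1) * (1 * of_bool (1 - int i = 0) + of_bool (0 < 1 - int i))"
    proof (intro tendsto_intros lim')
      show "(\<lambda>m. if i = 0 then (\<integral>xs. min_weight 1 0 xs \<partial>kw m) else 0) \<longlonglongrightarrow> (if i = 0 then \<rho> else 0)"
        using lim0 by (auto simp: kw_def)
    qed real_asymp+
    moreover have "(\<integral>xs. min_weight (exp (- \<alpha> / real m)) 0 ((1 - int i) # xs) \<partial>kw m)
       = exp (- \<alpha> / real m) * (\<integral>xs. min_weight (exp (- \<alpha> / real m)) (int i - 1) xs \<partial>kw m)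
            + (if i = 0 then (\<integral>xs. min_weight 1 0 xs \<partial>kw m) else 0)" for m
    proof (cases "i = 0")
      case True
      have "(\<integral>xs. min_weight (exp (- \<alpha> / real m)) 0 ((1 - int i) # xs) \<partial>kw m)
         = (\<integral>xs. exp (- \<alpha> / real m) * min_weight (exp (- \<alpha> / real m)) (int i - 1) xs + min_weight 1 0 xs \<partial>kw m)"
        by (simp only: min_weight_Cons_0) (simp add: R1 True)
      also have "\<dots> = exp (- \<alpha> / real m) * (\<integral>xs. min_weight (exp (- \<alpha> / real m)) (int i - 1) xs \<partial>kw m)
         + (\<integral>xs. min_weight 1 0 xs \<partial>kw m)"
        by (subst Bochner_Integration.integral_add[OF integrable_mult_right[OF int] int1]) simp
      finally show ?thesis using True by simp
    next
      case False
      then show ?thesis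
        by (simp only: min_weight_Cons_0) (simp add: R2 walk_min_nonpos not_less)
    qed
    ultimately show "(\<lambda>m. exp (- p / real m) * (\<integral>xs. min_weight (exp (- \<alpha> / real m)) 0 ((1 - int i) # xs) \<partial>killed_walk (exp (- p / real m)) (skip_free_pmf (c / real m) b))
        + (1 - exp (- p / real m)) * min_weight (exp (- \<alpha> / real m)) 0 [1 - int i]) \<longlonglongrightarrow>
         \<pi> (int i - 1) + (if i = 0 then \<rho> else 0)"
      by (simp only: single flip: kw_def) simp
  qed (use weight_bounds[OF z] in auto)
  moreover have "(\<lambda>m. real m * ((\<integral>xs. min_weight (exp (- \<alpha> / real m)) 0 xs \<partial>kw m)
      - exp (- c / real m) * (exp (- p / real m) * (\<integral>xs. min_weight (exp (- \<alpha> / real m)) 0 (0 # xs) \<partial>kw m)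
        + (1 - exp (- p / real m)) * min_weight (exp (- \<alpha> / real m)) 0 [0]))) \<longlonglongrightarrow> (p + \<alpha> + c) * \<pi> 0 - p"
  proof -
    have e: "min_weight w 0 (0 # xs) = w * min_weight w 0 xs" for w xs
      by (simp only: min_weight_Cons_0) (simp add: R2 walk_min_nonpos not_less)
    \<comment> \<open>Stopping within the first cell has probability about \<open>p / m\<close>; the
      other factors tend to 1.\<close>
    have "(\<lambda>m. real m * (exp (- c / real m) * ((1 - exp (- p / real m)) * exp (- \<alpha> / real m)))) \<longlonglongrightarrow> p"
      by real_asymp
    from tendsto_diff[OF limit_aux[OF lim'[of 0]] this] show ?thesis
      by (simp add: e single algebra_simps)
  qed
  ultimately show ?thesis by (rule LIMSEQ_unique[symmetric])
qed

end

text \<open>The contraction argument used for \<open>first_hit_sums\<close>: the difference to the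
  geometric solution vanishes at level 0, is at most 2, and loses a factor \<open>\<rho>\<close>
  with each use of the recursion.\<close>

lemma max_recursion_solution:
  fixes \<pi> :: "int \<Rightarrow> real"
  assumes \<rho>: "0 \<le> \<rho>" "\<rho> < 1" and w: "0 \<le> w" "w \<le> 1" "w = \<rho> * pgf b w"
    and rec: "\<And>k. k > 0 \<Longrightarrow> \<pi> k = \<rho> * (\<integral>i. \<pi> (k - 1 + int i) \<partial>b)"
    and bound: "\<And>k. \<bar>\<pi> k\<bar> \<le> 1"
  shows "\<pi> (int k) = \<pi> 0 * w ^ k"
proof -
  have int1: "integrable (measure_pmf b) (\<lambda>i. \<pi> (k + int i))" for k
    by (rule measure_pmf.integrable_const_bound[where B=1]) (use bound in auto)
  have int2: "integrable (measure_pmf b) (\<lambda>i. w ^ (k + i))" for k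
    by (rule measure_pmf.integrable_const_bound[where B=1]) (use w in \<open>auto intro: power_le_one\<close>)
  have *: "\<bar>\<pi> (int k) - \<pi> 0 * w ^ k\<bar> \<le> 2 * \<rho> ^ N" for N k
  proof (induction N arbitrary: k)
    case 0
    have "\<bar>\<pi> 0 * w ^ k\<bar> \<le> 1" using bound[of 0] w by (auto simp: abs_mult power_le_one intro!: mult_le_one)
    then show ?case using bound[of "int k"] by simp
  next
    case (Suc N)
    show ?case
    proof (cases k)
      case 0
      then show ?thesis using \<rho> by simp
    next
      case (Suc j)
      have "\<pi> 0 * w ^ k = \<pi> 0 * (w ^ j * (\<rho> * pgf b w))" using Suc w(3) by simp
      also have "\<dots> = \<rho> * (\<integral>i. \<pi> 0 * w ^ (j + i) \<partial>b)"
        using w by (subst pgf_eq_expectation) (auto simp: power_add)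
      finally have "\<pi> (int k) - \<pi> 0 * w ^ k = \<rho> * (\<integral>i. \<pi> (int j + int i) \<partial>b) - \<rho> * (\<integral>i. \<pi> 0 * w ^ (j + i) \<partial>b)"
        using rec[of "int k"] Suc by (simp add: add.commute)
      also have "\<dots> = \<rho> * (\<integral>i. \<pi> (int (j + i)) - \<pi> 0 * w ^ (j + i) \<partial>b)"
        by (subst Bochner_Integration.integral_diff) (auto simp: int1 int2 right_diff_distrib)
      finally have eq: "\<pi> (int k) - \<pi> 0 * w ^ k = \<rho> * (\<integral>i. \<pi> (int (j + i)) - \<pi> 0 * w ^ (j + i) \<partial>b)" .
      have "\<bar>\<integral>i. \<pi> (int (j + i)) - \<pi> 0 * w ^ (j + i) \<partial>b\<bar> \<le> 2 * \<rho> ^ N"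
        by (rule abs_expectation_le) (rule Suc.IH)
      then have "\<rho> * \<bar>\<integral>i. \<pi> (int (j + i)) - \<pi> 0 * w ^ (j + i) \<partial>b\<bar> \<le> \<rho> * (2 * \<rho> ^ N)"
        using \<rho> by (intro mult_left_mono) auto
      then show ?thesis unfolding eq using \<rho> by (simp add: abs_mult algebra_simps)
    qed
  qed
  have "(\<lambda>N. 2 * \<rho> ^ N) \<longlonglongrightarrow> 2 * 0"
    using \<rho> by (intro tendsto_intros LIMSEQ_realpow_zero) auto
  then have "\<bar>\<pi> (int k) - \<pi> 0 * w ^ k\<bar> \<le> 0"
    using * by (intro tendsto_lowerbound[of "\<lambda>N. 2 * \<rho> ^ N" 0 sequentially]) auto
  then show ?thesis by simp
qed

section \<open>The Wiener--Hopf factors\<close>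

lemma map_upt_eq_iff: "map f [0..<length xs] = xs \<longleftrightarrow> (\<forall>i\<in>{..<length xs}. f i = xs ! i)"
proof
  assume eq: "map f [0..<length xs] = xs"
  show "\<forall>i\<in>{..<length xs}. f i = xs ! i"
  proof
    fix i assume "i \<in> {..<length xs}"
    then have "f i = map f [0..<length xs] ! i" by simp
    then show "f i = xs ! i" by (simp only: eq)
  qed
qed (auto intro: nth_equalityI)

context upwards_skip_free_levy_chain
begin

lemma space_F: "0 \<le> t \<Longrightarrow> space (F t) = space M"
  using filtration.space_F[OF filtration, of t] by simp

lemma sets_F_mono: "0 \<le> s \<Longrightarrow> s \<le> t \<Longrightarrow> sets (F s) \<subseteq> sets (F t)"
  using filtration.sets_F_mono[OF filtration, of s t] by simp

lemma X_measurable_F: "0 \<le> s \<Longrightarrow> s \<le> t \<Longrightarrow> X s \<in> borel_measurable (F t)"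
  using adapted[of s] sets_F_mono[of s t] space_F[of s] space_F[of t] by (auto simp: measurable_def)

lemma AE_X_lattice:
  assumes t: "t > 0"
  shows "AE \<omega> in M. \<exists>k::int. X t \<omega> = h * of_int k"
proof -
  have "{x. \<exists>k::int. x = h * of_int k} = range (\<lambda>k::int. h * of_int k)" by auto
  also have "\<dots> \<in> sets borel" by (rule sets.countable) auto
  finally have [measurable]: "{x. \<exists>k::int. x = h * of_int k} \<in> sets borel" .
  have "AE x in distr M borel (X t). \<exists>k::int. x = h * of_int k"
    unfolding distr_X[OF t] by (subst AE_distr_iff) auto
  then show ?thesis
    using random_variable_X[of t] t by (subst (asm) AE_distr_iff) auto
qed

text \<open>The law at fixed positive times gives lattice values at all positive rationals
  simultaneously; right-continuity and closedness of the integers carry this to every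
  \<open>t \<ge> 0\<close>, approached from the right.\<close>

lemma AE_lattice_path: "AE \<omega> in M. lattice_path h (\<lambda>t. X t \<omega>) \<and> X 0 \<omega> = 0"
proof -
  have "AE \<omega> in M. \<forall>q\<in>\<rat> \<inter> {0<..}. \<exists>k::int. X q \<omega> = h * of_int k"
    by (subst AE_ball_countable) (auto intro: AE_X_lattice countable_subset[OF _ countable_rat])
  with start AE_space show ?thesis
  proof eventually_elim
    case (elim \<omega>)
    have cad: "cadlag (\<lambda>t. X t \<omega>)" using cadlag_paths elim by blast
    have "\<exists>k::int. X t \<omega> = h * of_int k" if t: "0 \<le> t" for t
    proof -
      have "\<exists>q\<in>\<rat>. t < q \<and> q < t + 1 / real (Suc n)" for n
        using Rats_dense_in_real[of t "t + 1 / real (Suc n)"] by auto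
      then obtain q where q: "\<And>n. q n \<in> \<rat>" "\<And>n. t < q n" "\<And>n. q n < t + 1 / real (Suc n)" by metis
      have "q \<longlonglongrightarrow> t"
      proof (rule real_tendsto_sandwich[of "\<lambda>_. t" q sequentially "\<lambda>n. t + 1 / real (Suc n)"])
        show "(\<lambda>n. t + 1 / real (Suc n)) \<longlonglongrightarrow> t" by real_asymp
      qed (use q in \<open>auto intro!: always_eventually less_imp_le\<close>)
      then have "filterlim q (at_right t) sequentially"
        unfolding filterlim_at using q by (auto intro!: always_eventually simp: less_imp_neq[THEN not_sym])
      moreover have "((\<lambda>s. X s \<omega>) \<longlongrightarrow> X t \<omega>) (at_right t)"
        using cad t by (auto simp: cadlag_def continuous_within)
      ultimately have "(\<lambda>n. X (q n) \<omega>) \<longlonglongrightarrow> X t \<omega>" by (rule filterlim_compose[rotated])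
      then have "(\<lambda>n. X (q n) \<omega> / h) \<longlonglongrightarrow> X t \<omega> / h"
        by (intro tendsto_divide tendsto_const) (use h_pos in auto)
      moreover have "X (q n) \<omega> / h \<in> \<int>" for n
      proof -
        have "0 < q n" using q(2)[of n] t by simp
        then obtain k :: int where "X (q n) \<omega> = h * of_int k" using elim(3) q(1)[of n] by auto
        then show ?thesis using h_pos by simp
      qed
      ultimately have "X t \<omega> / h \<in> \<int>"
        using closed_sequentially[OF closed_Ints, of "\<lambda>n. X (q n) \<omega> / h"] by blast
      then obtain k :: int where "X t \<omega> / h = of_int k" by (auto elim: Ints_cases)
      then have "X t \<omega> = h * of_int k" using h_pos by (simp add: field_simps)
      then show ?thesis ..
    qed
    with cad elim show ?case by (simp add: lattice_path_def)
  qed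
qed

section \<open>The law of the walk sampled up to an independent exponential time\<close>

definition increment :: "nat \<Rightarrow> nat \<Rightarrow> 'a \<Rightarrow> int" where
  "increment m i \<omega> = \<lfloor>(X (real (Suc i) / real m) \<omega> - X (real i / real m) \<omega>) / h\<rfloor>"

lemma grid_increments_eq: "grid_increments h (\<lambda>t. X t \<omega>) m n = map (\<lambda>i. increment m i \<omega>) [0..<n]"
  by (simp add: grid_increments_def increment_def)

abbreviation grid_pmf :: "nat \<Rightarrow> int pmf" where
  "grid_pmf m \<equiv> skip_free_pmf (lam / real m) step_pmf"

lemma increment_measurable_F:
  "i < n \<Longrightarrow> increment m i \<in> measurable (F (real n / real m)) (count_space UNIV)"
  unfolding increment_def[abs_def]
  by (intro measurable_compose[OF _ measurable_real_floor] borel_measurable_divide borel_measurable_diff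
        X_measurable_F measurable_const) (auto intro!: divide_right_mono)

lemma prob_increment:
  assumes m: "m > 0"
  shows "prob {\<omega> \<in> space M. increment m i \<omega> = x} = pmf (grid_pmf m) x"
proof -
  let ?s = "real i / real m" and ?t = "real (Suc i) / real m"
  have st: "0 \<le> ?s" "?s \<le> ?t" "?t - ?s = 1 / real m" using m by (auto simp: field_simps)
  have [measurable]: "X ?s \<in> borel_measurable M" "X ?t \<in> borel_measurable M"
    using st m by (intro random_variable_X; simp)+
  have B: "{y. \<lfloor>y / h\<rfloor> = x} \<in> sets borel" by measurable
  have D: "(\<lambda>\<omega>. X ?t \<omega> - X ?s \<omega>) \<in> borel_measurable M" by measurable
  have "prob {\<omega> \<in> space M. increment m i \<omega> = x}
      = measure (distr M borel (\<lambda>\<omega>. X ?t \<omega> - X ?s \<omega>)) {y. \<lfloor>y / h\<rfloor> = x}"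
    using B by (subst measure_distr[OF D]) (auto simp: increment_def simp del: of_nat_Suc intro!: arg_cong[where f=prob])
  also have "distr M borel (\<lambda>\<omega>. X ?t \<omega> - X ?s \<omega>) = distr M borel (X (1 / real m))"
    using stationary_increments[OF st(1,2)] st(3) by simp
  also have "\<dots> = distr (grid_pmf m) borel (\<lambda>k. h * of_int k)"
    using distr_X[of "1 / real m"] m by simp
  also have "measure (distr (grid_pmf m) borel (\<lambda>k. h * of_int k)) {y. \<lfloor>y / h\<rfloor> = x} = pmf (grid_pmf m) x"
    using B h_pos by (subst measure_distr) (auto simp: vimage_def pmf.rep_eq)
  finally show ?thesis .
qed

text \<open>The event must belong to the history at time \<open>n / m\<close>, since the next
  increment is independent of that sigma-algebra.\<close>

lemma grid_event_F:
  "{\<omega> \<in> space M. map (\<lambda>i. increment m i \<omega>) [0..<n] = xs} \<in> sets (F (real n / real m))"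
proof (cases "length xs = n")
  case True
  have "{\<omega> \<in> space (F (real n / real m)). \<forall>i\<in>{..<n}. increment m i \<omega> = xs ! i} \<in> sets (F (real n / real m))"
    by (intro sets.sets_Collect_finite_All)
       (auto intro!: measurable_sets_Collect[OF increment_measurable_F])
  also have "{\<omega> \<in> space (F (real n / real m)). \<forall>i\<in>{..<n}. increment m i \<omega> = xs ! i}
     = {\<omega> \<in> space M. map (\<lambda>i. increment m i \<omega>) [0..<n] = xs}"
    using True by (auto simp: space_F list_eq_iff_nth_eq)
  finally show ?thesis .
next
  case False
  then have eq: "{\<omega> \<in> space M. map (\<lambda>i. increment m i \<omega>) [0..<n] = xs} = {}" by auto
  show ?thesis unfolding eq by (rule sets.empty_sets)
qed

text \<open>The induction appends the latest increment, because independence is stated between the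
  past and what follows it; lists are therefore split at their end.\<close>

lemma prob_grid:
  assumes m: "m > 0"
  shows "prob {\<omega> \<in> space M. map (\<lambda>i. increment m i \<omega>) [0..<n] = xs} = pmf (replicate_pmf n (grid_pmf m)) xs"
proof (induction n arbitrary: xs)
  case 0
  show ?case by (cases xs) (auto simp: prob_space)
next
  case (Suc n)
  show ?case
  proof (cases xs rule: rev_cases)
    case Nil
    then show ?thesis by (simp add: pmf_replicate_pmf del: replicate_pmf.simps)
  next
    case (snoc ys y)
    let ?s = "real n / real m" and ?t = "real (Suc n) / real m"
    let ?D = "\<lambda>\<omega>. X ?t \<omega> - X ?s \<omega>"
    let ?A = "{\<omega> \<in> space M. map (\<lambda>i. increment m i \<omega>) [0..<n] = ys}"
    let ?B = "{\<omega> \<in> space M. increment m n \<omega> = y}"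
    have "{x. \<lfloor>x / h\<rfloor> = y} \<in> sets borel" by measurable
    then have "?D -` {x. \<lfloor>x / h\<rfloor> = y} \<inter> space M \<in> sets (vimage_algebra (space M) ?D borel)"
      by (rule in_vimage_algebra)
    also have "?D -` {x. \<lfloor>x / h\<rfloor> = y} \<inter> space M = ?B" by (auto simp: increment_def)
    finally have B: "?B \<in> sets (vimage_algebra (space M) ?D borel)" .
    have "indep_set (sets (F ?s)) (sets (vimage_algebra (space M) ?D borel))"
      by (rule indep_increments) (auto intro!: divide_right_mono)
    from indep_setD[OF this grid_event_F B] have "prob (?A \<inter> ?B) = prob ?A * prob ?B" .
    also have "?A \<inter> ?B = {\<omega> \<in> space M. map (\<lambda>i. increment m i \<omega>) [0..<Suc n] = xs}"
      unfolding snoc by auto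
    also have "prob ?A * prob ?B = pmf (replicate_pmf (Suc n) (grid_pmf m)) xs"
      unfolding Suc prob_increment[OF m] snoc by (simp add: pmf_replicate_pmf del: replicate_pmf.simps)
    finally show ?thesis .
  qed
qed

definition killed_grid :: "('a \<Rightarrow> real) \<Rightarrow> nat \<Rightarrow> 'a \<Rightarrow> int list" where
  "killed_grid e m \<omega> = grid_increments h (\<lambda>t. X t \<omega>) m (nat \<lceil>real m * e \<omega>\<rceil>)"

text \<open>The walk equals \<open>xs\<close> exactly when the number of cells is
  \<open>length xs\<close>, an event of \<open>e\<close>, and the first increments are
  \<open>xs\<close>, an event of the path. Independence factorises the probability into the
  geometric and the product weight.\<close>

lemma killed_grid:
  assumes p: "p > 0" and e: "independent_exponential M X p e" and m: "m > 0"
  shows killed_grid_measurable: "killed_grid e m \<in> measurable M (count_space UNIV)"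
    and distr_killed_grid: "distr M (count_space UNIV) (killed_grid e m)
          = killed_walk (exp (- p / real m)) (grid_pmf m)"
proof -
  have dist: "distributed M lborel e (exponential_density p)"
    and indep: "indep_set (sets (vimage_algebra (space M) e borel))
         (sets (vimage_algebra (space M) (\<lambda>\<omega>. \<lambda>t\<in>{0..}. X t \<omega>) (\<Pi>\<^sub>M t\<in>{0..}. borel)))"
    using e by (auto simp: independent_exponential_def)
  have [measurable]: "e \<in> borel_measurable M"
    using dist by (auto simp: distributed_def)
  let ?V = "vimage_algebra (space M) (\<lambda>\<omega>. \<lambda>t\<in>{0..}. X t \<omega>) (\<Pi>\<^sub>M t\<in>{0..}. borel)"
  have XV: "X t \<in> borel_measurable ?V" if "0 \<le> t" for t
  proof -
    have "(\<lambda>\<omega>. (\<lambda>t\<in>{0..}. X t \<omega>) t) \<in> borel_measurable ?V"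
      by (rule measurable_compose[OF measurable_vimage_algebra1 measurable_component_singleton])
         (use that in \<open>auto simp: space_PiM split: if_splits\<close>)
    then show ?thesis using that by simp
  qed
  have inc: "increment m i \<in> measurable ?V (count_space UNIV)" for i
    unfolding increment_def[abs_def]
    by (intro measurable_compose[OF _ measurable_real_floor] borel_measurable_divide borel_measurable_diff
          XV measurable_const) auto
  define N where "N \<omega> = nat \<lceil>real m * e \<omega>\<rceil>" for \<omega>
  let ?L = "killed_grid e m"
  have L: "?L \<omega> = map (\<lambda>i. increment m i \<omega>) [0..<N \<omega>]" for \<omega>
    by (simp add: killed_grid_def N_def grid_increments_eq)
  let ?A = "\<lambda>xs. {\<omega> \<in> space M. map (\<lambda>i. increment m i \<omega>) [0..<length xs] = xs}"
  let ?B = "\<lambda>n. {\<omega> \<in> space M. N \<omega> = n}"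
  have A: "?A xs \<in> sets ?V" for xs
  proof -
    have "{\<omega> \<in> space ?V. \<forall>i\<in>{..<length xs}. increment m i \<omega> = xs ! i} \<in> sets ?V"
    proof (intro sets.sets_Collect_finite_All)
      show "{\<omega> \<in> space ?V. increment m i \<omega> = xs ! i} \<in> sets ?V" for i
        by (rule measurable_sets_Collect[OF inc]) auto
    qed simp
    also have "{\<omega> \<in> space ?V. \<forall>i\<in>{..<length xs}. increment m i \<omega> = xs ! i} = ?A xs"
      by (simp only: map_upt_eq_iff space_vimage_algebra)
    finally show ?thesis .
  qed
  have B: "?B n \<in> sets (vimage_algebra (space M) e borel)" for n
  proof -
    have "{x. nat \<lceil>real m * x\<rceil> = n} \<in> sets borel" by measurable
    then have "e -` {x. nat \<lceil>real m * x\<rceil> = n} \<inter> space M \<in> sets (vimage_algebra (space M) e borel)"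
      by (rule in_vimage_algebra)
    also have "e -` {x. nat \<lceil>real m * x\<rceil> = n} \<inter> space M = ?B n" by (auto simp: N_def)
    finally show ?thesis .
  qed
  have Levent: "{\<omega> \<in> space M. ?L \<omega> = xs} = ?B (length xs) \<inter> ?A xs" for xs
    by (auto simp: L)
  have AM: "?A xs \<in> sets M" for xs
    using grid_event_F[of m "length xs" xs] sets_F_subset[of "real (length xs) / real m"] by auto
  have BM: "?B n \<in> sets M" for n unfolding N_def by measurable
  have Lvimage: "?L -` {xs} \<inter> space M = ?B (length xs) \<inter> ?A xs" for xs
    using Levent[of xs] by auto
  show Lmeas: "?L \<in> measurable M (count_space UNIV)"
    by (subst measurable_count_space_eq_countable) (auto simp: Lvimage intro!: sets.Int AM BM)
  \<comment> \<open>Zero cells would require \<open>e \<le> 0\<close>, a null event; otherwise the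
    count is read off from the exponential tails at consecutive grid times.\<close>
  have probB: "prob (?B n) = (if n = 0 then 0 else exp (- p / real m) ^ (n - 1) * (1 - exp (- p / real m)))" for n
  proof (cases n)
    case 0
    have "?B 0 = {\<omega> \<in> space M. e \<omega> \<le> 0}"
      using m by (auto simp: N_def mult_le_0_iff ceiling_le_iff)
    moreover have "\<P>(\<omega> in M. e \<omega> \<le> 0) = 0"
      using exponential_distributedD_le[OF dist, of 0] p by simp
    ultimately show ?thesis using 0 by simp
  next
    case (Suc k)
    have eq: "?B n = {\<omega> \<in> space M. real k / real m < e \<omega>} - {\<omega> \<in> space M. real (Suc k) / real m < e \<omega>}"
    proof -
      have "nat \<lceil>real m * y\<rceil> = Suc k \<longleftrightarrow> real k / real m < y \<and> \<not> real (Suc k) / real m < y" for y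
      proof -
        have "nat \<lceil>real m * y\<rceil> = Suc k \<longleftrightarrow> \<lceil>real m * y\<rceil> = int (Suc k)" by auto
        also have "\<dots> \<longleftrightarrow> real k < real m * y \<and> real m * y \<le> real (Suc k)"
          by (auto simp: ceiling_eq_iff)
        finally show ?thesis using m by (simp add: field_simps not_less)
      qed
      then show ?thesis by (auto simp: N_def Suc)
    qed
    have ex: "prob {\<omega> \<in> space M. real j / real m < e \<omega>} = exp (- p / real m) ^ j" for j
      using exponential_distributedD_gt[OF dist, of "real j / real m"] p
      by (simp add: mult.commute flip: exp_of_nat_mult)
    have "prob (?B n) = prob {\<omega> \<in> space M. real k / real m < e \<omega>} - prob {\<omega> \<in> space M. real (Suc k) / real m < e \<omega>}"
      unfolding eq
    proof (rule finite_measure.finite_measure_Diff[OF prob_space.axioms(1)[OF prob_space_axioms]])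
      have "real k / real m \<le> real (Suc k) / real m" by (intro divide_right_mono) auto
      then show "{\<omega> \<in> space M. real (Suc k) / real m < e \<omega>} \<subseteq> {\<omega> \<in> space M. real k / real m < e \<omega>}"
        by (auto intro: le_less_trans)
    qed measurable
    then show ?thesis unfolding ex by (simp add: Suc algebra_simps)
  qed
  show "distr M (count_space UNIV) ?L = killed_walk (exp (- p / real m)) (grid_pmf m)"
  proof (rule measure_eqI_countable[where A=UNIV])
    fix xs :: "int list"
    have "emeasure (distr M (count_space UNIV) ?L) {xs} = prob (?B (length xs) \<inter> ?A xs)"
      using Lmeas by (subst emeasure_distr) (auto simp: finite_measure.emeasure_eq_measure[OF prob_space.axioms(1)[OF prob_space_axioms]] Lvimage)
    also have "prob (?B (length xs) \<inter> ?A xs) = prob (?B (length xs)) * prob (?A xs)"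
      by (rule indep_setD[OF indep B A])
    also have "\<dots> = pmf (killed_walk (exp (- p / real m)) (grid_pmf m)) xs"
    proof -
      let ?q = "exp (- p / real m)"
      have q: "0 < ?q" "?q < 1" using p m by auto
      have "pmf (killed_walk ?q (grid_pmf m)) xs
        = (\<integral>n. pmf (replicate_pmf (Suc n) (grid_pmf m)) xs \<partial>geometric_pmf (1 - ?q))"
        by (simp add: killed_walk_def pmf_bind del: replicate_pmf.simps)
      also have "\<dots> = (\<integral>n. (if Suc n = length xs then prod_list (map (pmf (grid_pmf m)) xs) else 0) \<partial>geometric_pmf (1 - ?q))"
        by (simp only: pmf_replicate_pmf eq_commute)
      also have "\<dots> = (\<Sum>n\<in>{length xs - 1}. (if Suc n = length xs then prod_list (map (pmf (grid_pmf m)) xs) else 0) * pmf (geometric_pmf (1 - ?q)) n)"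
        by (rule integral_measure_pmf_real) (auto split: if_splits)
      also have "\<dots> = prob (?B (length xs)) * prob (?A xs)"
        unfolding probB prob_grid[OF m] pmf_replicate_pmf using q by (cases xs) auto
      finally show ?thesis by simp
    qed
    finally show "emeasure (distr M (count_space UNIV) ?L) {xs}
        = emeasure (measure_pmf (killed_walk (exp (- p / real m)) (grid_pmf m))) {xs}"
      by (simp add: emeasure_pmf_single)
  qed auto
qed

text \<open>Running extrema and their times depend on uncountably many coordinates. They are almost
  everywhere limits of grid quantities, hence measurable by completeness of
  \<open>M\<close>.\<close>

lemma borel_measurable_AE_limit:
  fixes f :: "nat \<Rightarrow> 'a \<Rightarrow> 'b::{second_countable_topology, banach}"
  assumes f: "\<And>n. f n \<in> borel_measurable M"
    and lim: "AE \<omega> in M. (\<lambda>n. f n \<omega>) \<longlonglongrightarrow> g \<omega>"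
  shows "g \<in> borel_measurable M"
proof (rule measurableI)
  define g' where "g' \<omega> = lim (\<lambda>n. f n \<omega>)" for \<omega>
  have g': "g' \<in> borel_measurable M"
    unfolding g'_def[abs_def] by (rule borel_measurable_lim_metric[OF f])
  have eq: "AE \<omega> in M. g \<omega> = g' \<omega>"
    using lim by eventually_elim (simp add: g'_def limI)
  fix A :: "'b set" assume "A \<in> sets borel"
  show "g -` A \<inter> space M \<in> sets M"
  proof (rule in_sets_AE)
    show "g' -` A \<inter> space M \<in> sets M" using g' \<open>A \<in> sets borel\<close> by (rule measurable_sets)
    show "AE \<omega> in M. (\<omega> \<in> g' -` A \<inter> space M) = (\<omega> \<in> g -` A \<inter> space M)"
      using eq by eventually_elim auto
  qed auto
qed auto

end

text \<open>Since \<open>\<pi>\<close> vanishes above 0, the expectations are the coefficients of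
  index \<open>k + 1\<close> of the product of the two generating functions. Multiplied by powers of
  \<open>w\<close> and summed, the recursion leaves only its source, proportional to
  \<open>w\<close>, and the zeroth coefficient of the product, which no equation matches.\<close>

lemma min_recursion_solution:
  fixes \<pi> :: "int \<Rightarrow> real" and w :: "'b::{real_normed_field,banach,second_countable_topology}"
  assumes pos: "\<And>k. k > 0 \<Longrightarrow> \<pi> k = 0"
    and summable: "summable (\<lambda>k. \<bar>\<pi> (- int k)\<bar>)"
    and rec: "\<And>k. k < 0 \<Longrightarrow> r * \<pi> k = c * (\<integral>i. \<pi> (k - 1 + int i) \<partial>measure_pmf b)"
    and rec0: "r * \<pi> 0 - p = c * (\<integral>i. \<pi> (int i - 1) + (if i = 0 then \<rho> else 0) \<partial>measure_pmf b)"
    and w: "norm w \<le> 1"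
  shows "(of_real r * w - of_real c * pgf b w) * (\<Sum>k. of_real (\<pi> (- int k)) * w ^ k)
    = of_real (p + c * pmf b 0 * \<rho>) * w - of_real (c * pmf b 0 * \<pi> 0)"
proof -
  define u where "u k = \<pi> (- int k)" for k
  define conv where "conv k = (\<Sum>i\<le>k. pmf b i * u (k - i))" for k
  have sum_eq: "(\<integral>i. \<pi> (- int k - 1 + int i) \<partial>measure_pmf b) = conv (Suc k)" for k
  proof -
    have "(\<integral>i. \<pi> (- int k - 1 + int i) \<partial>measure_pmf b) = (\<Sum>i\<le>Suc k. \<pi> (- int k - 1 + int i) * pmf b i)"
      by (rule integral_measure_pmf_real) (use pos in \<open>auto simp: not_le intro: ccontr\<close>)
    also have "\<dots> = conv (Suc k)"
      unfolding conv_def u_def by (intro sum.cong) (auto simp: of_nat_diff algebra_simps)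
    finally show ?thesis .
  qed
  have recS: "c * conv (Suc k) = r * u k - (if k = 0 then p + c * pmf b 0 * \<rho> else 0)" for k
  proof (cases k)
    case 0
    have "(\<integral>i. \<pi> (int i - 1) + (if i = 0 then \<rho> else 0) \<partial>measure_pmf b)
      = (\<Sum>i\<le>Suc 0. (\<pi> (int i - 1) + (if i = 0 then \<rho> else 0)) * pmf b i)"
      by (rule integral_measure_pmf_real) (use pos in \<open>auto simp: not_le intro: ccontr split: if_splits\<close>)
    also have "\<dots> = conv (Suc 0) + \<rho> * pmf b 0"
      by (simp add: conv_def u_def algebra_simps)
    finally show ?thesis using rec0 0 by (simp add: u_def algebra_simps)
  next
    case (Suc j)
    then show ?thesis using rec[of "- int k"] sum_eq[of k] by (simp add: u_def)
  qed
  have su: "summable (\<lambda>k. norm (of_real (u k) * w ^ k :: 'b))"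
    by (rule summable_comparison_test'[OF summable])
       (use w in \<open>auto simp: u_def norm_mult norm_power intro!: mult_left_le power_le_one\<close>)
  define B where "B = (\<Sum>k. of_real (u k) * w ^ k)"
  have uB: "(\<lambda>k. of_real (u k) * w ^ k) sums B"
    unfolding B_def by (rule summable_sums[OF summable_norm_cancel[OF su]])
  have "(\<lambda>k. \<Sum>i\<le>k. (of_real (pmf b i) * w ^ i) * (of_real (u (k - i)) * w ^ (k - i))) sums (pgf b w * B)"
    unfolding pgf_def B_def by (rule Cauchy_product_sums[OF summable_norm_pgf[OF w] su])
  moreover have "(\<Sum>i\<le>k. (of_real (pmf b i) * w ^ i) * (of_real (u (k - i)) * w ^ (k - i))) = of_real (conv k) * w ^ k" for k
    unfolding conv_def of_real_sum sum_distrib_right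
    by (intro sum.cong) (auto simp: simp flip: power_add)
  ultimately have "(\<lambda>k. of_real (conv k) * w ^ k) sums (pgf b w * B)" by simp
  then have "(\<lambda>k. of_real c * (of_real (conv k) * w ^ k)) sums (of_real c * (pgf b w * B))"
    by (rule sums_mult)
  \<comment> \<open>The coefficient of index 0 of the product is moved to the other side; it becomes
    the constant term \<open>c * pmf b 0 * \<pi> 0\<close>.\<close>
  then have 1: "(\<lambda>k. of_real c * (of_real (conv (Suc k)) * w ^ Suc k)) sums
       (of_real c * (pgf b w * B) - of_real (c * pmf b 0 * \<pi> 0))"
    by (subst sums_Suc_iff) (simp add: conv_def u_def)
  have "(\<lambda>k. of_real r * w * (of_real (u k) * w ^ k) - (if k = 0 then of_real (p + c * pmf b 0 * \<rho>) * w else 0)) sums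
       (of_real r * w * B - of_real (p + c * pmf b 0 * \<rho>) * w)"
    by (intro sums_diff sums_mult uB sums_single)
  moreover have "of_real r * w * (of_real (u k) * w ^ k) - (if k = 0 then of_real (p + c * pmf b 0 * \<rho>) * w else 0)
      = of_real c * (of_real (conv (Suc k)) * w ^ Suc k)" for k
  proof -
    have "of_real c * (of_real (conv (Suc k)) * w ^ Suc k) = of_real (c * conv (Suc k)) * w ^ Suc k"
      by simp
    also have "\<dots> = (of_real r * of_real (u k) - (if k = 0 then of_real (p + c * pmf b 0 * \<rho>) else 0)) * w ^ Suc k"
      unfolding recS by simp
    finally show ?thesis by (auto simp: algebra_simps)
  qed
  ultimately have "of_real r * w * B - of_real (p + c * pmf b 0 * \<rho>) * w
      = of_real c * (pgf b w * B) - of_real (c * pmf b 0 * \<pi> 0)"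
    using 1 sums_unique2 by simp
  then show ?thesis by (simp add: B_def u_def algebra_simps)
qed

section \<open>Transforms of the extrema at the exponential time\<close>

context upwards_skip_free_levy_chain
begin

lemmas integrable_bounded_M = finite_measure.integrable_const_bound[OF prob_space.axioms(1)[OF prob_space_axioms]]

text \<open>Almost every path sits at exactly one level, so the transform is pathwise a series with
  a single nonzero term; the masses of the levels add up to at most 1 and dominate the
  interchange.\<close>

lemma expectation_partition_sums:
  fixes S :: "nat \<Rightarrow> 'a \<Rightarrow> real" and H :: "'a \<Rightarrow> complex"
  assumes S: "\<And>k. S k \<in> borel_measurable M"
    and part: "AE \<omega> in M. \<exists>k g. 0 \<le> g \<and> g \<le> 1 \<and> (\<forall>j. S j \<omega> = (if j = k then g else 0)) \<and> H \<omega> = of_real g * c k"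
    and c: "\<And>k. norm (c k) \<le> 1"
  shows "summable (\<lambda>k. \<integral>\<omega>. S k \<omega> \<partial>M)"
    and "(\<lambda>k. of_real (\<integral>\<omega>. S k \<omega> \<partial>M) * c k) sums (\<integral>\<omega>. H \<omega> \<partial>M)"
proof -
  have bounds: "AE \<omega> in M. 0 \<le> S j \<omega> \<and> S j \<omega> \<le> 1" for j
    using part by eventually_elim auto
  have int: "integrable M (S j)" for j
    by (rule integrable_bounded_M[where B=1]) (use bounds[of j] S in \<open>auto elim: eventually_mono\<close>)
  have nonneg: "0 \<le> (\<integral>\<omega>. S k \<omega> \<partial>M)" for k
    using bounds[of k] by (intro integral_nonneg_AE) (auto elim: eventually_mono)
  show summ: "summable (\<lambda>k. \<integral>\<omega>. S k \<omega> \<partial>M)"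
  proof (rule summableI_nonneg_bounded[OF nonneg])
    fix n
    have "(\<Sum>k<n. \<integral>\<omega>. S k \<omega> \<partial>M) = (\<integral>\<omega>. (\<Sum>k<n. S k \<omega>) \<partial>M)"
      by (subst Bochner_Integration.integral_sum) (auto intro: int)
    also have "\<dots> \<le> (\<integral>\<omega>. (1::real) \<partial>M)"
    proof (rule integral_mono_AE)
      show "AE \<omega> in M. (\<Sum>k<n. S k \<omega>) \<le> 1"
        using part by eventually_elim (auto simp: sum.delta)
      show "integrable M (\<lambda>\<omega>. \<Sum>k<n. S k \<omega>)" by (intro Bochner_Integration.integrable_sum int)
      show "integrable M (\<lambda>\<omega>. 1::real)" by (rule integrable_bounded_M[where B=1]) auto
    qed
    also have "\<dots> = 1" by (simp add: prob_space)
    finally show "(\<Sum>k<n. \<integral>\<omega>. S k \<omega> \<partial>M) \<le> 1" .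
  qed
  have lim: "AE \<omega> in M. (\<lambda>k. of_real (S k \<omega>) * c k) sums H \<omega>"
    using part
  proof eventually_elim
    case (elim \<omega>)
    then obtain k g where *: "\<And>j. S j \<omega> = (if j = k then g else 0)" "H \<omega> = of_real g * c k" by blast
    have "(\<lambda>j. if j = k then of_real g * c j else 0) sums (of_real g * c k)"
      by (rule sums_single)
    moreover have "(\<lambda>j. if j = k then of_real g * c j else 0) = (\<lambda>k. of_real (S k \<omega>) * c k)"
      by (auto simp: *)
    ultimately show ?case by (simp add: *)
  qed
  have meas: "(\<lambda>\<omega>. of_real (S k \<omega>) * c k) \<in> borel_measurable M" for k
    using S[of k] by measurable
  \<comment> \<open>Measurability of the transform comes from its being an almost everywhere limit
    of measurable partial sums.\<close>
  have Hm: "H \<in> borel_measurable M"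
    by (rule borel_measurable_AE_limit[of "\<lambda>n \<omega>. \<Sum>k<n. of_real (S k \<omega>) * c k"])
       (use lim meas in \<open>auto simp: sums_def\<close>)
  have "(\<lambda>k. \<integral>\<omega>. of_real (S k \<omega>) * c k \<partial>M) sums (\<integral>\<omega>. (\<Sum>k. of_real (S k \<omega>) * c k) \<partial>M)"
  proof (rule sums_integral)
    show "integrable M (\<lambda>\<omega>. of_real (S k \<omega>) * c k)" for k using int[of k] by simp
    show "AE \<omega> in M. summable (\<lambda>k. norm (of_real (S k \<omega>) * c k))"
      using part
    proof eventually_elim
      case (elim \<omega>)
      then obtain k g where *: "\<And>j. S j \<omega> = (if j = k then g else 0)" by blast
      have "summable (\<lambda>j. if j = k then norm (of_real g * c j) else 0)" by (rule summable_single)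
      moreover have "(\<lambda>j. if j = k then norm (of_real g * c j) else 0) = (\<lambda>k. norm (of_real (S k \<omega>) * c k))"
        by (auto simp: *)
      ultimately show ?case by simp
    qed
    show "summable (\<lambda>k. \<integral>\<omega>. norm (of_real (S k \<omega>) * c k) \<partial>M)"
    proof (rule summable_comparison_test'[OF summ])
      fix k
      have "(\<integral>\<omega>. norm (of_real (S k \<omega>) * c k) \<partial>M) \<le> (\<integral>\<omega>. S k \<omega> \<partial>M)"
      proof (rule integral_mono_AE)
        show "integrable M (\<lambda>\<omega>. norm (of_real (S k \<omega>) * c k))" using int[of k] by (simp add: norm_mult)
        show "AE \<omega> in M. norm (of_real (S k \<omega>) * c k) \<le> S k \<omega>"
          using bounds[of k] by eventually_elim (use c[of k] in \<open>auto simp: norm_mult intro: mult_left_le\<close>)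
      qed (rule int)
      then show "norm (\<integral>\<omega>. norm (of_real (S k \<omega>) * c k) \<partial>M) \<le> (\<integral>\<omega>. S k \<omega> \<partial>M)"
        by (simp add: integral_nonneg_AE)
    qed
  qed
  also have "(\<integral>\<omega>. (\<Sum>k. of_real (S k \<omega>) * c k) \<partial>M) = (\<integral>\<omega>. H \<omega> \<partial>M)"
    by (rule integral_cong_AE) (use lim Hm meas in \<open>auto elim!: eventually_mono simp: sums_iff\<close>)
  also have "(\<lambda>k. \<integral>\<omega>. of_real (S k \<omega>) * c k \<partial>M) = (\<lambda>k. of_real (\<integral>\<omega>. S k \<omega> \<partial>M) * c k)"
    by simp
  finally show "(\<lambda>k. of_real (\<integral>\<omega>. S k \<omega> \<partial>M) * c k) sums (\<integral>\<omega>. H \<omega> \<partial>M)" .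
qed

text \<open>Both sides vanish at \<open>Phi \<nu> r\<close>; dividing by
  \<open>x - Phi \<nu> r\<close> and passing to the limit compares the derivatives. It serves the
  infimum transform and, applied to real and imaginary parts, \<open>kappa_hat\<close>.\<close>

lemma quotient_at_root:
  assumes r: "r > 0" and g: "isCont g1 (Phi \<nu> r)" "isCont g2 (Phi \<nu> r)"
    and eq: "\<And>x. x > 0 \<Longrightarrow> (r - psi x) * g1 x = (1 - exp ((x - Phi \<nu> r) * h)) * g2 x"
  shows "deriv psi (Phi \<nu> r) * g1 (Phi \<nu> r) = h * g2 (Phi \<nu> r)"
proof -
  define x0 where "x0 = Phi \<nu> r"
  have x0: "x0 > 0" "psi x0 = r" using Phi_pos psi_Phi r by (auto simp: x0_def)
  have L1: "((\<lambda>x. (psi x - psi x0) / (x - x0) * g1 x) \<longlongrightarrow> deriv psi x0 * g1 x0) (at x0)"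
    using DERIV_psi_Phi(1)[OF r] g(1) unfolding x0_def[symmetric] isCont_def
    by (intro tendsto_mult) (auto simp: has_field_derivative_iff)
  have L2: "((\<lambda>x. (exp ((x - x0) * h) - exp ((x0 - x0) * h)) / (x - x0) * g2 x) \<longlongrightarrow> h * g2 x0) (at x0)"
  proof (intro tendsto_mult)
    have "DERIV (\<lambda>x. exp ((x - x0) * h)) x0 :> h"
      by (auto intro!: derivative_eq_intros)
    then show "((\<lambda>x. (exp ((x - x0) * h) - exp ((x0 - x0) * h)) / (x - x0)) \<longlongrightarrow> h) (at x0)"
      by (simp add: has_field_derivative_iff)
    show "(g2 \<longlongrightarrow> g2 x0) (at x0)" using g(2) by (simp add: isCont_def x0_def)
  qed
  have ev: "eventually (\<lambda>x. (psi x - psi x0) / (x - x0) * g1 x =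
      (exp ((x - x0) * h) - exp ((x0 - x0) * h)) / (x - x0) * g2 x) (at x0)"
  proof -
    have "eventually (\<lambda>x. x \<in> {0<..}) (at x0)"
      by (rule eventually_at_in_open') (use x0 in auto)
    then show ?thesis
    proof eventually_elim
      case (elim x)
      have "(psi x - r) * g1 x = (exp ((x - x0) * h) - 1) * g2 x"
        using eq[of x] elim by (simp add: x0_def algebra_simps)
      then show ?case by (simp add: x0)
    qed
  qed
  have "deriv psi x0 * g1 x0 = h * g2 x0"
    by (rule tendsto_unique[OF _ Lim_transform_eventually[OF L1 ev] L2]) simp
  then show ?thesis by (simp add: x0_def)
qed

text \<open>The level is eventually exact along the grid, so the jump of the indicator causes no
  trouble and only the discount has to converge.\<close>

lemma level_weight_tendsto:
  fixes G :: "nat \<Rightarrow> 'b" and ext :: "'b \<Rightarrow> int" and arg :: "'b \<Rightarrow> nat"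
  assumes ext: "eventually (\<lambda>m. h * of_int (ext (G m)) = R) sequentially"
    and arg: "(\<lambda>m. real (arg (G m)) / real m) \<longlonglongrightarrow> T"
  shows "(\<lambda>m. if ext (G m) = k then exp (- \<alpha> / real m) ^ arg (G m) else 0)
    \<longlonglongrightarrow> (if R = h * of_int k then exp (- (\<alpha> * T)) else 0)"
proof -
  have "(\<lambda>m. exp (- (\<alpha> * (real (arg (G m)) / real m)))) \<longlonglongrightarrow> exp (- (\<alpha> * T))"
    by (intro tendsto_intros arg)
  then have "(\<lambda>m. if R = h * of_int k then exp (- (\<alpha> * (real (arg (G m)) / real m))) else 0)
      \<longlonglongrightarrow> (if R = h * of_int k then exp (- (\<alpha> * T)) else 0)"
    by (cases "R = h * of_int k") simp_all
  moreover have "eventually (\<lambda>m. (if R = h * of_int k then exp (- (\<alpha> * (real (arg (G m)) / real m))) else 0)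
      = (if ext (G m) = k then exp (- \<alpha> / real m) ^ arg (G m) else 0)) sequentially"
    using ext
  proof eventually_elim
    case (elim m)
    have "R = h * of_int k \<longleftrightarrow> ext (G m) = k"
      using h_pos by (simp flip: elim)
    then show ?case by (simp add: mult.commute flip: exp_of_nat_mult)
  qed
  ultimately show ?thesis by (rule Lim_transform_eventually)
qed

context
  fixes p :: real and e :: "'a \<Rightarrow> real"
  assumes p: "p > 0" and e: "independent_exponential M X p e"
begin

definition sup_weight :: "real \<Rightarrow> int \<Rightarrow> 'a \<Rightarrow> real" where
  "sup_weight \<alpha> k \<omega> = (if running_sup X (e \<omega>) \<omega> = h * of_int k
     then exp (- (\<alpha> * first_sup_time X (e \<omega>) \<omega>)) else 0)"

definition inf_weight :: "real \<Rightarrow> int \<Rightarrow> 'a \<Rightarrow> real" where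
  "inf_weight \<alpha> k \<omega> = (if running_inf X (e \<omega>) \<omega> = h * of_int k
     then exp (- (\<alpha> * last_inf_time X (e \<omega>) \<omega>)) else 0)"

lemma AE_good: "AE \<omega> in M. 0 < e \<omega> \<and> lattice_path h (\<lambda>t. X t \<omega>) \<and> X 0 \<omega> = 0"
proof -
  have dist: "distributed M lborel e (exponential_density p)"
    using e by (simp add: independent_exponential_def)
  then have [measurable]: "e \<in> borel_measurable M" by (auto simp: distributed_def)
  have "prob {\<omega> \<in> space M. 0 < e \<omega>} = 1"
    using exponential_distributedD_gt[OF dist, of 0] p by simp
  then have "AE \<omega> in M. \<omega> \<in> {\<omega> \<in> space M. 0 < e \<omega>}"
    by (intro AE_prob_1)
  with AE_lattice_path show ?thesis by eventually_elim auto
qed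

lemma AE_max_weight_tendsto:
  "AE \<omega> in M. \<forall>k. (\<lambda>m. max_weight (exp (- \<alpha> / real m)) k (killed_grid e m \<omega>)) \<longlonglongrightarrow> sup_weight \<alpha> k \<omega>"
  using AE_good
proof eventually_elim
  case (elim \<omega>)
  then show ?case
    unfolding max_weight_def sup_weight_def
    by (intro allI level_weight_tendsto; unfold killed_grid_def; intro grid_max_limit) (use h_pos in auto)
qed

lemma AE_min_weight_tendsto:
  "AE \<omega> in M. \<forall>k. (\<lambda>m. min_weight (exp (- \<alpha> / real m)) k (killed_grid e m \<omega>)) \<longlonglongrightarrow> inf_weight \<alpha> k \<omega>"
  using AE_good
proof eventually_elim
  case (elim \<omega>)
  then show ?case
    unfolding min_weight_def inf_weight_def
    by (intro allI level_weight_tendsto; unfold killed_grid_def; intro grid_min_limit) (use h_pos in auto)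
qed

lemma killed_grid_expectation_tendsto:
  fixes W :: "nat \<Rightarrow> int list \<Rightarrow> real"
  assumes W: "\<And>m xs. 0 \<le> W m xs" "\<And>m xs. W m xs \<le> 1"
    and lim: "AE \<omega> in M. (\<lambda>m. W m (killed_grid e m \<omega>)) \<longlonglongrightarrow> S \<omega>"
  shows "S \<in> borel_measurable M"
    and "(\<lambda>m. \<integral>xs. W m xs \<partial>killed_walk (exp (- p / real m)) (grid_pmf m)) \<longlonglongrightarrow> (\<integral>\<omega>. S \<omega> \<partial>M)"
    and "0 \<le> (\<integral>\<omega>. S \<omega> \<partial>M)" "(\<integral>\<omega>. S \<omega> \<partial>M) \<le> 1"
proof -
  \<comment> \<open>The mesh \<open>1 / m\<close> makes sense from \<open>m = 1\<close> on; the
    shift by \<open>Suc\<close> avoids \<open>m = 0\<close> and is undone by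
    \<open>LIMSEQ_imp_Suc\<close>.\<close>
  have Lm: "killed_grid e (Suc m) \<in> measurable M (count_space UNIV)" for m
    using killed_grid_measurable[OF p e, of "Suc m"] by simp
  have Wm: "(\<lambda>\<omega>. W (Suc m) (killed_grid e (Suc m) \<omega>)) \<in> borel_measurable M" for m
    by (rule measurable_compose[OF Lm]) simp
  have lim': "AE \<omega> in M. (\<lambda>m. W (Suc m) (killed_grid e (Suc m) \<omega>)) \<longlonglongrightarrow> S \<omega>"
    using lim by eventually_elim (rule LIMSEQ_Suc)
  show Sm: "S \<in> borel_measurable M"
    by (rule borel_measurable_AE_limit[OF Wm lim'])
  have eq: "(\<integral>\<omega>. W (Suc m) (killed_grid e (Suc m) \<omega>) \<partial>M)
      = (\<integral>xs. W (Suc m) xs \<partial>killed_walk (exp (- p / real (Suc m))) (grid_pmf (Suc m)))" for m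
    unfolding distr_killed_grid[OF p e zero_less_Suc, symmetric]
    by (rule integral_distr[symmetric]) (auto intro: Lm)
  have "(\<lambda>m. \<integral>\<omega>. W (Suc m) (killed_grid e (Suc m) \<omega>) \<partial>M) \<longlonglongrightarrow> (\<integral>\<omega>. S \<omega> \<partial>M)"
  proof (rule integral_dominated_convergence[where w="\<lambda>_. 1"])
    show "integrable M (\<lambda>_. 1::real)" by (rule integrable_bounded_M[where B=1]) auto
  qed (use Sm Wm lim' W in auto)
  then show L: "(\<lambda>m. \<integral>xs. W m xs \<partial>killed_walk (exp (- p / real m)) (grid_pmf m)) \<longlonglongrightarrow> (\<integral>\<omega>. S \<omega> \<partial>M)"
    unfolding eq by (rule LIMSEQ_imp_Suc)
  have E: "0 \<le> (\<integral>xs. W m xs \<partial>measure_pmf q)" "(\<integral>xs. W m xs \<partial>measure_pmf q) \<le> 1" for m q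
    by (rule expectation_bounds_01; rule W)+
  show "0 \<le> (\<integral>\<omega>. S \<omega> \<partial>M)" by (rule LIMSEQ_le_const[OF L]) (use E(1) in blast)
  show "(\<integral>\<omega>. S \<omega> \<partial>M) \<le> 1" by (rule LIMSEQ_le_const2[OF L]) (use E(2) in blast)
qed

context
  fixes \<alpha> :: real
  assumes \<alpha>: "\<alpha> \<ge> 0"
begin

lemma sup_weight_limit:
  shows sup_weight_measurable: "sup_weight \<alpha> k \<in> borel_measurable M"
    and max_weight_limit: "(\<lambda>m. \<integral>xs. max_weight (exp (- \<alpha> / real m)) k xs
      \<partial>killed_walk (exp (- p / real m)) (grid_pmf m)) \<longlonglongrightarrow> (\<integral>\<omega>. sup_weight \<alpha> k \<omega> \<partial>M)"
    and sup_weight_bounds: "0 \<le> (\<integral>\<omega>. sup_weight \<alpha> k \<omega> \<partial>M)" "(\<integral>\<omega>. sup_weight \<alpha> k \<omega> \<partial>M) \<le> 1"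
proof -
  have z: "0 \<le> exp (- \<alpha> / real m)" "exp (- \<alpha> / real m) \<le> 1" for m using \<alpha> by auto
  have lim: "AE \<omega> in M. (\<lambda>m. max_weight (exp (- \<alpha> / real m)) k (killed_grid e m \<omega>)) \<longlonglongrightarrow> sup_weight \<alpha> k \<omega>"
    using AE_max_weight_tendsto by eventually_elim auto
  from killed_grid_expectation_tendsto[OF weight_bounds(1,2)[OF z] lim]
  show "sup_weight \<alpha> k \<in> borel_measurable M"
    "(\<lambda>m. \<integral>xs. max_weight (exp (- \<alpha> / real m)) k xs
      \<partial>killed_walk (exp (- p / real m)) (grid_pmf m)) \<longlonglongrightarrow> (\<integral>\<omega>. sup_weight \<alpha> k \<omega> \<partial>M)"
    "0 \<le> (\<integral>\<omega>. sup_weight \<alpha> k \<omega> \<partial>M)" "(\<integral>\<omega>. sup_weight \<alpha> k \<omega> \<partial>M) \<le> 1"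
    by auto
qed

lemma inf_weight_limit:
  shows inf_weight_measurable: "inf_weight \<alpha> k \<in> borel_measurable M"
    and min_weight_limit: "(\<lambda>m. \<integral>xs. min_weight (exp (- \<alpha> / real m)) k xs
      \<partial>killed_walk (exp (- p / real m)) (grid_pmf m)) \<longlonglongrightarrow> (\<integral>\<omega>. inf_weight \<alpha> k \<omega> \<partial>M)"
    and inf_weight_bounds: "0 \<le> (\<integral>\<omega>. inf_weight \<alpha> k \<omega> \<partial>M)" "(\<integral>\<omega>. inf_weight \<alpha> k \<omega> \<partial>M) \<le> 1"
proof -
  have z: "0 \<le> exp (- \<alpha> / real m)" "exp (- \<alpha> / real m) \<le> 1" for m using \<alpha> by auto
  have lim: "AE \<omega> in M. (\<lambda>m. min_weight (exp (- \<alpha> / real m)) k (killed_grid e m \<omega>)) \<longlonglongrightarrow> inf_weight \<alpha> k \<omega>"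
    using AE_min_weight_tendsto by eventually_elim auto
  from killed_grid_expectation_tendsto[OF weight_bounds(4,5)[OF z] lim]
  show "inf_weight \<alpha> k \<in> borel_measurable M"
    "(\<lambda>m. \<integral>xs. min_weight (exp (- \<alpha> / real m)) k xs
      \<partial>killed_walk (exp (- p / real m)) (grid_pmf m)) \<longlonglongrightarrow> (\<integral>\<omega>. inf_weight \<alpha> k \<omega> \<partial>M)"
    "0 \<le> (\<integral>\<omega>. inf_weight \<alpha> k \<omega> \<partial>M)" "(\<integral>\<omega>. inf_weight \<alpha> k \<omega> \<partial>M) \<le> 1"
    by auto
qed

lemma sup_weight_geometric:
  "(\<integral>\<omega>. sup_weight \<alpha> (int k) \<omega> \<partial>M) = (\<integral>\<omega>. sup_weight 0 0 \<omega> \<partial>M) * w0 (p + \<alpha>) ^ k"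
proof -
  define \<pi> where "\<pi> k = (\<integral>\<omega>. sup_weight \<alpha> k \<omega> \<partial>M)" for k
  have "\<pi> (int k) = \<pi> 0 * w0 (p + \<alpha>) ^ k"
  proof (rule max_recursion_solution)
    show "0 \<le> lam / (p + \<alpha> + lam)" "lam / (p + \<alpha> + lam) < 1" using lam_pos p \<alpha> by auto
    show "0 \<le> w0 (p + \<alpha>)" "w0 (p + \<alpha>) \<le> 1" using w0_bounds[of "p + \<alpha>"] p \<alpha> by auto
    show "w0 (p + \<alpha>) = lam / (p + \<alpha> + lam) * pgf step_pmf (w0 (p + \<alpha>))"
      using w0_root[of "p + \<alpha>"] p \<alpha> by simp
    show "\<pi> k = lam / (p + \<alpha> + lam) * (\<integral>i. \<pi> (k - 1 + int i) \<partial>step_pmf)" if "k > 0" for k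
      using max_recursion_limit[OF p \<alpha> lam_pos max_weight_limit that] lam_pos p \<alpha>
      unfolding \<pi>_def by (simp add: field_simps)
    show "\<bar>\<pi> k\<bar> \<le> 1" for k using sup_weight_bounds[of k] by (simp add: \<pi>_def)
  qed
  \<comment> \<open>On level 0 the first time of the supremum is 0, so the discount is 1 for every
    \<alpha>.\<close>
  moreover have "\<pi> 0 = (\<integral>\<omega>. sup_weight 0 0 \<omega> \<partial>M)"
    unfolding \<pi>_def
  proof (rule integral_cong_AE)
    show "AE \<omega> in M. sup_weight \<alpha> 0 \<omega> = sup_weight 0 0 \<omega>"
      using AE_good by eventually_elim
       (use grid_max_limit(3) h_pos in \<open>fastforce simp: sup_weight_def\<close>)
    show "sup_weight 0 0 \<in> borel_measurable M"
      by (rule killed_grid_expectation_tendsto(1)[of "\<lambda>m. max_weight 1 0"])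
         (use weight_bounds[of 1] AE_max_weight_tendsto[of 0] in auto)
  qed (rule sup_weight_measurable)
  ultimately show ?thesis by (simp add: \<pi>_def)
qed

lemma sup_transform_sums:
  fixes \<beta> :: complex
  assumes "Re \<beta> \<ge> 0"
  shows "(\<lambda>k. of_real (\<integral>\<omega>. sup_weight \<alpha> (int k) \<omega> \<partial>M) * exp (- (\<beta> * of_real h)) ^ k) sums
    (\<integral>\<omega>. exp (- of_real (\<alpha> * first_sup_time X (e \<omega>) \<omega>) - \<beta> * of_real (running_sup X (e \<omega>) \<omega>)) \<partial>M)"
proof (rule expectation_partition_sums(2))
  show "norm (exp (- (\<beta> * of_real h)) ^ k) \<le> 1" for k
    using assms h_pos by (simp add: norm_power power_le_one)
  show "AE \<omega> in M. \<exists>k g. 0 \<le> g \<and> g \<le> 1 \<and> (\<forall>j. sup_weight \<alpha> (int j) \<omega> = (if j = k then g else 0)) \<and>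
     exp (- of_real (\<alpha> * first_sup_time X (e \<omega>) \<omega>) - \<beta> * of_real (running_sup X (e \<omega>) \<omega>)) =
     of_real g * exp (- (\<beta> * of_real h)) ^ k"
    using AE_good
  proof eventually_elim
    case (elim \<omega>)
    \<comment> \<open>A single sufficiently fine grid already exhibits the supremum as a natural
      multiple of \<open>h\<close>, which identifies the level \<open>k\<close>.\<close>
    have "eventually (\<lambda>m. h * of_int (walk_max (killed_grid e m \<omega>)) = running_sup X (e \<omega>) \<omega>) sequentially"
      unfolding killed_grid_def by (rule grid_max_limit(1)) (use elim h_pos in auto)
    then obtain m where m: "h * of_int (walk_max (killed_grid e m \<omega>)) = running_sup X (e \<omega>) \<omega>"
      by (auto simp: eventually_sequentially)
    define k where "k = nat (walk_max (killed_grid e m \<omega>))"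
    have k: "running_sup X (e \<omega>) \<omega> = h * real k"
      using m walk_max_nonneg[of "killed_grid e m \<omega>"] by (simp add: k_def)
    define g where "g = exp (- (\<alpha> * first_sup_time X (e \<omega>) \<omega>))"
    have "(\<lambda>m. real (walk_argmax (killed_grid e m \<omega>)) / real m) \<longlonglongrightarrow> first_sup_time X (e \<omega>) \<omega>"
      unfolding killed_grid_def by (rule grid_max_limit(2)) (use elim h_pos in auto)
    \<comment> \<open>The time is a limit of nonnegative quotients; with
      \<open>\<alpha> \<ge> 0\<close> this bounds the discount by 1.\<close>
    then have "0 \<le> first_sup_time X (e \<omega>) \<omega>" by (rule LIMSEQ_le_const) auto
    then have "g \<le> 1" using \<alpha> by (simp add: g_def)
    moreover have "sup_weight \<alpha> (int j) \<omega> = (if j = k then g else 0)" for j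
      using h_pos by (simp add: sup_weight_def k g_def)
    moreover have "exp (- of_real (\<alpha> * first_sup_time X (e \<omega>) \<omega>) - \<beta> * of_real (running_sup X (e \<omega>) \<omega>)) =
       of_real g * exp (- (\<beta> * of_real h)) ^ k"
      by (simp add: k g_def algebra_simps minus_diff_commute flip: exp_of_nat_mult exp_add exp_of_real)
    ultimately show ?case by (intro exI[of _ k] exI[of _ g]) (simp add: g_def)
  qed
qed (rule sup_weight_measurable)

lemma inf_transform_sums:
  shows inf_weight_summable: "summable (\<lambda>k. \<integral>\<omega>. inf_weight \<alpha> (- int k) \<omega> \<partial>M)"
    and inf_transform: "Re \<beta> \<ge> 0 \<Longrightarrow> (\<lambda>k. of_real (\<integral>\<omega>. inf_weight \<alpha> (- int k) \<omega> \<partial>M) * exp (- (\<beta> * of_real h)) ^ k) sums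
    (\<integral>\<omega>. exp (- of_real (\<alpha> * last_inf_time X (e \<omega>) \<omega>) + \<beta> * of_real (running_inf X (e \<omega>) \<omega>)) \<partial>M)"
proof -
  have norm: "norm (exp (- (\<beta> * of_real h)) ^ k) \<le> 1" if "Re \<beta> \<ge> 0" for k and \<beta> :: complex
    using that h_pos by (simp add: norm_power power_le_one)
  have AE: "AE \<omega> in M. \<exists>k g. 0 \<le> g \<and> g \<le> 1 \<and> (\<forall>j. inf_weight \<alpha> (- int j) \<omega> = (if j = k then g else 0)) \<and>
     exp (- of_real (\<alpha> * last_inf_time X (e \<omega>) \<omega>) + \<beta> * of_real (running_inf X (e \<omega>) \<omega>)) =
     of_real g * exp (- (\<beta> * of_real h)) ^ k" for \<beta> :: complex
    using AE_good
  proof eventually_elim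
    case (elim \<omega>)
    have "eventually (\<lambda>m. h * of_int (walk_min (killed_grid e m \<omega>)) = running_inf X (e \<omega>) \<omega>) sequentially"
      unfolding killed_grid_def by (rule grid_min_limit(1)) (use elim h_pos in auto)
    then obtain m where m: "h * of_int (walk_min (killed_grid e m \<omega>)) = running_inf X (e \<omega>) \<omega>"
      by (auto simp: eventually_sequentially)
    define k where "k = nat (- walk_min (killed_grid e m \<omega>))"
    have k: "running_inf X (e \<omega>) \<omega> = - (h * real k)"
      using m walk_min_nonpos[of "killed_grid e m \<omega>"] by (simp add: k_def)
    define g where "g = exp (- (\<alpha> * last_inf_time X (e \<omega>) \<omega>))"
    have "(\<lambda>m. real (walk_last_argmin (killed_grid e m \<omega>)) / real m) \<longlonglongrightarrow> last_inf_time X (e \<omega>) \<omega>"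
      unfolding killed_grid_def by (rule grid_min_limit(2)) (use elim h_pos in auto)
    then have "0 \<le> last_inf_time X (e \<omega>) \<omega>" by (rule LIMSEQ_le_const) auto
    then have "g \<le> 1" using \<alpha> by (simp add: g_def)
    moreover have "inf_weight \<alpha> (- int j) \<omega> = (if j = k then g else 0)" for j
      using h_pos by (simp add: inf_weight_def k g_def)
    moreover have "exp (- of_real (\<alpha> * last_inf_time X (e \<omega>) \<omega>) + \<beta> * of_real (running_inf X (e \<omega>) \<omega>)) =
       of_real g * exp (- (\<beta> * of_real h)) ^ k"
      by (simp add: k g_def algebra_simps minus_diff_commute flip: exp_of_nat_mult exp_add exp_of_real)
    ultimately show ?case by (intro exI[of _ k] exI[of _ g]) (simp add: g_def)
  qed
  show "summable (\<lambda>k. \<integral>\<omega>. inf_weight \<alpha> (- int k) \<omega> \<partial>M)"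
    by (rule expectation_partition_sums(1)[OF inf_weight_measurable AE[of 0] norm]) simp
  show "(\<lambda>k. of_real (\<integral>\<omega>. inf_weight \<alpha> (- int k) \<omega> \<partial>M) * exp (- (\<beta> * of_real h)) ^ k) sums
    (\<integral>\<omega>. exp (- of_real (\<alpha> * last_inf_time X (e \<omega>) \<omega>) + \<beta> * of_real (running_inf X (e \<omega>) \<omega>)) \<partial>M)" if "Re \<beta> \<ge> 0"
    using that by (intro expectation_partition_sums(2)[OF inf_weight_measurable AE norm])
qed

lemma inf_weight_pos: "k > 0 \<Longrightarrow> (\<integral>\<omega>. inf_weight \<alpha> k \<omega> \<partial>M) = 0"
proof -
  assume k: "k > 0"
  have "min_weight z k xs = 0" for z xs
    using walk_min_nonpos[of xs] k by (auto simp: min_weight_def)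
  then have "(\<lambda>m. 0::real) \<longlonglongrightarrow> (\<integral>\<omega>. inf_weight \<alpha> k \<omega> \<partial>M)"
    using min_weight_limit[of k] by simp
  then show ?thesis by (simp add: LIMSEQ_const_iff)
qed

text \<open>The field stays open because the real root \<open>w0\<close> will be inserted to find
  the constants, and complex points for the transform. The value \<open>inf_weight 0 0\<close>
  enters as the limit of the undiscounted weights in the source term.\<close>

lemma inf_gf_equation:
  fixes w :: "'b::{real_normed_field,banach,second_countable_topology}"
  assumes w: "norm w \<le> 1"
  shows "(of_real (p + \<alpha> + lam) * w - of_real lam * pgf step_pmf w)
      * (\<Sum>k. of_real (\<integral>\<omega>. inf_weight \<alpha> (- int k) \<omega> \<partial>M) * w ^ k)
    = of_real (p + lam * pmf step_pmf 0 * (\<integral>\<omega>. inf_weight 0 0 \<omega> \<partial>M)) * w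
      - of_real (lam * pmf step_pmf 0 * (\<integral>\<omega>. inf_weight \<alpha> 0 \<omega> \<partial>M))"
proof (rule min_recursion_solution[OF inf_weight_pos _ _ _ w])
  show "summable (\<lambda>k. \<bar>\<integral>\<omega>. inf_weight \<alpha> (- int k) \<omega> \<partial>M\<bar>)"
    using inf_weight_summable inf_weight_bounds(1) by simp
  show "(p + \<alpha> + lam) * (\<integral>\<omega>. inf_weight \<alpha> k \<omega> \<partial>M)
      = lam * (\<integral>i. (\<integral>\<omega>. inf_weight \<alpha> (k - 1 + int i) \<omega> \<partial>M) \<partial>step_pmf)" if "k < 0" for k
    by (rule min_recursion_limit[OF p \<alpha> lam_pos min_weight_limit that])
  have "(\<lambda>m. \<integral>xs. min_weight 1 0 xs \<partial>killed_walk (exp (- p / real m)) (grid_pmf m)) \<longlonglongrightarrow> (\<integral>\<omega>. inf_weight 0 0 \<omega> \<partial>M)"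
    by (rule killed_grid_expectation_tendsto(2)[of "\<lambda>m. min_weight 1 0"])
       (use weight_bounds[of 1] AE_min_weight_tendsto[of 0] in auto)
  then show "(p + \<alpha> + lam) * (\<integral>\<omega>. inf_weight \<alpha> 0 \<omega> \<partial>M) - p
    = lam * (\<integral>i. (\<integral>\<omega>. inf_weight \<alpha> (int i - 1) \<omega> \<partial>M) + (if i = 0 then (\<integral>\<omega>. inf_weight 0 0 \<omega> \<partial>M) else 0) \<partial>step_pmf)"
    by (rule min_recursion_limit_0[OF p \<alpha> lam_pos min_weight_limit])
qed

end

lemma sup_transform:
  fixes \<beta> :: complex
  assumes \<alpha>: "\<alpha> \<ge> 0" and \<beta>: "Re \<beta> \<ge> 0"
  shows "(\<integral>\<omega>. exp (- of_real (\<alpha> * first_sup_time X (e \<omega>) \<omega>) - \<beta> * of_real (running_sup X (e \<omega>) \<omega>)) \<partial>M)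
    = (1 - of_real (w0 p)) / (1 - of_real (w0 (p + \<alpha>)) * exp (- (\<beta> * of_real h)))"
proof -
  have *: "(\<integral>\<omega>. exp (- of_real (a * first_sup_time X (e \<omega>) \<omega>) - b * of_real (running_sup X (e \<omega>) \<omega>)) \<partial>M)
      = of_real (\<integral>\<omega>. sup_weight 0 0 \<omega> \<partial>M) / (1 - of_real (w0 (p + a)) * exp (- (b * of_real h)))"
    if a: "a \<ge> 0" and b: "Re b \<ge> 0" for a and b :: complex
  proof -
    have w: "0 < w0 (p + a)" "w0 (p + a) < 1" using w0_bounds[of "p + a"] p a by auto
    let ?z = "of_real (w0 (p + a)) * exp (- (b * of_real h))"
    have "norm ?z \<le> w0 (p + a) * 1"
      using w b h_pos by (simp add: norm_mult)
    then have "norm ?z < 1" using w by simp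
    from sums_mult[OF geometric_sums[OF this], of "of_real (\<integral>\<omega>. sup_weight 0 0 \<omega> \<partial>M)"]
    have "(\<lambda>k. of_real (\<integral>\<omega>. sup_weight a (int k) \<omega> \<partial>M) * exp (- (b * of_real h)) ^ k) sums
      (of_real (\<integral>\<omega>. sup_weight 0 0 \<omega> \<partial>M) * (1 / (1 - ?z)))"
      by (simp add: sup_weight_geometric[OF a] power_mult_distrib mult.assoc)
    with sup_transform_sums[OF a b] show ?thesis using sums_unique2 by fastforce
  qed
  \<comment> \<open>At \<open>a = b = 0\<close> the transform is the total mass 1, which determines
    the weight at level 0 as \<open>1 - w0 p\<close>.\<close>
  have "of_real (\<integral>\<omega>. sup_weight 0 0 \<omega> \<partial>M) / (1 - of_real (w0 p)) = (1::complex)"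
    using *[of 0 0] by (simp add: prob_space)
  then have "of_real (\<integral>\<omega>. sup_weight 0 0 \<omega> \<partial>M) = (1 - of_real (w0 p) :: complex)"
    using w0_bounds(2)[OF p] by (simp add: field_simps)
  with *[OF \<alpha> \<beta>] show ?thesis by simp
qed

text \<open>At \<open>w = w0 (p + a)\<close> the first factor vanishes, so the constant term of the
  affine right-hand side is its slope \<open>s\<close> times that root. The slope is the same for
  every \<open>a\<close>.\<close>

lemma inf_gf_closed_form:
  fixes w :: "'b::{real_normed_field,banach,second_countable_topology}"
  assumes \<alpha>: "\<alpha> \<ge> 0" and w: "norm w \<le> 1"
  shows "(of_real (p + \<alpha> + lam) * w - of_real lam * pgf step_pmf w)
      * (\<Sum>k. of_real (\<integral>\<omega>. inf_weight \<alpha> (- int k) \<omega> \<partial>M) * w ^ k)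
    = of_real (p / (1 - w0 p)) * (w - of_real (w0 (p + \<alpha>)))"
proof -
  define s where "s = p + lam * pmf step_pmf 0 * (\<integral>\<omega>. inf_weight 0 0 \<omega> \<partial>M)"
  have root: "lam * pmf step_pmf 0 * (\<integral>\<omega>. inf_weight a 0 \<omega> \<partial>M) = s * w0 (p + a)" if a: "a \<ge> 0" for a
  proof -
    have b: "0 < w0 (p + a)" "w0 (p + a) < 1" using w0_bounds[of "p + a"] p a by auto
    have "(p + a + lam) * w0 (p + a) - lam * pgf step_pmf (w0 (p + a)) = 0"
      using w0_root[of "p + a"] p a lam_pos by (simp add: field_simps)
    then show ?thesis using inf_gf_equation[OF a, of "w0 (p + a)"] b by (simp add: s_def)
  qed
  \<comment> \<open>For \<open>a = 0\<close> the constant term is \<open>s * w0 p\<close> and also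
    occurs inside the definition of \<open>s\<close>, which yields an equation for
    \<open>s\<close>.\<close>
  have "p = s - s * w0 p"
    using root[of 0] s_def by simp
  then have s: "s = p / (1 - w0 p)"
    using w0_bounds(2)[OF p] by (simp add: field_simps)
  show ?thesis
    unfolding inf_gf_equation[OF \<alpha> w] root[OF \<alpha>] s_def[symmetric] unfolding s
    by (simp add: right_diff_distrib)
qed

text \<open>The equation for the generating function carries a common factor
  \<open>exp (- \<beta> h)\<close>, which is cancelled. Without division the identity remains valid
  where the exponent equals \<open>p + \<alpha>\<close>.\<close>

lemma inf_transform_product:
  fixes \<beta> :: complex
  assumes \<alpha>: "\<alpha> \<ge> 0" and \<beta>: "Re \<beta> \<ge> 0"
  shows "(of_real (p + \<alpha>) - laplace_exponent \<nu> \<beta>) *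
      (\<integral>\<omega>. exp (- of_real (\<alpha> * last_inf_time X (e \<omega>) \<omega>) + \<beta> * of_real (running_inf X (e \<omega>) \<omega>)) \<partial>M)
    = of_real (p / (1 - w0 p)) * (1 - exp ((\<beta> - of_real (Phi \<nu> (p + \<alpha>))) * of_real h))"
proof -
  let ?w = "exp (- (\<beta> * of_real h))"
  let ?I = "\<integral>\<omega>. exp (- of_real (\<alpha> * last_inf_time X (e \<omega>) \<omega>) + \<beta> * of_real (running_inf X (e \<omega>) \<omega>)) \<partial>M"
  have w: "norm ?w \<le> 1" using \<beta> h_pos by simp
  have I: "(\<Sum>k. of_real (\<integral>\<omega>. inf_weight \<alpha> (- int k) \<omega> \<partial>M) * ?w ^ k) = ?I"
    using inf_transform[OF \<alpha> \<beta>] by (simp add: sums_iff)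
  have "?w * ((of_real (p + \<alpha>) - laplace_exponent \<nu> \<beta>) * ?I) = (of_real (p + \<alpha> + lam) * ?w - of_real lam * pgf step_pmf ?w) * ?I"
    using exponent_pgf[OF w, of "p + \<alpha>"] by (simp only: mult.assoc[symmetric])
  also have "\<dots> = of_real (p / (1 - w0 p)) * (?w - of_real (w0 (p + \<alpha>)))"
    using inf_gf_closed_form[OF \<alpha> w] by (simp only: I)
  also have "\<dots> = ?w * (of_real (p / (1 - w0 p)) * (1 - exp ((\<beta> - of_real (Phi \<nu> (p + \<alpha>))) * of_real h)))"
  proof -
    have "of_real (w0 (p + \<alpha>)) = ?w * exp ((\<beta> - of_real (Phi \<nu> (p + \<alpha>))) * of_real h)"
      by (simp add: w0_def algebra_simps flip: exp_add exp_of_real)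
    then show ?thesis by (simp add: algebra_simps)
  qed
  finally show ?thesis by (rule iffD1[OF mult_left_cancel[OF exp_not_eq_zero]])
qed

lemma inf_transform_root:
  assumes \<alpha>: "\<alpha> \<ge> 0"
  defines "b \<equiv> Phi \<nu> (p + \<alpha>)"
  shows "(\<integral>\<omega>. exp (- of_real (\<alpha> * last_inf_time X (e \<omega>) \<omega>) + complex_of_real b * of_real (running_inf X (e \<omega>) \<omega>)) \<partial>M)
    = of_real (p * h / (deriv psi b * (1 - w0 p)))"
proof -
  have r: "p + \<alpha> > 0" using p \<alpha> by simp
  define u where "u k = (\<integral>\<omega>. inf_weight \<alpha> (- int k) \<omega> \<partial>M)" for k
  define g where "g x = (\<Sum>k. u k * exp (- (x * h)) ^ k)" for x
  have su: "summable u" unfolding u_def using inf_weight_summable[OF \<alpha>] .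
  have "b > 0" using Phi_pos[OF r] by (simp add: b_def)
  \<comment> \<open>As \<open>b > 0\<close>, the point lies strictly inside the disc, where a power
    series with summable coefficients is continuous.\<close>
  have "isCont (\<lambda>w. \<Sum>k. u k * w ^ k) (exp (- (b * h)))"
    by (rule isCont_powser[where K=1]) (use su \<open>b > 0\<close> h_pos in auto)
  then have "isCont g b"
    unfolding g_def by (rule isCont_o2[rotated]) (intro continuous_intros)
  have eq: "(p + \<alpha> - psi x) * g x = (1 - exp ((x - b) * h)) * (p / (1 - w0 p))" if "x > 0" for x
  proof -
    let ?w = "exp (- (x * h))"
    have w: "norm ?w \<le> 1" using that h_pos by simp
    have "?w * ((p + \<alpha> - psi x) * g x) = p / (1 - w0 p) * (?w - w0 (p + \<alpha>))"
      using exponent_pgf[of x "p + \<alpha>"] inf_gf_closed_form[OF \<alpha> w] w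
      by (simp add: g_def u_def mult.assoc[symmetric])
    also have "w0 (p + \<alpha>) = ?w * exp ((x - b) * h)"
      by (simp add: w0_def b_def algebra_simps flip: exp_add)
    finally have "?w * ((p + \<alpha> - psi x) * g x) = ?w * ((1 - exp ((x - b) * h)) * (p / (1 - w0 p)))"
      by (simp add: algebra_simps)
    then show ?thesis by (rule iffD1[OF mult_left_cancel[OF exp_not_eq_zero]])
  qed
  have "deriv psi b * g b = h * (p / (1 - w0 p))"
    unfolding b_def by (rule quotient_at_root[OF r]) (use \<open>isCont g b\<close> eq in \<open>auto simp: b_def\<close>)
  then have gb: "g b = p * h / (deriv psi b * (1 - w0 p))"
    using DERIV_psi_Phi(2)[OF r] nonzero_eq_divide_eq[of "deriv psi b" "g b" "h * (p / (1 - w0 p))"]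
    by (simp add: b_def mult.commute)
  have 1: "(\<lambda>k. of_real (u k * exp (- (b * h)) ^ k)) sums
      (\<integral>\<omega>. exp (- of_real (\<alpha> * last_inf_time X (e \<omega>) \<omega>) + complex_of_real b * of_real (running_inf X (e \<omega>) \<omega>)) \<partial>M)"
  proof -
    have "exp (- (complex_of_real b * of_real h)) = of_real (exp (- (b * h)))"
      by (simp flip: exp_of_real)
    then show ?thesis
      using inf_transform[OF \<alpha>, of "complex_of_real b"] \<open>b > 0\<close> by (simp add: u_def)
  qed
  have "(\<lambda>k. u k * exp (- (b * h)) ^ k) sums g b"
    unfolding g_def
    by (rule summable_sums, rule summable_comparison_test'[OF su])
       (use inf_weight_bounds(1)[OF \<alpha>] \<open>b > 0\<close> h_pos in \<open>auto simp: u_def abs_mult intro!: mult_left_le power_le_one\<close>)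
  then have "(\<lambda>k. complex_of_real (u k * exp (- (b * h)) ^ k)) sums of_real (g b)"
    by (rule sums_of_real)
  from sums_unique2[OF 1 this] show ?thesis unfolding gb .
qed

end

end

section \<open>The functions determining the Wiener--Hopf factors\<close>

text \<open>Exchanges the sum over the number of jumps with the expansion in \<open>w\<close>, as
  Fubini for counting measure. The rows of \<open>a\<close> are sub-probability masses, so the
  double series is dominated by the sum of \<open>r\<close>.\<close>

lemma powser_swap:
  fixes w :: complex and r :: "nat \<Rightarrow> real" and a :: "nat \<Rightarrow> nat \<Rightarrow> real"
  assumes r: "\<And>n. 0 \<le> r n" "summable r"
    and a: "\<And>n k. 0 \<le> a n k" "\<And>n. summable (a n)" "\<And>n. suminf (a n) \<le> 1"
    and w: "norm w \<le> 1"
  shows "summable (\<lambda>k. \<Sum>n. r n * a n k)" (is ?A)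
    and "(\<lambda>n. of_real (r n) * (\<Sum>k. of_real (a n k) * w ^ k))
           sums (\<Sum>k. of_real (\<Sum>n. r n * a n k) * w ^ k)" (is ?B)
proof -
  have a1: "a n k \<le> 1" for n k
  proof -
    have "a n k = (\<Sum>i\<in>{k}. a n i)" by simp
    also have "\<dots> \<le> suminf (a n)" by (rule sum_le_suminf[OF a(2)]) (use a(1) in auto)
    finally show ?thesis using a(3)[of n] by simp
  qed
  have ra: "summable (\<lambda>n. r n * a n k)" for k
    by (rule summable_comparison_test'[OF r(2)]) (use r a a1 in \<open>auto simp: abs_mult intro!: mult_left_le\<close>)
  have main: "(summable (\<lambda>k. norm (of_real (\<Sum>n. r n * a n k) * v ^ k))) \<and>
     (\<lambda>n. of_real (r n) * (\<Sum>k. of_real (a n k) * v ^ k)) sums (\<Sum>k. of_real (\<Sum>n. r n * a n k) * v ^ k)"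
    if v: "norm v \<le> 1" for v :: complex
  proof -
    define f where "f n k = of_real (r n) * (of_real (a n k) * v ^ k)" for n k
    have fb: "norm (f n k) \<le> r n * a n k" for n k
      using r(1)[of n] a(1)[of n k] v
      by (auto simp: f_def norm_mult norm_power mult.assoc[symmetric] intro!: mult_left_le power_le_one)
    have fs: "summable (\<lambda>k. norm (f n k))" for n
      by (rule summable_comparison_test'[OF summable_mult[OF a(2)[of n], of "r n"]]) (use fb in simp)
    have f1: "integrable (count_space UNIV) (f n)" for n
      unfolding integrable_count_space_nat_iff by (rule fs)
    have fe: "(\<integral>k. f n k \<partial>count_space UNIV) = of_real (r n) * (\<Sum>k. of_real (a n k) * v ^ k)" for n
    proof -
      have sa: "summable (\<lambda>k. of_real (a n k) * v ^ k)"
        by (rule summable_comparison_test'[OF a(2)[of n]])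
          (use a(1) v in \<open>auto simp: norm_mult norm_power intro!: mult_left_le power_le_one\<close>)
      have "(\<integral>k. f n k \<partial>count_space UNIV) = (\<Sum>k. f n k)"
        using sums_integral_count_space_nat[OF f1] by (simp add: sums_iff)
      also have "\<dots> = of_real (r n) * (\<Sum>k. of_real (a n k) * v ^ k)"
        unfolding f_def by (rule suminf_mult[OF sa])
      finally show ?thesis .
    qed
    have summ: "summable (\<lambda>n. norm (f n k))" for k
      by (rule summable_comparison_test'[OF ra[of k]]) (use fb in simp)
    have "summable (\<lambda>n. \<integral>k. norm (f n k) \<partial>count_space UNIV)"
    proof (rule summable_comparison_test'[OF r(2)])
      fix n
      have "(\<lambda>k. norm (f n k)) sums (\<integral>k. norm (f n k) \<partial>count_space UNIV)"
        by (rule sums_integral_count_space_nat) (use f1 in simp)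
      then have "(\<integral>k. norm (f n k) \<partial>count_space UNIV) = (\<Sum>k. norm (f n k))" by (simp add: sums_iff)
      also have "\<dots> \<le> (\<Sum>k. r n * a n k)"
        by (rule suminf_le[OF fb fs]) (rule summable_mult[OF a(2)])
      also have "\<dots> = r n * suminf (a n)" by (rule suminf_mult[OF a(2)])
      also have "\<dots> \<le> r n" using r(1) a(3) by (intro mult_left_le) auto
      finally show "norm (\<integral>k. norm (f n k) \<partial>count_space UNIV) \<le> r n" by simp
    qed
    note F = f1 AE_I2[where M="count_space UNIV", OF summ] this
    have fk: "(\<Sum>n. f n k) = of_real (\<Sum>n. r n * a n k) * v ^ k" for k
    proof -
      have "(\<lambda>n. of_real (r n * a n k) * v ^ k) sums (of_real (\<Sum>n. r n * a n k) * v ^ k)"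
        by (intro sums_mult2 sums_of_real summable_sums ra)
      then show ?thesis by (simp add: f_def mult.assoc sums_iff)
    qed
    have I: "integrable (count_space UNIV) (\<lambda>k. \<Sum>n. f n k)" by (rule integrable_suminf[OF F])
    have "(\<lambda>n. \<integral>k. f n k \<partial>count_space UNIV) sums (\<integral>k. (\<Sum>n. f n k) \<partial>count_space UNIV)"
      by (rule sums_integral[OF F])
    also have "(\<integral>k. (\<Sum>n. f n k) \<partial>count_space UNIV) = (\<Sum>k. of_real (\<Sum>n. r n * a n k) * v ^ k)"
      using sums_integral_count_space_nat[OF I] by (simp add: fk sums_iff)
    finally show ?thesis using I by (simp add: fe fk integrable_count_space_nat_iff)
  qed
  have nonneg: "0 \<le> (\<Sum>n. r n * a n k)" for k
    by (rule suminf_nonneg[OF ra]) (use r a in auto)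
  \<comment> \<open>At the point 1 the norms are the nonnegative coefficients themselves.\<close>
  show ?A using main[of 1] nonneg by simp
  show ?B using main[OF w] by simp
qed

lemma log_series:
  fixes z :: complex
  assumes "norm z < 1"
  shows "(\<lambda>n. z ^ Suc n / of_nat (Suc n)) sums (- Ln (1 - z))"
proof -
  have "(\<lambda>n. (-1) ^ Suc n / of_nat n * (- z) ^ n) sums Ln (1 + - z)"
    by (rule Ln_series) (use assms in simp)
  then have "(\<lambda>n. - ((-1) ^ Suc n / of_nat n * (- z) ^ n)) sums (- Ln (1 - z))"
    by (intro sums_minus) simp
  moreover have "(-1) ^ n * (- z) ^ n = z ^ n" for n
    by (simp flip: power_mult_distrib)
  ultimately have "(\<lambda>n. z ^ n / of_nat n) sums (- Ln (1 - z))" by simp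
  then show ?thesis by (subst sums_Suc_iff) simp
qed

text \<open>For positive times the Erlang density is \<open>l\<close> times a Poisson
  probability.\<close>

lemma erlang_density_le:
  assumes "0 < l"
  shows "erlang_density n l t \<le> l"
proof (cases "t > 0")
  case True
  then have "pmf (poisson_pmf (l * t)) n \<le> 1" by (intro pmf_le_1)
  then have "l * ((l * t) ^ n / fact n * exp (- (l * t))) \<le> l * 1"
    using assms True by (intro mult_left_mono) auto
  then show ?thesis using True by (simp add: erlang_density_def power_mult_distrib mult_ac)
next
  case False
  then show ?thesis using assms by (cases "t = 0"; cases n) (auto simp: erlang_density_def)
qed

lemma has_bochner_integral_erlang_density:
  assumes l: "0 < l"
  shows "has_bochner_integral lborel (erlang_density n l) 1"
  using nn_integral_erlang_ith_moment[OF l, of n 0] l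
  by (intro has_bochner_integral_nn_integral) auto

text \<open>Every Erlang density has integral 1, so integrating such a series over time just adds up
  its coefficients. This is how the integrals in the kappa functions become series.\<close>

lemma erlang_series:
  fixes c :: "nat \<Rightarrow> complex"
  assumes l: "0 < l" and c: "summable (\<lambda>n. norm (c n))"
  shows "has_bochner_integral lborel (\<lambda>t. \<Sum>n. c n * of_real (erlang_density n l t)) (\<Sum>n. c n)"
    and "summable (\<lambda>n. c n * of_real (erlang_density n l t))"
proof -
  have b: "norm (c n * of_real (erlang_density n l t)) \<le> l * norm (c n)" for n t
    using mult_left_mono[OF erlang_density_le[OF l, of n t], of "norm (c n)"] l
    by (simp add: norm_mult mult.commute)
  have s: "summable (\<lambda>n. norm (c n * of_real (erlang_density n l t)))" for t
    by (rule summable_comparison_test'[OF summable_mult[OF c, of l]]) (use b[of _ t] in simp)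
  then show "summable (\<lambda>n. c n * of_real (erlang_density n l t))" by (rule summable_norm_cancel)
  have I: "integrable lborel (erlang_density n l)" "(\<integral>t. erlang_density n l t \<partial>lborel) = 1" for n
    using has_bochner_integral_erlang_density[OF l, of n] by (auto simp: has_bochner_integral_iff)
  have F1: "integrable lborel (\<lambda>t. c n * of_real (erlang_density n l t))" for n
    using I(1)[of n] by simp
  have "(\<integral>t. norm (c n * of_real (erlang_density n l t)) \<partial>lborel) = norm (c n)" for n
    using I(2)[of n] l by (simp add: norm_mult)
  with c have F3: "summable (\<lambda>n. \<integral>t. norm (c n * of_real (erlang_density n l t)) \<partial>lborel)" by simp
  note F = F1 AE_I2[where M=lborel, OF s] F3
  have "(\<lambda>n. \<integral>t. c n * of_real (erlang_density n l t) \<partial>lborel) sums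
      (\<integral>t. (\<Sum>n. c n * of_real (erlang_density n l t)) \<partial>lborel)"
    by (rule sums_integral[OF F])
  then have "(\<integral>t. (\<Sum>n. c n * of_real (erlang_density n l t)) \<partial>lborel) = (\<Sum>n. c n)"
    using I(2) by (simp add: sums_iff)
  with integrable_suminf[OF F] show
    "has_bochner_integral lborel (\<lambda>t. \<Sum>n. c n * of_real (erlang_density n l t)) (\<Sum>n. c n)"
    by (simp add: has_bochner_integral_iff)
qed

text \<open>The integral over \<open>t\<close> of \<open>exp (- \<alpha> t) / t\<close> times the
  Poisson probability of \<open>n \<ge> 1\<close> jumps at rate \<open>c\<close> is
  \<open>\<rho> ^ n / n\<close> with \<open>\<rho> = c / (c + \<alpha>)\<close>; \<open>Y n\<close>
  is the spatial transform after \<open>n\<close> jumps.\<close>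

definition levy_series :: "real \<Rightarrow> (nat \<Rightarrow> complex) \<Rightarrow> complex" where
  "levy_series \<rho> Y = (\<Sum>n. of_real (\<rho> ^ Suc n / real (Suc n)) * Y (Suc n))"

lemma levy_coeff:
  assumes "0 \<le> \<rho>" "\<rho> < (1::real)"
  shows "summable (\<lambda>n. \<rho> ^ Suc n / real (Suc n))"
proof (rule summable_comparison_test')
  show "summable (\<lambda>n. \<rho> ^ n)" using assms by (intro summable_geometric) auto
  show "norm (\<rho> ^ Suc n / real (Suc n)) \<le> \<rho> ^ n" for n
  proof -
    have "\<rho> ^ Suc n / real (Suc n) \<le> \<rho> ^ Suc n / 1" using assms by (intro divide_left_mono) auto
    also have "\<dots> \<le> \<rho> ^ n" using assms by (simp add: mult_left_le_one_le)
    finally show ?thesis using assms by simp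
  qed
qed

lemma summable_levy_series:
  fixes Y :: "nat \<Rightarrow> complex"
  assumes "0 \<le> \<rho>" "\<rho> < 1" "\<And>n. norm (Y n) \<le> 1"
  shows "summable (\<lambda>n. norm (of_real (\<rho> ^ Suc n / real (Suc n)) * Y (Suc n)))"
proof (rule summable_comparison_test'[OF levy_coeff[OF assms(1,2)]])
  fix n
  have "norm (of_real (\<rho> ^ Suc n / real (Suc n)) * Y (Suc n)) = \<rho> ^ Suc n / real (Suc n) * norm (Y (Suc n))"
    using assms by (simp only: norm_mult norm_of_real) (simp del: of_nat_Suc power_Suc)
  also have "\<dots> \<le> \<rho> ^ Suc n / real (Suc n)" using assms by (intro mult_left_le) auto
  finally show "norm (norm (of_real (\<rho> ^ Suc n / real (Suc n)) * Y (Suc n))) \<le> \<rho> ^ Suc n / real (Suc n)"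
    by simp
qed

text \<open>
  Expanding both exponentials around the rate \<open>max 1 \<alpha> + c\<close> reduces the Frullani integral of
  the zeroth term to Gamma integrals.
\<close>

lemma levy_integral:
  fixes P V :: "nat \<Rightarrow> complex" and inner :: "real \<Rightarrow> complex"
  assumes c: "c > 0" and \<alpha>: "\<alpha> > 0"
    and PV: "\<And>n. norm (P n) \<le> 1" "\<And>n. norm (V n) \<le> 1" "P 0 = of_bool b" "V 0 = of_bool b"
    and inner: "\<And>t. t > 0 \<Longrightarrow> (\<lambda>n. ((c * t) ^ n / fact n * exp (- (c * t))) *\<^sub>R
       ((exp (- of_real t) * P n - exp (- of_real (\<alpha> * t)) * V n) * (1 / of_real t))) sums inner t"
  shows "exp (LINT t:{0<..}|lborel. inner t)
    = (if b then of_real ((c + \<alpha>) / (c + 1)) else 1) * exp (levy_series (c / (c + 1)) P) * exp (- levy_series (c / (c + \<alpha>)) V)"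
proof -
  \<comment> \<open>The larger of the rates \<open>c + 1\<close> and \<open>c + \<alpha>\<close>, so
    that \<open>x\<close> and \<open>y\<close> both fall into \<open>[0, 1)\<close>.\<close>
  define l where "l = c + max 1 \<alpha>"
  define x where "x = (l - c - 1) / l"
  define y where "y = (l - c - \<alpha>) / l"
  have l: "l > 0" using c by (simp add: l_def)
  have xy: "0 \<le> x" "x < 1" "0 \<le> y" "y < 1" using c \<alpha> by (auto simp: x_def y_def l_def divide_simps max_def)
  define d where "d n = complex_of_real (x ^ Suc n / real (Suc n)) - of_real (y ^ Suc n / real (Suc n))" for n
  define c1 where "c1 n = of_real ((c / (c + 1)) ^ Suc n / real (Suc n)) * P (Suc n)" for n
  define c2 where "c2 n = of_real ((c / (c + \<alpha>)) ^ Suc n / real (Suc n)) * V (Suc n)" for n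
  have sd: "summable (\<lambda>n. norm (d n))"
  proof (rule summable_comparison_test'[OF summable_add[OF levy_coeff[OF xy(1,2)] levy_coeff[OF xy(3,4)]]])
    fix n
    have "norm (d n) \<le> norm (complex_of_real (x ^ Suc n / real (Suc n))) + norm (complex_of_real (y ^ Suc n / real (Suc n)))"
      unfolding d_def by (rule norm_triangle_ineq4)
    then show "norm (norm (d n)) \<le> x ^ Suc n / real (Suc n) + y ^ Suc n / real (Suc n)"
      using xy by (simp only: norm_of_real) (simp del: power_Suc of_nat_Suc)
  qed
  have \<rho>: "0 \<le> c / (c + 1)" "c / (c + 1) < 1" "0 \<le> c / (c + \<alpha>)" "c / (c + \<alpha>) < 1" using c \<alpha> by auto
  have s1: "summable (\<lambda>n. norm (c1 n))" unfolding c1_def by (rule summable_levy_series) (use \<rho> PV in auto)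
  have s2: "summable (\<lambda>n. norm (c2 n))" unfolding c2_def by (rule summable_levy_series) (use \<rho> PV in auto)
  have pos: "c + 1 > 0" "c + \<alpha> > 0" using c \<alpha> by auto
  define E where "E l c t = (\<Sum>n. c n * complex_of_real (erlang_density n l t))" for l c t
  \<comment> \<open>\<open>b\<close> records whether displacement 0 belongs to the half-line
    considered; only then does the term without jumps contribute.\<close>
  define G where "G t = of_bool b * E l d t + E (c + 1) c1 t - E (c + \<alpha>) c2 t" for t
  have G: "has_bochner_integral lborel G (of_bool b * (\<Sum>n. d n) + (\<Sum>n. c1 n) - (\<Sum>n. c2 n))"
    unfolding G_def E_def
    by (intro has_bochner_integral_diff has_bochner_integral_add has_bochner_integral_mult_right
          erlang_series(1) l pos sd s1 s2)
  have inner_eq: "inner t = G t" if t: "t > 0" for t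
  proof -
    have er: "erlang_density n (c + a) t * ((c / (c + a)) ^ Suc n / real (Suc n))
        = (c * t) ^ Suc n / fact (Suc n) * exp (- (c * t)) * exp (- (a * t)) / t" if "a > 0" for a n
    proof -
      have "(c + a) ^ Suc n * (c / (c + a)) ^ Suc n = c ^ Suc n"
        using c that by (simp add: power_divide)
      moreover have "exp (- ((c + a) * t)) = exp (- (c * t)) * exp (- (a * t))"
        by (simp add: algebra_simps flip: exp_add)
      moreover have "erlang_density n L t * ((c / L) ^ Suc n / real (Suc n))
          = (L ^ Suc n * (c / L) ^ Suc n) * (t ^ n * exp (- (L * t))) / (fact n * real (Suc n))" for L
        using t by (simp add: erlang_density_def del: power_Suc of_nat_Suc)
      ultimately have "erlang_density n (c + a) t * ((c / (c + a)) ^ Suc n / real (Suc n))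
          = c ^ Suc n * (t ^ n * (exp (- (c * t)) * exp (- (a * t)))) / (fact n * real (Suc n))"
        by (simp only:)
      also have "\<dots> = (c * t) ^ Suc n / fact (Suc n) * exp (- (c * t)) * exp (- (a * t)) / t"
        using t by (simp add: power_mult_distrib divide_simps del: of_nat_Suc)
      finally show ?thesis .
    qed
    have "(\<lambda>n. c1 n * of_real (erlang_density n (c + 1) t) - c2 n * of_real (erlang_density n (c + \<alpha>) t))
        sums (E (c + 1) c1 t - E (c + \<alpha>) c2 t)"
      unfolding E_def by (intro sums_diff summable_sums erlang_series(2) pos s1 s2)
    moreover have "c1 n * of_real (erlang_density n (c + 1) t) - c2 n * of_real (erlang_density n (c + \<alpha>) t)
        = ((c * t) ^ Suc n / fact (Suc n) * exp (- (c * t))) *\<^sub>R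
       ((exp (- of_real t) * P (Suc n) - exp (- of_real (\<alpha> * t)) * V (Suc n)) * (1 / of_real t))" for n
    proof -
      have "c1 n * of_real (erlang_density n (c + 1) t) - c2 n * of_real (erlang_density n (c + \<alpha>) t)
        = of_real (erlang_density n (c + 1) t * ((c / (c + 1)) ^ Suc n / real (Suc n))) * P (Suc n)
          - of_real (erlang_density n (c + \<alpha>) t * ((c / (c + \<alpha>)) ^ Suc n / real (Suc n))) * V (Suc n)"
        by (simp only: c1_def c2_def of_real_mult mult_ac)
      also have "\<dots> = ((c * t) ^ Suc n / fact (Suc n) * exp (- (c * t))) *\<^sub>R
       ((of_real (exp (- t)) * P (Suc n) - of_real (exp (- (\<alpha> * t))) * V (Suc n)) * (1 / of_real t))"
        using t unfolding er[OF zero_less_one] er[OF \<alpha>]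
        by (simp add: scaleR_conv_of_real field_simps del: power_Suc fact_Suc)
      finally show ?thesis by (simp flip: exp_of_real)
    qed
    ultimately have "(\<lambda>n. ((c * t) ^ Suc n / fact (Suc n) * exp (- (c * t))) *\<^sub>R
       ((exp (- of_real t) * P (Suc n) - exp (- of_real (\<alpha> * t)) * V (Suc n)) * (1 / of_real t)))
        sums (E (c + 1) c1 t - E (c + \<alpha>) c2 t)" by simp
    then have "inner t = E (c + 1) c1 t - E (c + \<alpha>) c2 t +
        ((c * t) ^ 0 / fact 0 * exp (- (c * t))) *\<^sub>R
       ((exp (- of_real t) * P 0 - exp (- of_real (\<alpha> * t)) * V 0) * (1 / of_real t))"
      using inner[OF t] sums_unique2 by (subst (asm) sums_Suc_iff) blast
    also have "((c * t) ^ 0 / fact 0 * exp (- (c * t))) *\<^sub>R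
       ((exp (- of_real t) * P 0 - exp (- of_real (\<alpha> * t)) * V 0) * (1 / of_real t)) = of_bool b * E l d t"
    proof (cases b)
      case True
      have ex: "(\<lambda>n. (exp (- (l * t)) / t) * (z ^ Suc n / fact (Suc n))) sums ((exp (- (l * t)) / t) * (exp z - 1))" for z :: real
      proof -
        have "(\<lambda>n. z ^ n / fact n) sums exp z" using exp_converges[of z] by (simp add: divide_inverse mult.commute)
        then have "(\<lambda>n. z ^ Suc n / fact (Suc n)) sums (exp z - 1)" by (subst sums_Suc_iff) simp
        then show ?thesis by (rule sums_mult)
      qed
      have er0: "(u / l) ^ Suc n / real (Suc n) * erlang_density n l t = (exp (- (l * t)) / t) * ((u * t) ^ Suc n / fact (Suc n))" for u n
      proof -
        have "l ^ Suc n * (u / l) ^ Suc n = u ^ Suc n" using l by (simp add: power_divide)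
        moreover have "(u / l) ^ Suc n / real (Suc n) * erlang_density n l t
            = (l ^ Suc n * (u / l) ^ Suc n) * (t ^ n * exp (- (l * t))) / (fact n * real (Suc n))"
          using t by (simp add: erlang_density_def mult_ac del: power_Suc of_nat_Suc)
        ultimately have "(u / l) ^ Suc n / real (Suc n) * erlang_density n l t
            = u ^ Suc n * (t ^ n * exp (- (l * t))) / (fact n * real (Suc n))"
          by (simp only:)
        also have "\<dots> = (exp (- (l * t)) / t) * ((u * t) ^ Suc n / fact (Suc n))"
          using t by (simp add: power_mult_distrib divide_simps del: of_nat_Suc)
        finally show ?thesis .
      qed
      define u where "u = l - c - 1"
      define v where "v = l - c - \<alpha>"
      have "(\<lambda>n. complex_of_real ((exp (- (l * t)) / t) * ((u * t) ^ Suc n / fact (Suc n)) - (exp (- (l * t)) / t) * ((v * t) ^ Suc n / fact (Suc n))))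
        sums of_real ((exp (- (l * t)) / t) * (exp (u * t) - 1) - (exp (- (l * t)) / t) * (exp (v * t) - 1))"
        by (intro sums_of_real sums_diff ex)
      moreover have "complex_of_real ((exp (- (l * t)) / t) * ((u * t) ^ Suc n / fact (Suc n)) - (exp (- (l * t)) / t) * ((v * t) ^ Suc n / fact (Suc n)))
         = d n * of_real (erlang_density n l t)" for n
        unfolding er0[symmetric] d_def x_def y_def u_def v_def by (simp only: of_real_diff of_real_mult left_diff_distrib)
      ultimately have "E l d t = of_real ((exp (- (l * t)) / t) * (exp (u * t) - 1) - (exp (- (l * t)) / t) * (exp (v * t) - 1))"
        by (simp add: E_def sums_iff)
      also have "(exp (- (l * t)) / t) * (exp (u * t) - 1) - (exp (- (l * t)) / t) * (exp (v * t) - 1)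
        = exp (- (c * t)) * (exp (- t) - exp (- (\<alpha> * t))) / t"
      proof -
        have "exp (- (l * t)) * exp (u * t) = exp (- (c * t)) * exp (- t)"
          "exp (- (l * t)) * exp (v * t) = exp (- (c * t)) * exp (- (\<alpha> * t))"
          by (simp_all add: u_def v_def algebra_simps flip: exp_add)
        then show ?thesis using t by (simp add: algebra_simps diff_divide_distrib)
      qed
      finally have "E l d t = of_real (exp (- (c * t)) * (exp (- t) - exp (- (\<alpha> * t))) / t)" .
      moreover have "exp (- complex_of_real t) = of_real (exp (- t))"
        "exp (- complex_of_real (\<alpha> * t)) = of_real (exp (- (\<alpha> * t)))"
        by (simp_all flip: exp_of_real)
      ultimately show ?thesis
        using True by (simp only: PV) (simp add: scaleR_conv_of_real)
    qed (simp add: PV)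
    finally show ?thesis by (simp add: G_def)
  qed
  have "(LINT t:{0<..}|lborel. inner t) = (\<integral>t. G t \<partial>lborel)"
    unfolding set_lebesgue_integral_def
  proof (rule integral_cong_AE)
    \<comment> \<open>Erlang densities vanish at negative times, but the one of index 0 does not
      vanish at time 0; that point is absorbed by a null set.\<close>
    have G0: "G t = 0" if "t < 0" for t using that by (simp add: G_def E_def erlang_density_def)
    have "AE t in lborel. t \<noteq> (0::real)" by (rule AE_lborel_singleton)
    then show ae: "AE t in lborel. indicator {0<..} t *\<^sub>R inner t = G t"
      by eventually_elim (use inner_eq G0 in \<open>auto simp: indicator_def not_less le_less\<close>)
    have "integrable lborel G" using G by (simp add: has_bochner_integral_iff)
    then show mG: "G \<in> borel_measurable lborel" by (rule borel_measurable_integrable)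
    have "(\<lambda>t. indicator {0<..} t *\<^sub>R inner t) = (\<lambda>t. indicator {0<..} t *\<^sub>R G t)"
      using inner_eq by (auto simp: fun_eq_iff indicator_def)
    then show "(\<lambda>t. indicator {0<..} t *\<^sub>R inner t) \<in> borel_measurable lborel"
      using mG by simp
  qed
  also have "\<dots> = of_bool b * (\<Sum>n. d n) + levy_series (c / (c + 1)) P - levy_series (c / (c + \<alpha>)) V"
    using G by (simp add: has_bochner_integral_iff levy_series_def c1_def c2_def)
  finally have "exp (LINT t:{0<..}|lborel. inner t)
    = exp (of_bool b * (\<Sum>n. d n)) * exp (levy_series (c / (c + 1)) P) * exp (- levy_series (c / (c + \<alpha>)) V)"
    by (simp add: exp_diff exp_add exp_minus divide_inverse)
  \<comment> \<open>The coefficients \<open>d\<close> sum to a difference of logarithms of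
    \<open>1 - y\<close> and \<open>1 - x\<close>, whose quotient no longer involves the auxiliary
    rate \<open>l\<close>.\<close>
  moreover have "exp (\<Sum>n. d n) = of_real ((c + \<alpha>) / (c + 1))"
  proof -
    have "(\<lambda>n. of_real x ^ Suc n / of_nat (Suc n) - of_real y ^ Suc n / of_nat (Suc n)) sums
        (- Ln (1 - of_real x) - - Ln (1 - of_real y))"
      by (intro sums_diff log_series) (use xy in auto)
    then have "(\<Sum>n. d n) = - Ln (1 - of_real x) - - Ln (1 - of_real y)"
      by (simp add: d_def sums_iff)
    moreover have "1 - complex_of_real x \<noteq> 0" "1 - complex_of_real y \<noteq> 0"
      using xy by (auto simp: complex_eq_iff)
    ultimately have "exp (\<Sum>n. d n) = of_real ((1 - y) / (1 - x))"
      by (simp add: exp_diff exp_minus divide_inverse exp_add mult.commute)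
    also have "(1 - y) / (1 - x) = (c + \<alpha>) / (c + 1)"
    proof -
      have "1 - x = (c + 1) / l" "1 - y = (c + \<alpha>) / l"
        using l by (simp_all add: x_def y_def field_simps)
      then show ?thesis using l by simp
    qed
    finally show ?thesis .
  qed
  ultimately show ?thesis by simp
qed

section \<open>The upward and downward series of the jump chain\<close>

context upwards_skip_free_levy_chain
begin

text \<open>Exponents count lattice steps away from 0 in either direction, so
  \<open>w = exp (- \<beta> h)\<close> represents \<open>exp (- \<beta> x)\<close> here and
  \<open>exp (\<beta> x)\<close> in \<open>down_part\<close>. Displacement 0 belongs to the downward
  part, as in the half-lines of the kappa functions.\<close>

definition up_part :: "nat \<Rightarrow> complex \<Rightarrow> complex" where
  "up_part n w = (\<integral>i. (if i < n then w ^ (n - i) else 0) \<partial>iid_sum step_pmf n)"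

definition down_part :: "nat \<Rightarrow> complex \<Rightarrow> complex" where
  "down_part n w = (\<integral>i. (if n \<le> i then w ^ (i - n) else 0) \<partial>iid_sum step_pmf n)"

lemma integrable_part:
  assumes "norm w \<le> 1"
  shows "integrable (measure_pmf P) (\<lambda>i. if i < n then w ^ (n - i) else (0::complex))"
    "integrable (measure_pmf P) (\<lambda>i. if n \<le> i then w ^ (i - n) else (0::complex))"
  using assms
  by (auto intro!: measure_pmf.integrable_const_bound[where B=1] simp: norm_power power_le_one)

lemma norm_part_le:
  assumes w: "norm w \<le> 1"
  shows "norm (up_part n w) \<le> 1" "norm (down_part n w) \<le> 1"
proof -
  have "norm (\<integral>i. f i \<partial>measure_pmf P) \<le> 1" if "integrable (measure_pmf P) f" "\<And>i. norm (f i) \<le> 1" for f :: "nat \<Rightarrow> complex" and P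
  proof -
    have "norm (\<integral>i. f i \<partial>measure_pmf P) \<le> (\<integral>i. 1 \<partial>measure_pmf P)"
      by (rule order.trans[OF integral_norm_bound integral_mono]) (use that in auto)
    then show ?thesis by simp
  qed
  from this[OF integrable_part(1)[OF w]] this[OF integrable_part(2)[OF w]]
  show "norm (up_part n w) \<le> 1" "norm (down_part n w) \<le> 1"
    unfolding up_part_def down_part_def using w by (auto simp: norm_power power_le_one)
qed

lemma part_0: "up_part 0 w = 0" "down_part 0 w = 1"
  by (simp_all add: up_part_def down_part_def)

text \<open>Inverting \<open>w\<close> aligns the upward powers with the downward ones; on the
  circle both arguments are admissible and the halves recombine to the full transform after
  \<open>n\<close> jumps.\<close>

lemma up_down_sum:
  assumes w: "norm w = 1"
  shows "up_part n (inverse w) + down_part n w = (pgf step_pmf w / w) ^ n"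
proof -
  have w0: "w \<noteq> 0" using w by auto
  have i: "norm (inverse w) \<le> 1" using w by (simp add: norm_inverse)
  have "up_part n (inverse w) + down_part n w
    = (\<integral>i. (if i < n then inverse w ^ (n - i) else 0) + (if n \<le> i then w ^ (i - n) else 0) \<partial>iid_sum step_pmf n)"
    unfolding up_part_def down_part_def
    by (rule Bochner_Integration.integral_add[symmetric]) (use integrable_part[OF i] integrable_part[of w] w in auto)
  also have "\<dots> = (\<integral>i. w ^ i / w ^ n \<partial>iid_sum step_pmf n)"
    by (intro Bochner_Integration.integral_cong refl)
       (use w0 in \<open>auto simp: power_diff divide_simps power_inverse simp flip: power_add\<close>)
  also have "\<dots> = pgf (iid_sum step_pmf n) w / w ^ n"
    using w by (simp add: pgf_eq_expectation)
  finally show ?thesis using w by (simp add: pgf_iid_sum power_divide)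
qed

text \<open>Treats both half-lines at once: \<open>A\<close> is the half-line and \<open>g\<close>
  its part of the transform. The summand \<open>exp (- t)\<close> has no spatial factor and
  therefore appears as \<open>g\<close> at 1.\<close>

lemma inner_integral_sums:
  fixes b w :: complex and g :: "nat \<Rightarrow> nat \<Rightarrow> complex \<Rightarrow> complex"
  assumes t: "t > 0" and A: "A \<in> sets borel"
    and bound: "\<And>k::int. h * of_int k \<in> A \<Longrightarrow> norm (exp (b * of_real (h * of_int k))) \<le> 1"
    and part: "\<And>n i. (if h * of_int (int n - int i) \<in> A then exp (b * of_real (h * of_int (int n - int i))) else 0) = g n i w"
      "\<And>n i. (if h * of_int (int n - int i) \<in> A then 1 else 0) = g n i 1"
    and g: "\<And>n v. norm v \<le> 1 \<Longrightarrow> integrable (measure_pmf (iid_sum step_pmf n)) (\<lambda>i. g n i v)"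
    and w: "norm w \<le> 1" and \<alpha>: "\<alpha> > 0"
  shows "(\<lambda>n. ((lam * t) ^ n / fact n * exp (- (lam * t))) *\<^sub>R
      ((exp (- of_real t) * (\<integral>i. g n i 1 \<partial>iid_sum step_pmf n)
        - exp (- of_real (\<alpha> * t)) * (\<integral>i. g n i w \<partial>iid_sum step_pmf n)) * (1 / of_real t)))
    sums (LINT x:A|distr M borel (X t). (exp (- of_real t) - exp (- of_real \<alpha> * of_real t + b * of_real x)) * (1 / of_real t))"
proof -
  define f where "f k = indicator A (h * of_int k) *\<^sub>R
     ((exp (- of_real t) - exp (- of_real \<alpha> * of_real t + b * of_real (h * of_int k))) * (1 / complex_of_real t))" for k :: int
  have "(\<lambda>x. (exp (- of_real t) - exp (- of_real \<alpha> * of_real t + b * of_real x)) * (1 / complex_of_real t))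
      \<in> borel_measurable borel"
    by (intro borel_measurable_continuous_onI continuous_intros) (use t in auto)
  from borel_measurable_scaleR[OF borel_measurable_indicator[OF A] this]
  have meas: "(\<lambda>x. indicator A x *\<^sub>R ((exp (- of_real t) - exp (- of_real \<alpha> * of_real t + b * of_real x)) * (1 / complex_of_real t)))
      \<in> borel_measurable borel" .
  have "(LINT x:A|distr M borel (X t). (exp (- of_real t) - exp (- of_real \<alpha> * of_real t + b * of_real x)) * (1 / of_real t))
     = (\<integral>k. f k \<partial>skip_free_pmf (lam * t) step_pmf)"
    unfolding set_lebesgue_integral_def distr_X[OF t] f_def by (rule integral_distr[OF _ meas]) simp
  \<comment> \<open>Time is fixed here, so \<open>1 / t\<close> is a constant; both exponentials
    have modulus at most 1 on the half-line.\<close>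
  moreover have "norm (f k) \<le> 2 / t" for k
  proof (cases "h * of_int k \<in> A")
    case True
    have "norm (exp (- of_real t :: complex)) \<le> 1" using t by simp
    moreover have "norm (exp (- of_real \<alpha> * of_real t + b * of_real (h * of_int k))) \<le> 1 * 1"
      unfolding exp_add norm_mult using bound[OF True] \<alpha> t by (intro mult_mono) auto
    ultimately have "norm (exp (- of_real t) - exp (- of_real \<alpha> * of_real t + b * of_real (h * of_int k))) \<le> 1 + 1"
      by (intro order.trans[OF norm_triangle_ineq4] add_mono) auto
    then show ?thesis using True t by (simp add: f_def norm_mult norm_divide divide_right_mono)
  qed (use t in \<open>simp add: f_def\<close>)
  then have "(\<lambda>n. ((lam * t) ^ n / fact n * exp (- (lam * t))) *\<^sub>R (\<integral>i. f (int n - int i) \<partial>iid_sum step_pmf n))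
      sums (\<integral>k. f k \<partial>skip_free_pmf (lam * t) step_pmf)"
    using lam_pos t by (intro skip_free_pmf_sums[where C="2 / t"]) auto
  moreover have "(\<integral>i. f (int n - int i) \<partial>iid_sum step_pmf n) =
     (exp (- of_real t) * (\<integral>i. g n i 1 \<partial>iid_sum step_pmf n)
        - exp (- of_real (\<alpha> * t)) * (\<integral>i. g n i w \<partial>iid_sum step_pmf n)) * (1 / of_real t)" for n
  proof -
    have e: "exp (- complex_of_real \<alpha> * of_real t + y) = exp (- of_real (\<alpha> * t)) * exp y" for y
      by (simp flip: exp_add)
    have "f (int n - int i) = (exp (- of_real t) * g n i 1 - exp (- of_real (\<alpha> * t)) * g n i w) * (1 / of_real t)" for i
      unfolding part[symmetric] f_def e
      by (cases "h * of_int (int n - int i) \<in> A") simp_all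
    then have "(\<integral>i. f (int n - int i) \<partial>iid_sum step_pmf n)
      = (\<integral>i. (exp (- of_real t) * g n i 1 - exp (- of_real (\<alpha> * t)) * g n i w) * (1 / of_real t) \<partial>iid_sum step_pmf n)"
      by simp
    also have "\<dots> = (exp (- of_real t) * (\<integral>i. g n i 1 \<partial>iid_sum step_pmf n)
        - exp (- of_real (\<alpha> * t)) * (\<integral>i. g n i w \<partial>iid_sum step_pmf n)) * (1 / of_real t)"
      by (simp only: integral_mult_left_zero integral_mult_right_zero
            Bochner_Integration.integral_diff[OF integrable_mult_right[OF g] integrable_mult_right[OF g]] w norm_one order_refl)
    finally show ?thesis .
  qed
  ultimately show ?thesis by simp
qed

lemma site_sign: "0 < h * of_int (int n - int i) \<longleftrightarrow> i < n" "h * of_int (int n - int i) \<le> 0 \<longleftrightarrow> n \<le> i"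
  using h_pos by (auto simp: zero_less_mult_iff mult_le_0_iff)

lemma kappa_star_eq_series:
  assumes \<alpha>: "\<alpha> > 0" and \<beta>: "Re \<beta> \<ge> 0"
  shows "kappa_star c M X (of_real \<alpha>) \<beta> = of_real c * exp (levy_series (lam / (lam + 1)) (\<lambda>n. up_part n 1))
     * exp (- levy_series (lam / (lam + \<alpha>)) (\<lambda>n. up_part n (exp (- (\<beta> * of_real h)))))"
proof -
  let ?w = "exp (- (\<beta> * of_real h))"
  have w: "norm ?w \<le> 1" using \<beta> h_pos by simp
  let ?inner = "\<lambda>t. LINT x:{0<..}|distr M borel (X t).
        (exp (- of_real t) - exp (- of_real \<alpha> * of_real t - \<beta> * of_real x)) * (1 / of_real t)"
  have "exp (LINT t:{0<..}|lborel. ?inner t) =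
     (if False then of_real ((lam + \<alpha>) / (lam + 1)) else 1) * exp (levy_series (lam / (lam + 1)) (\<lambda>n. up_part n 1))
     * exp (- levy_series (lam / (lam + \<alpha>)) (\<lambda>n. up_part n ?w))"
  proof (rule levy_integral[OF lam_pos \<alpha>])
    fix t :: real assume t: "t > 0"
    have pw: "exp (- \<beta> * of_real (h * of_int (int n - int i))) = ?w ^ (n - i)" if "i < n" for n i
      using that by (simp add: of_nat_diff mult_ac flip: exp_of_nat_mult)
    show "(\<lambda>n. ((lam * t) ^ n / fact n * exp (- (lam * t))) *\<^sub>R
      ((exp (- of_real t) * up_part n 1 - exp (- of_real (\<alpha> * t)) * up_part n ?w) * (1 / of_real t))) sums ?inner t"
    proof -
      have eq: "?inner t = (LINT x:{0<..}|distr M borel (X t).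
          (exp (- of_real t) - exp (- of_real \<alpha> * of_real t + - \<beta> * of_real x)) * (1 / of_real t))"
        by simp
      have bd: "norm (exp (- \<beta> * of_real (h * of_int k))) \<le> 1" if "h * of_int k \<in> {0<..}" for k :: int
        using that \<beta> h_pos by (simp add: zero_less_mult_iff)
      show ?thesis
        unfolding eq up_part_def
      proof (rule inner_integral_sums[where g="\<lambda>n i v. if i < n then v ^ (n - i) else 0", OF t _ bd _ _ _ w \<alpha>])
        show "(if h * of_int (int n - int i) \<in> {0<..} then exp (- \<beta> * of_real (h * of_int (int n - int i))) else 0)
            = (if i < n then ?w ^ (n - i) else 0)" for n i
          by (cases "i < n") (simp_all only: greaterThan_iff site_sign pw if_True if_False simp_thms)
        show "(if h * of_int (int n - int i) \<in> {0<..} then 1 else 0) = (if i < n then 1 ^ (n - i) else (0::complex))" for n i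
          by (simp only: greaterThan_iff site_sign power_one)
      qed (use integrable_part in auto)
    qed
  qed (use norm_part_le w in \<open>auto simp: part_0\<close>)
  then show ?thesis by (simp add: kappa_star_def mult.assoc)
qed

text \<open>The quotient \<open>(lam + \<alpha>) / (lam + 1)\<close> is the contribution of no
  jumps; it is absent from \<open>kappa_star\<close>, whose half-line omits 0.\<close>

lemma kappa_hat_eq_series:
  assumes \<alpha>: "\<alpha> > 0" and \<beta>: "Re \<beta> \<ge> 0"
  shows "kappa_hat c M X (of_real \<alpha>) \<beta> = of_real c * of_real ((lam + \<alpha>) / (lam + 1)) * exp (levy_series (lam / (lam + 1)) (\<lambda>n. down_part n 1))
     * exp (- levy_series (lam / (lam + \<alpha>)) (\<lambda>n. down_part n (exp (- (\<beta> * of_real h)))))"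
proof -
  let ?w = "exp (- (\<beta> * of_real h))"
  have w: "norm ?w \<le> 1" using \<beta> h_pos by simp
  let ?inner = "\<lambda>t. LINT x:{..0}|distr M borel (X t).
        (exp (- of_real t) - exp (- of_real \<alpha> * of_real t + \<beta> * of_real x)) * (1 / of_real t)"
  have "exp (LINT t:{0<..}|lborel. ?inner t) =
     (if True then of_real ((lam + \<alpha>) / (lam + 1)) else 1) * exp (levy_series (lam / (lam + 1)) (\<lambda>n. down_part n 1))
     * exp (- levy_series (lam / (lam + \<alpha>)) (\<lambda>n. down_part n ?w))"
  proof (rule levy_integral[OF lam_pos \<alpha>])
    fix t :: real assume t: "t > 0"
    have pw: "exp (\<beta> * of_real (h * of_int (int n - int i))) = ?w ^ (i - n)" if "n \<le> i" for n i
      using that by (simp add: of_nat_diff algebra_simps flip: exp_of_nat_mult)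
    have bd: "norm (exp (\<beta> * of_real (h * of_int k))) \<le> 1" if "h * of_int k \<in> {..0}" for k :: int
      using that \<beta> h_pos by (simp add: mult_nonneg_nonpos)
    show "(\<lambda>n. ((lam * t) ^ n / fact n * exp (- (lam * t))) *\<^sub>R
      ((exp (- of_real t) * down_part n 1 - exp (- of_real (\<alpha> * t)) * down_part n ?w) * (1 / of_real t))) sums ?inner t"
      unfolding down_part_def
    proof (rule inner_integral_sums[where g="\<lambda>n i v. if n \<le> i then v ^ (i - n) else 0", OF t _ bd _ _ _ w \<alpha>])
      show "(if h * of_int (int n - int i) \<in> {..0} then exp (\<beta> * of_real (h * of_int (int n - int i))) else 0)
          = (if n \<le> i then ?w ^ (i - n) else 0)" for n i
        by (cases "n \<le> i") (simp_all only: atMost_iff site_sign pw if_True if_False simp_thms)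
      show "(if h * of_int (int n - int i) \<in> {..0} then 1 else 0) = (if n \<le> i then 1 ^ (i - n) else (0::complex))" for n i
        by (simp only: atMost_iff site_sign power_one)
    qed (use integrable_part in auto)
  qed (use norm_part_le w in \<open>auto simp: part_0\<close>)
  then show ?thesis by (simp add: kappa_hat_def mult.assoc)
qed

context
  fixes \<alpha> :: real
  assumes \<alpha>: "\<alpha> > 0"
begin

lemma rho_bounds: "0 \<le> lam / (lam + \<alpha>)" "lam / (lam + \<alpha>) < 1"
  using lam_pos \<alpha> by auto

text \<open>After exchanging the sums, the coefficient of \<open>w ^ k\<close> collects over all
  \<open>n\<close> the probabilities of being \<open>k\<close> steps up after \<open>n\<close>
  jumps, and Kemperman's formula evaluates it.\<close>

lemma exp_up_series:
  assumes w: "norm w \<le> 1"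
  shows "exp (- levy_series (lam / (lam + \<alpha>)) (\<lambda>n. up_part n w)) = 1 - of_real (w0 \<alpha>) * w"
proof -
  let ?\<rho> = "lam / (lam + \<alpha>)"
  define a where "a n k = (if 1 \<le> k \<and> k \<le> Suc n then pmf (iid_sum step_pmf (Suc n)) (Suc n - k) else 0)" for n k
  define r where "r n = ?\<rho> ^ Suc n / real (Suc n)" for n
  have wb: "0 < w0 \<alpha>" "w0 \<alpha> < 1" using w0_bounds \<alpha> by auto
  have a_fin: "a n sums (\<Sum>k\<in>{1..Suc n}. a n k)" for n
    by (rule sums_finite) (auto simp: a_def)
  have "(\<Sum>k\<in>{1..Suc n}. a n k) \<le> 1" for n
  proof -
    have "(\<Sum>k\<in>{1..Suc n}. a n k) = (\<Sum>i\<in>{..n}. pmf (iid_sum step_pmf (Suc n)) i)"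
      by (rule sum.reindex_bij_witness[of _ "\<lambda>i. Suc n - i" "\<lambda>k. Suc n - k"]) (auto simp: a_def simp del: iid_sum.simps)
    also have "\<dots> = measure (iid_sum step_pmf (Suc n)) {..n}"
      by (rule measure_measure_pmf_finite[symmetric]) simp
    finally show ?thesis by (simp only: measure_pmf.prob_le_1)
  qed
  then have a1: "suminf (a n) \<le> 1" for n using a_fin[of n] by (simp only: sums_iff)
  have up: "(\<Sum>k. of_real (a n k) * w ^ k) = up_part (Suc n) w" for n
  proof -
    have "(\<Sum>k. of_real (a n k) * w ^ k) = (\<Sum>k\<in>{1..Suc n}. of_real (a n k) * w ^ k)"
      by (rule suminf_finite) (auto simp: a_def)
    also have "\<dots> = (\<Sum>i\<in>{..n}. pmf (iid_sum step_pmf (Suc n)) i *\<^sub>R (if i < Suc n then w ^ (Suc n - i) else 0))"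
      by (rule sum.reindex_bij_witness[of _ "\<lambda>i. Suc n - i" "\<lambda>k. Suc n - k"])
         (auto simp: a_def scaleR_conv_of_real simp del: iid_sum.simps)
    also have "\<dots> = up_part (Suc n) w"
      unfolding up_part_def by (rule integral_measure_pmf[symmetric]) (auto split: if_splits)
    finally show ?thesis .
  qed
  \<comment> \<open>\<open>first_hit\<close> carries the factor \<open>k / n\<close>; dividing by
    \<open>k\<close> leaves exactly the weight \<open>1 / n\<close> of the series, and summation
    gives \<open>w0 \<alpha> ^ k / k\<close>.\<close>
  have coeff: "(\<Sum>n. r n * a n k) = (if k = 0 then 0 else w0 \<alpha> ^ k / real k)" for k
  proof (cases k)
    case 0
    then show ?thesis by (simp add: a_def)
  next
    case (Suc j)
    have "(\<lambda>n. ?\<rho> ^ n * first_hit step_pmf n k) sums w0 \<alpha> ^ k"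
      by (rule first_hit_sums[OF rho_bounds]) (use wb w0_root[OF \<alpha>] in \<open>auto simp: add.commute\<close>)
    then have "(\<lambda>n. ?\<rho> ^ Suc n * first_hit step_pmf (Suc n) k) sums w0 \<alpha> ^ k"
      by (subst sums_Suc_iff) (simp add: first_hit_def Suc)
    then have "(\<lambda>n. ?\<rho> ^ Suc n * first_hit step_pmf (Suc n) k / real k) sums (w0 \<alpha> ^ k / real k)"
      by (rule sums_divide)
    moreover have "?\<rho> ^ Suc n * first_hit step_pmf (Suc n) k / real k = r n * a n k" for n
      using Suc by (simp add: first_hit_def r_def a_def del: iid_sum.simps power_Suc of_nat_Suc)
    ultimately show ?thesis using Suc by (simp add: sums_iff)
  qed
  have "(\<lambda>n. of_real (r n) * up_part (Suc n) w) sums (\<Sum>k. of_real (\<Sum>n. r n * a n k) * w ^ k)"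
    unfolding up[symmetric]
  proof (rule powser_swap(2)[OF _ _ _ _ a1 w])
    show "0 \<le> r n" for n using rho_bounds by (simp add: r_def del: power_Suc of_nat_Suc)
    show "summable r" unfolding r_def[abs_def] by (rule levy_coeff[OF rho_bounds])
    show "0 \<le> a n k" for n k by (simp add: a_def del: iid_sum.simps)
    show "summable (a n)" for n by (rule sums_summable[OF a_fin])
  qed
  then have "levy_series ?\<rho> (\<lambda>n. up_part n w) = (\<Sum>k. of_real (\<Sum>n. r n * a n k) * w ^ k)"
    by (simp add: levy_series_def r_def sums_iff del: power_Suc of_nat_Suc)
  also have "\<dots> = - Ln (1 - of_real (w0 \<alpha>) * w)"
  proof -
    have "norm (of_real (w0 \<alpha>) * w) \<le> w0 \<alpha> * 1"
      unfolding norm_mult using w wb by (intro mult_mono) auto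
    then have "norm (of_real (w0 \<alpha>) * w) < 1" using wb by simp
    from log_series[OF this]
    have "(\<lambda>n. of_real (\<Sum>m. r m * a m (Suc n)) * w ^ Suc n) sums (- Ln (1 - of_real (w0 \<alpha>) * w))"
      by (simp add: coeff power_mult_distrib del: power_Suc of_nat_Suc)
    then have "(\<lambda>n. of_real (\<Sum>m. r m * a m n) * w ^ n) sums (- Ln (1 - of_real (w0 \<alpha>) * w))"
      by (subst (asm) sums_Suc_iff) (simp add: coeff)
    then show ?thesis by (simp add: sums_iff)
  qed
  finally have "levy_series ?\<rho> (\<lambda>n. up_part n w) = - Ln (1 - of_real (w0 \<alpha>) * w)" .
  moreover have "1 - of_real (w0 \<alpha>) * w \<noteq> 0"
  proof
    assume "1 - of_real (w0 \<alpha>) * w = 0"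
    then have "norm (of_real (w0 \<alpha>) * w) = 1" by (metis eq_iff_diff_eq_0 norm_one)
    then have "1 \<le> w0 \<alpha> * 1" using w wb mult_left_mono[OF w, of "w0 \<alpha>"] by (simp add: norm_mult)
    then show False using wb by simp
  qed
  ultimately show ?thesis by simp
qed

text \<open>The coefficients stay anonymous: the point is their absolute summability, which yields
  continuity on the closed disc and holomorphy inside.\<close>

lemma down_series:
  obtains q :: "nat \<Rightarrow> real" where "summable (\<lambda>k. \<bar>q k\<bar>)"
    "\<And>w. norm w \<le> 1 \<Longrightarrow> levy_series (lam / (lam + \<alpha>)) (\<lambda>n. down_part n w) = (\<Sum>k. of_real (q k) * w ^ k)"
proof -
  let ?\<rho> = "lam / (lam + \<alpha>)"
  define a where "a n k = pmf (iid_sum step_pmf (Suc n)) (k + Suc n)" for n k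
  define r where "r n = ?\<rho> ^ Suc n / real (Suc n)" for n
  have r: "0 \<le> r n" "summable r" for n
    using levy_coeff[OF rho_bounds] rho_bounds by (auto simp: r_def[abs_def] simp del: power_Suc of_nat_Suc)
  have as: "a n sums (1 - (\<Sum>i<Suc n. pmf (iid_sum step_pmf (Suc n)) i))" for n
    unfolding a_def by (rule sums_split_initial_segment[OF pmf_nat_sums_1])
  have a: "0 \<le> a n k" "summable (a n)" "suminf (a n) \<le> 1" for n k
  proof -
    show "0 \<le> a n k" by (simp add: a_def del: iid_sum.simps)
    show "summable (a n)" by (rule sums_summable[OF as])
    have "0 \<le> (\<Sum>i<Suc n. pmf (iid_sum step_pmf (Suc n)) i)" by (rule sum_nonneg) simp
    then show "suminf (a n) \<le> 1" using sums_unique[OF as[of n]] by linarith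
  qed
  have down: "(\<Sum>k. of_real (a n k) * w ^ k) = down_part (Suc n) w" if w: "norm w \<le> 1" for n w
  proof -
    have "(\<lambda>i. pmf (iid_sum step_pmf (Suc n)) i *\<^sub>R (if Suc n \<le> i then w ^ (i - Suc n) else 0)) sums down_part (Suc n) w"
      unfolding down_part_def
      by (rule pmf_nat_expectation_sums[where C=1]) (use w in \<open>auto simp: norm_power power_le_one\<close>)
    from sums_split_initial_segment[OF this, of "Suc n"] show ?thesis
      by (simp add: a_def scaleR_conv_of_real sums_iff del: iid_sum.simps)
  qed
  show ?thesis
  proof
    have "0 \<le> (\<Sum>n. r n * a n k)" for k
    proof (rule suminf_nonneg)
      have "a n k \<le> 1" for n by (simp add: a_def pmf_le_1 del: iid_sum.simps)
      then show "summable (\<lambda>n. r n * a n k)"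
        by (intro summable_comparison_test'[OF r(2)]) (use r a in \<open>auto simp: abs_mult intro!: mult_left_le\<close>)
    qed (use r a in auto)
    then show "summable (\<lambda>k. \<bar>\<Sum>n. r n * a n k\<bar>)"
      using powser_swap(1)[of r a 0] r a by simp
    show "levy_series ?\<rho> (\<lambda>n. down_part n w) = (\<Sum>k. of_real (\<Sum>n. r n * a n k) * w ^ k)" if "norm w \<le> 1" for w
      using powser_swap(2)[of r a w] r a that
      by (simp add: down levy_series_def r_def sums_iff del: power_Suc of_nat_Suc)
  qed
qed

lemma continuous_on_down_series:
  "continuous_on (cball 0 1) (\<lambda>w. levy_series (lam / (lam + \<alpha>)) (\<lambda>n. down_part n w))"
proof -
  obtain q :: "nat \<Rightarrow> real" where q: "summable (\<lambda>k. \<bar>q k\<bar>)"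
    "\<And>w. norm w \<le> 1 \<Longrightarrow> levy_series (lam / (lam + \<alpha>)) (\<lambda>n. down_part n w) = (\<Sum>k. of_real (q k) * w ^ k)"
    by (rule down_series) (rule that)
  show ?thesis
    by (rule continuous_on_eq[OF continuous_on_powser_cball[OF q(1)]]) (simp add: q(2))
qed

text \<open>
  On the unit circle the factorisation is the logarithmic series of \<open>1 - \<rho> * pgf w / w\<close>; the
  maximum modulus principle extends it to the disc.
\<close>

lemma exp_down_series:
  assumes w: "norm w \<le> 1"
  shows "exp (- levy_series (lam / (lam + \<alpha>)) (\<lambda>n. down_part n w)) * (w - of_real (w0 \<alpha>))
    = w - of_real (lam / (lam + \<alpha>)) * pgf step_pmf w"
proof -
  let ?\<rho> = "lam / (lam + \<alpha>)"
  define Q where "Q w = levy_series ?\<rho> (\<lambda>n. down_part n w)" for w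
  \<comment> \<open>The factorisation on the circle contains \<open>1 / w\<close>. Multiplied by
    \<open>w\<close> it becomes the vanishing of a function holomorphic in the whole open
    disc.\<close>
  define D where "D w = exp (- Q w) * (w - of_real (w0 \<alpha>)) - (w - of_real ?\<rho> * pgf step_pmf w)" for w
  have cont: "continuous_on (cball 0 1) D"
    unfolding D_def Q_def by (intro continuous_intros continuous_on_down_series continuous_on_pgf)
  have Qhol: "Q holomorphic_on ball 0 1"
  proof -
    obtain q :: "nat \<Rightarrow> real" where q: "summable (\<lambda>k. \<bar>q k\<bar>)"
      "\<And>w. norm w \<le> 1 \<Longrightarrow> levy_series (lam / (lam + \<alpha>)) (\<lambda>n. down_part n w) = (\<Sum>k. of_real (q k) * w ^ k)"
      by (rule down_series) (rule that)
    show ?thesis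
      by (rule holomorphic_transform[OF powser_holomorphic[OF q(1)]]) (simp add: q(2) Q_def)
  qed
  have "pgf step_pmf holomorphic_on (ball 0 1 :: complex set)"
    unfolding pgf_def by (rule powser_holomorphic[OF summable_abs_pmf])
  with Qhol have hol: "D holomorphic_on ball 0 1"
    unfolding D_def by (intro holomorphic_intros)
  have circle: "D v = 0" if v: "norm v = 1" for v
  proof -
    have v0: "v \<noteq> 0" and iv: "norm (inverse v) \<le> 1" using v by (auto simp: norm_inverse)
    let ?u = "pgf step_pmf v / v"
    have u: "norm ?u \<le> 1"
      using norm_pgf_le[of v step_pmf] v by (simp add: norm_divide)
    \<comment> \<open>The strict inequality \<open>\<rho> < 1\<close> keeps the argument inside the
      disc of convergence of the logarithm, uniformly on the circle.\<close>
    have nz: "norm (of_real ?\<rho> * ?u) < 1"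
    proof -
      have "norm (of_real ?\<rho> * ?u) = ?\<rho> * norm ?u"
        using rho_bounds by (simp only: norm_mult norm_of_real abs_of_nonneg)
      also have "\<dots> \<le> ?\<rho> * 1" using u rho_bounds by (intro mult_left_mono)
      finally show ?thesis using rho_bounds by simp
    qed
    have "(\<lambda>n. of_real (?\<rho> ^ Suc n / real (Suc n)) * up_part (Suc n) (inverse v)
        + of_real (?\<rho> ^ Suc n / real (Suc n)) * down_part (Suc n) v) sums
       (levy_series ?\<rho> (\<lambda>n. up_part n (inverse v)) + Q v)"
      unfolding levy_series_def Q_def
      by (intro sums_add summable_sums summable_norm_cancel[OF summable_levy_series] rho_bounds norm_part_le iv)
         (simp add: v)
    moreover have "of_real (?\<rho> ^ Suc n / real (Suc n)) * up_part (Suc n) (inverse v)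
        + of_real (?\<rho> ^ Suc n / real (Suc n)) * down_part (Suc n) v = (of_real ?\<rho> * ?u) ^ Suc n / of_nat (Suc n)" for n
    proof -
      have "of_real (x ^ Suc n / real (Suc n)) * y ^ Suc n = (of_real x * y) ^ Suc n / of_nat (Suc n)" for x :: real and y :: complex
        by (simp add: power_mult_distrib del: power_Suc of_nat_Suc)
      then show ?thesis unfolding distrib_left[symmetric] up_down_sum[OF v] .
    qed
    ultimately have "levy_series ?\<rho> (\<lambda>n. up_part n (inverse v)) + Q v = - Ln (1 - of_real ?\<rho> * ?u)"
      using log_series[OF nz] sums_unique2 by (metis (no_types, lifting) sums_cong)
    moreover have "1 - of_real ?\<rho> * ?u \<noteq> 0"
      using nz by (metis eq_iff_diff_eq_0 less_irrefl norm_one)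
    ultimately have "exp (- (levy_series ?\<rho> (\<lambda>n. up_part n (inverse v)) + Q v)) = 1 - of_real ?\<rho> * ?u"
      by simp
    then have "(1 - of_real (w0 \<alpha>) * inverse v) * exp (- Q v) = 1 - of_real ?\<rho> * ?u"
      using exp_up_series[OF iv] by (simp add: exp_diff exp_minus divide_inverse)
    then have "v * ((1 - of_real (w0 \<alpha>) * inverse v) * exp (- Q v)) = v * (1 - of_real ?\<rho> * ?u)" by simp
    moreover have "v * ((1 - x * inverse v) * y) = y * (v - x)" "v * (1 - x * (y / v)) = v - x * y" for x y
      using v0 by (simp_all add: field_simps)
    ultimately show ?thesis by (simp only: D_def) simp
  qed
  have "norm (D w) \<le> 0"
    by (rule maximum_modulus_frontier[of D "cball 0 1"])
       (use hol cont circle w in \<open>auto simp: frontier_cball\<close>)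
  then show ?thesis by (simp add: D_def Q_def)
qed

end

section \<open>Closed forms of the kappa functions and their constants\<close>

lemma kappa_star_closed_form:
  assumes \<alpha>: "\<alpha> > 0" and \<beta>: "Re \<beta> \<ge> 0"
  shows "kappa_star c M X (of_real \<alpha>) \<beta>
    = of_real (c / (1 - w0 1)) * (1 - exp (- (\<beta> + of_real (Phi \<nu> \<alpha>)) * of_real h))"
proof -
  have w: "norm (exp (- (\<beta> * of_real h))) \<le> 1" using \<beta> h_pos by simp
  \<comment> \<open>The normalising factor is the same series at \<open>\<alpha> = 1\<close> and
    \<open>w = 1\<close>; its inverse is the origin of \<open>1 / (1 - w0 1)\<close>.\<close>
  have "exp (- levy_series (lam / (lam + 1)) (\<lambda>n. up_part n 1)) = 1 - of_real (w0 1) * 1"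
    by (rule exp_up_series) auto
  then have e1: "exp (levy_series (lam / (lam + 1)) (\<lambda>n. up_part n 1)) = inverse (1 - of_real (w0 1))"
    by (metis exp_minus inverse_inverse_eq mult.right_neutral)
  have e2: "of_real (w0 \<alpha>) * exp (- (\<beta> * of_real h)) = exp (- (\<beta> + of_real (Phi \<nu> \<alpha>)) * of_real h)"
    by (simp add: w0_def algebra_simps flip: exp_add exp_of_real)
  show ?thesis
    unfolding kappa_star_eq_series[OF \<alpha> \<beta>] exp_up_series[OF \<alpha> w] e1 e2
    by (simp only: divide_inverse of_real_mult of_real_inverse of_real_diff of_real_1)
qed

text \<open>At \<open>\<alpha> = 1\<close>, \<open>w = 1\<close> the generating function is 1, so
  \<open>exp_down_series\<close> evaluates the normalising factor as
  \<open>(lam + 1) * (1 - w0 1)\<close>, whose \<open>lam + 1\<close> cancels against the no-jump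
  quotient.\<close>

lemma kappa_hat_eq_down_series:
  assumes \<alpha>: "\<alpha> > 0" and \<beta>: "Re \<beta> \<ge> 0"
  shows "kappa_hat c M X (of_real \<alpha>) \<beta> = of_real (c * (1 - w0 1) * (lam + \<alpha>))
    * exp (- levy_series (lam / (lam + \<alpha>)) (\<lambda>n. down_part n (exp (- (\<beta> * of_real h)))))"
proof -
  have nz: "lam + 1 \<noteq> 0" using lam_pos by simp
  have "exp (- levy_series (lam / (lam + 1)) (\<lambda>n. down_part n 1)) * (1 - of_real (w0 1))
      = 1 - of_real (lam / (lam + 1)) * pgf step_pmf 1"
    by (rule exp_down_series) auto
  also have "\<dots> = of_real (1 - lam / (lam + 1))"
    by (simp only: pgf_1 mult.right_neutral of_real_diff of_real_1)
  also have "1 - lam / (lam + 1) = 1 / (lam + 1)" using nz by (simp add: field_simps)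
  finally have "exp (levy_series (lam / (lam + 1)) (\<lambda>n. down_part n 1)) * of_real (1 / (lam + 1))
      = exp (levy_series (lam / (lam + 1)) (\<lambda>n. down_part n 1))
        * (exp (- levy_series (lam / (lam + 1)) (\<lambda>n. down_part n 1)) * (1 - of_real (w0 1)))" by simp
  also have "\<dots> = 1 - of_real (w0 1)"
    unfolding mult.assoc[symmetric] exp_minus_inverse by simp
  finally have *: "exp (levy_series (lam / (lam + 1)) (\<lambda>n. down_part n 1)) * of_real (1 / (lam + 1)) = 1 - of_real (w0 1)" .
  have "of_real ((lam + \<alpha>) / (lam + 1)) * exp (levy_series (lam / (lam + 1)) (\<lambda>n. down_part n 1))
      = of_real (lam + \<alpha>) * (exp (levy_series (lam / (lam + 1)) (\<lambda>n. down_part n 1)) * of_real (1 / (lam + 1)))"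
    by simp
  also have "\<dots> = of_real ((1 - w0 1) * (lam + \<alpha>))"
    unfolding * by (simp add: mult.commute)
  finally have **: "of_real ((lam + \<alpha>) / (lam + 1)) * exp (levy_series (lam / (lam + 1)) (\<lambda>n. down_part n 1))
      = of_real ((1 - w0 1) * (lam + \<alpha>))" .
  show ?thesis
    unfolding kappa_hat_eq_series[OF \<alpha> \<beta>] mult.assoc[of "of_real c"] **
    by (simp only: of_real_mult mult.assoc)
qed

lemma kappa_hat_product:
  assumes \<alpha>: "\<alpha> > 0" and \<beta>: "Re \<beta> \<ge> 0"
  shows "kappa_hat c M X (of_real \<alpha>) \<beta> * (1 - exp ((\<beta> - of_real (Phi \<nu> \<alpha>)) * of_real h))
    = of_real (c * (1 - w0 1)) * (of_real \<alpha> - laplace_exponent \<nu> \<beta>)"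
proof -
  let ?w = "exp (- (\<beta> * of_real h))"
  let ?Q = "levy_series (lam / (lam + \<alpha>)) (\<lambda>n. down_part n ?w)"
  have w: "norm ?w \<le> 1" using \<beta> h_pos by simp
  have nz: "complex_of_real (lam + \<alpha>) \<noteq> 0" using lam_pos \<alpha> by (simp del: of_real_add)
  have ew: "of_real (w0 \<alpha>) = ?w * exp ((\<beta> - of_real (Phi \<nu> \<alpha>)) * of_real h)"
    by (simp add: w0_def algebra_simps flip: exp_add exp_of_real)
  have "of_real (lam + \<alpha>) * (exp (- ?Q) * (?w - of_real (w0 \<alpha>))) = of_real (\<alpha> + lam) * ?w - of_real lam * pgf step_pmf ?w"
    unfolding exp_down_series[OF \<alpha> w] using nz by (simp add: field_simps)
  also have "\<dots> = ?w * (of_real \<alpha> - laplace_exponent \<nu> \<beta>)"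
    using exponent_pgf[OF w, of \<alpha>] by simp
  finally have "?w * (of_real (lam + \<alpha>) * exp (- ?Q) * (1 - exp ((\<beta> - of_real (Phi \<nu> \<alpha>)) * of_real h)))
      = ?w * (of_real \<alpha> - laplace_exponent \<nu> \<beta>)"
    unfolding ew by (simp add: algebra_simps)
  then have "of_real (lam + \<alpha>) * exp (- ?Q) * (1 - exp ((\<beta> - of_real (Phi \<nu> \<alpha>)) * of_real h))
      = of_real \<alpha> - laplace_exponent \<nu> \<beta>"
    by (rule iffD1[OF mult_left_cancel[OF exp_not_eq_zero]])
  then show ?thesis
    unfolding kappa_hat_eq_down_series[OF \<alpha> \<beta>] by (simp only: of_real_mult mult.assoc)
qed

text \<open>The downward series makes \<open>kappa_hat\<close> continuous along the positive reals,
  so its value at the root follows from the product formula at neighbouring points.\<close>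

lemma kappa_hat_root:
  assumes \<alpha>: "\<alpha> > 0"
  defines "b \<equiv> Phi \<nu> \<alpha>"
  shows "kappa_hat c M X (of_real \<alpha>) (of_real b) = of_real (c * (1 - w0 1) * deriv psi b / h)"
proof -
  define K where "K x = kappa_hat c M X (of_real \<alpha>) (of_real x)" for x :: real
  have b: "b > 0" using Phi_pos[OF \<alpha>] by (simp add: b_def)
  have "continuous_on {0<..} (\<lambda>x. of_real (c * (1 - w0 1) * (lam + \<alpha>))
    * exp (- levy_series (lam / (lam + \<alpha>)) (\<lambda>n. down_part n (exp (- (complex_of_real x * of_real h))))))"
    by (intro continuous_intros continuous_on_compose2[OF continuous_on_down_series[OF \<alpha>]])
       (use h_pos in auto)
  then have "continuous_on {0<..} K"
    by (rule continuous_on_eq) (simp add: K_def kappa_hat_eq_down_series[OF \<alpha>])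
  then have "isCont K b"
    using b by (simp add: continuous_on_eq_continuous_at)
  then have cont: "isCont (\<lambda>x. Re (K x)) b" "isCont (\<lambda>x. Im (K x)) b"
    unfolding isCont_def by (auto intro: tendsto_Re tendsto_Im)
  have eq: "K x * of_real (1 - exp ((x - b) * h)) = of_real (c * (1 - w0 1) * (\<alpha> - psi x))" if "x > 0" for x
  proof -
    have "Re (complex_of_real x) \<ge> 0" using that by simp
    moreover have "exp ((complex_of_real x - of_real (Phi \<nu> \<alpha>)) * of_real h) = of_real (exp ((x - b) * h))"
      by (simp add: b_def flip: exp_of_real)
    ultimately show ?thesis
      using kappa_hat_product[OF \<alpha>, of "of_real x" c]
      by (simp only: K_def laplace_exponent_of_real of_real_diff of_real_mult of_real_1)
  qed
  \<comment> \<open>\<open>quotient_at_root\<close> compares real functions; the real part carries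
    the constant, and the imaginary part shows that the value is real.\<close>
  have re: "(\<alpha> - psi x) * (c * (1 - w0 1)) = (1 - exp ((x - b) * h)) * Re (K x)" if "x > 0" for x
    using arg_cong[OF eq[OF that], of Re] by (simp add: mult_ac)
  have im: "(\<alpha> - psi x) * 0 = (1 - exp ((x - b) * h)) * Im (K x)" if "x > 0" for x
    using arg_cong[OF eq[OF that], of Im] by auto
  have "deriv psi b * (c * (1 - w0 1)) = h * Re (K b)"
    unfolding b_def by (rule quotient_at_root[OF \<alpha>]) (use cont re in \<open>auto simp: b_def\<close>)
  moreover have "deriv psi b * 0 = h * Im (K b)"
    unfolding b_def by (rule quotient_at_root[OF \<alpha>]) (use cont im in \<open>auto simp: b_def\<close>)
  ultimately show ?thesis
    using h_pos by (intro complex_eqI) (simp_all add: K_def[symmetric] field_simps)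
qed

end

theorem theorem3p10:
  fixes M :: "'a measure" and F :: "real \<Rightarrow> 'a measure" and X :: "real \<Rightarrow> 'a \<Rightarrow> real"
    and \<nu> :: "real measure" and h c_star c_hat :: real
  assumes chain: "upwards_skip_free_levy_chain M F X \<nu> h"
    and c_star: "c_star > 0" and c_hat: "c_hat > 0"
  shows
   "(\<forall>p e. p > 0 \<longrightarrow> independent_exponential M X p e \<longrightarrow>
      (\<forall>\<alpha>::real. \<alpha> \<ge> 0 \<longrightarrow>
        (\<forall>\<beta>::complex. Re \<beta> \<ge> 0 \<longrightarrow>
          (\<integral>\<omega>. exp (- of_real (\<alpha> * first_sup_time X (e \<omega>) \<omega>)
                    - \<beta> * of_real (running_sup X (e \<omega>) \<omega>)) \<partial>M)
            = (1 - exp (- of_real (Phi \<nu> p * h)))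
              / (1 - exp (- (\<beta> + of_real (Phi \<nu> (p + \<alpha>))) * of_real h))
        \<and> (of_real (p + \<alpha>) \<noteq> laplace_exponent \<nu> \<beta> \<longrightarrow>
          (\<integral>\<omega>. exp (- of_real (\<alpha> * last_inf_time X (e \<omega>) \<omega>)
                    + \<beta> * of_real (running_inf X (e \<omega>) \<omega>)) \<partial>M)
            = of_real p / (of_real (p + \<alpha>) - laplace_exponent \<nu> \<beta>)
              * ((1 - exp ((\<beta> - of_real (Phi \<nu> (p + \<alpha>))) * of_real h))
                 / (1 - exp (- of_real (Phi \<nu> p * h))))))
      \<and> (\<exists>!\<beta>\<^sub>0::real. \<beta>\<^sub>0 > 0 \<and> laplace_exponent \<nu> \<beta>\<^sub>0 = p + \<alpha>)
      \<and> (\<forall>\<beta>\<^sub>0::real. \<beta>\<^sub>0 > 0 \<and> laplace_exponent \<nu> \<beta>\<^sub>0 = p + \<alpha> \<longrightarrow>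
          \<beta>\<^sub>0 = Phi \<nu> (p + \<alpha>)
        \<and> (\<integral>\<omega>. exp (- of_real (\<alpha> * last_inf_time X (e \<omega>) \<omega>)
                    + complex_of_real \<beta>\<^sub>0 * of_real (running_inf X (e \<omega>) \<omega>)) \<partial>M)
            = of_real (p * h / (deriv (laplace_exponent \<nu>) \<beta>\<^sub>0 * (1 - exp (- Phi \<nu> p * h))))
        \<and> p * h / (deriv (laplace_exponent \<nu>) \<beta>\<^sub>0 * (1 - exp (- Phi \<nu> p * h)))
            = p * h * deriv (Phi \<nu>) (p + \<alpha>) / (1 - exp (- Phi \<nu> p * h)))))
  \<and> (\<exists>k_star k_hat :: real. k_star > 0 \<and> k_hat > 0 \<and>
      (\<forall>\<alpha>::real. \<alpha> > 0 \<longrightarrow>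
        (\<forall>\<beta>::complex. Re \<beta> \<ge> 0 \<longrightarrow>
          kappa_star c_star M X (of_real \<alpha>) \<beta>
            = of_real k_star * (1 - exp (- (\<beta> + of_real (Phi \<nu> \<alpha>)) * of_real h))
        \<and> (of_real \<alpha> \<noteq> laplace_exponent \<nu> \<beta> \<longrightarrow>
          kappa_hat c_hat M X (of_real \<alpha>) \<beta>
            = of_real k_hat * ((of_real \<alpha> - laplace_exponent \<nu> \<beta>)
                / (1 - exp ((\<beta> - of_real (Phi \<nu> \<alpha>)) * of_real h)))))
      \<and> (\<exists>!\<beta>\<^sub>0::real. \<beta>\<^sub>0 > 0 \<and> laplace_exponent \<nu> \<beta>\<^sub>0 = \<alpha>)
      \<and> (\<forall>\<beta>\<^sub>0::real. \<beta>\<^sub>0 > 0 \<and> laplace_exponent \<nu> \<beta>\<^sub>0 = \<alpha> \<longrightarrow>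
          \<beta>\<^sub>0 = Phi \<nu> \<alpha>
        \<and> kappa_hat c_hat M X (of_real \<alpha>) (of_real \<beta>\<^sub>0)
            = of_real (k_hat * deriv (laplace_exponent \<nu>) \<beta>\<^sub>0 / h)
        \<and> k_hat * deriv (laplace_exponent \<nu>) \<beta>\<^sub>0 / h = k_hat / (h * deriv (Phi \<nu>) \<alpha>))))"
proof -
  interpret upwards_skip_free_levy_chain M F X \<nu> h by (rule chain)
  have w0_exp: "w0 r = exp (- Phi \<nu> r * h)" "complex_of_real (w0 r) = exp (- of_real (Phi \<nu> r * h))" for r
    by (simp_all add: w0_def flip: exp_of_real)
  have w01: "0 < 1 - w0 1" using w0_bounds[of 1] by simp
  have first: "(\<integral>\<omega>. exp (- of_real (\<alpha> * first_sup_time X (e \<omega>) \<omega>) - \<beta> * of_real (running_sup X (e \<omega>) \<omega>)) \<partial>M)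
        = (1 - exp (- of_real (Phi \<nu> p * h))) / (1 - exp (- (\<beta> + of_real (Phi \<nu> (p + \<alpha>))) * of_real h))"
    if "p > 0" "independent_exponential M X p e" "\<alpha> \<ge> 0" "Re \<beta> \<ge> 0" for p e \<alpha> and \<beta> :: complex
  proof -
    have "exp (- (\<beta> + of_real (Phi \<nu> (p + \<alpha>))) * of_real h) = of_real (w0 (p + \<alpha>)) * exp (- (\<beta> * of_real h))"
      by (simp add: w0_def algebra_simps flip: exp_add exp_of_real)
    then show ?thesis
      unfolding w0_exp(2)[symmetric] using sup_transform[OF that] by (simp only:)
  qed
  have second: "(\<integral>\<omega>. exp (- of_real (\<alpha> * last_inf_time X (e \<omega>) \<omega>) + \<beta> * of_real (running_inf X (e \<omega>) \<omega>)) \<partial>M)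
        = of_real p / (of_real (p + \<alpha>) - laplace_exponent \<nu> \<beta>)
          * ((1 - exp ((\<beta> - of_real (Phi \<nu> (p + \<alpha>))) * of_real h)) / (1 - exp (- of_real (Phi \<nu> p * h))))"
    if "p > 0" "independent_exponential M X p e" "\<alpha> \<ge> 0" "Re \<beta> \<ge> 0"
      "of_real (p + \<alpha>) \<noteq> laplace_exponent \<nu> \<beta>" for p e \<alpha> and \<beta> :: complex
  proof -
    have nz: "of_real (p + \<alpha>) - laplace_exponent \<nu> \<beta> \<noteq> 0" using that by simp
    have k: "of_real (p / (1 - w0 p)) = complex_of_real p / (1 - exp (- of_real (Phi \<nu> p * h)))"
      by (simp only: of_real_divide of_real_diff of_real_1 w0_exp(2))
    have "(\<integral>\<omega>. exp (- of_real (\<alpha> * last_inf_time X (e \<omega>) \<omega>) + \<beta> * of_real (running_inf X (e \<omega>) \<omega>)) \<partial>M)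
        = of_real (p / (1 - w0 p)) * (1 - exp ((\<beta> - of_real (Phi \<nu> (p + \<alpha>))) * of_real h))
          / (of_real (p + \<alpha>) - laplace_exponent \<nu> \<beta>)"
      unfolding inf_transform_product[OF that(1-4), symmetric]
      by (rule nonzero_mult_div_cancel_left[OF nz, symmetric])
    then show ?thesis unfolding k by (simp only: divide_inverse mult_ac)
  qed
  have root: "\<beta>\<^sub>0 = Phi \<nu> (p + \<alpha>)
        \<and> (\<integral>\<omega>. exp (- of_real (\<alpha> * last_inf_time X (e \<omega>) \<omega>)
                    + complex_of_real \<beta>\<^sub>0 * of_real (running_inf X (e \<omega>) \<omega>)) \<partial>M)
            = of_real (p * h / (deriv (laplace_exponent \<nu>) \<beta>\<^sub>0 * (1 - exp (- Phi \<nu> p * h))))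
        \<and> p * h / (deriv (laplace_exponent \<nu>) \<beta>\<^sub>0 * (1 - exp (- Phi \<nu> p * h)))
            = p * h * deriv (Phi \<nu>) (p + \<alpha>) / (1 - exp (- Phi \<nu> p * h))"
    if "p > 0" "independent_exponential M X p e" "\<alpha> \<ge> 0" "\<beta>\<^sub>0 > 0 \<and> psi \<beta>\<^sub>0 = p + \<alpha>" for p e \<alpha> \<beta>\<^sub>0
  proof -
    have r: "0 < p + \<alpha>" using that by simp
    then have b: "\<beta>\<^sub>0 = Phi \<nu> (p + \<alpha>)" using psi_eq_iff_Phi that by blast
    show ?thesis
      using inf_transform_root[OF that(1-3)] DERIV_psi_Phi(3)[OF r] unfolding b w0_exp(1)
      by (simp add: divide_inverse mult_ac)
  qed
  have kappa_root: "\<beta>\<^sub>0 = Phi \<nu> \<alpha>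
        \<and> kappa_hat c_hat M X (of_real \<alpha>) (of_real \<beta>\<^sub>0) = of_real (c_hat * (1 - w0 1) * deriv (laplace_exponent \<nu>) \<beta>\<^sub>0 / h)
        \<and> c_hat * (1 - w0 1) * deriv (laplace_exponent \<nu>) \<beta>\<^sub>0 / h = c_hat * (1 - w0 1) / (h * deriv (Phi \<nu>) \<alpha>)"
    if "\<alpha> > 0" "\<beta>\<^sub>0 > 0 \<and> psi \<beta>\<^sub>0 = \<alpha>" for \<alpha> \<beta>\<^sub>0
  proof -
    have b: "\<beta>\<^sub>0 = Phi \<nu> \<alpha>" using psi_eq_iff_Phi that by blast
    show ?thesis
      using kappa_hat_root[OF that(1), of c_hat] DERIV_psi_Phi(3)[OF that(1)] unfolding b
      by (simp add: divide_inverse mult_ac)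
  qed
  have kappa: "kappa_hat c_hat M X (of_real \<alpha>) \<beta> = of_real (c_hat * (1 - w0 1)) * ((of_real \<alpha> - laplace_exponent \<nu> \<beta>)
                / (1 - exp ((\<beta> - of_real (Phi \<nu> \<alpha>)) * of_real h)))"
    if "\<alpha> > 0" "Re \<beta> \<ge> 0" "of_real \<alpha> \<noteq> laplace_exponent \<nu> \<beta>" for \<alpha> \<beta>
  proof -
    \<comment> \<open>A vanishing denominator would, by the product formula and since the constant
      is nonzero, force \<alpha> to equal the exponent at \<beta>; so division is
      legitimate.\<close>
    have "complex_of_real (c_hat * (1 - w0 1)) \<noteq> 0" using c_hat w01 by (simp del: of_real_mult)
    then have "of_real (c_hat * (1 - w0 1)) * (of_real \<alpha> - laplace_exponent \<nu> \<beta>) \<noteq> 0" using that(3) by simp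
    then have "1 - exp ((\<beta> - of_real (Phi \<nu> \<alpha>)) * of_real h) \<noteq> 0"
      unfolding kappa_hat_product[OF that(1,2), symmetric] by (metis mult_zero_right)
    then show ?thesis using kappa_hat_product[OF that(1,2), of c_hat] by (simp only: eq_divide_eq times_divide_eq_right) simp
  qed
  show ?thesis
  proof (intro conjI allI impI, goal_cases)
    case (1 p e \<alpha> \<beta>)
    then show ?case by (rule first)
  next
    case (2 p e \<alpha> \<beta>)
    then show ?case by (rule second)
  next
    case (3 p e \<alpha>)
    then show ?case by (intro ex1_psi_root) simp
  next
    case (4 p e \<alpha> \<beta>\<^sub>0)
    from root[OF this] show ?case by (rule conjunct1)
  next
    case (5 p e \<alpha> \<beta>\<^sub>0)
    from root[OF this] show ?case by (elim conjE)
  next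
    case (6 p e \<alpha> \<beta>\<^sub>0)
    from root[OF this] show ?case by (elim conjE)
  next
    case 7
    show ?case
    \<comment> \<open>The constants come from normalising by \<open>exp (- t)\<close>, that is from
      \<alpha> = 1; both are positive because \<open>w0 1 < 1\<close>.\<close>
    proof (rule exI[of _ "c_star / (1 - w0 1)"], rule exI[of _ "c_hat * (1 - w0 1)"],
        intro conjI allI impI, goal_cases)
      case 1
      show ?case using c_star w01 by simp
    next
      case 2
      show ?case using c_hat w01 by simp
    next
      case (3 \<alpha> \<beta>)
      then show ?case by (rule kappa_star_closed_form)
    next
      case (4 \<alpha> \<beta>)
      then show ?case by (rule kappa)
    next
      case (5 \<alpha>)
      then show ?case by (rule ex1_psi_root)
    next
      case (6 \<alpha> \<beta>\<^sub>0)
      from kappa_root[OF this] show ?case by (elim conjE)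
    next
      case (7 \<alpha> \<beta>\<^sub>0)
      from kappa_root[OF this] show ?case by (elim conjE)
    next
      case (8 \<alpha> \<beta>\<^sub>0)
      from kappa_root[OF this] show ?case by (elim conjE)
    qed
  qed
qed

end
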